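(* Let $s\in\mathbb{N}$ and let $\boldsymbol{p}=(p_1,\ldots,p_s)$ be a vector of $s$ mutually different prime numbers. Let $\widehat{L}_{2,N,\boldsymbol{1}}(\mathcal{H}_{\boldsymbol{p}})$ denote the root mean square (RMS) $L_2$-discrepancy of the $\boldsymbol{p}$-adically shifted Halton sequence $\mathcal{H}_{\boldsymbol{p}}$. Then $$\widehat{L}_{2,N,\boldsymbol{1}}(\mathcal{H}_{\boldsymbol{p}})\ll_s\frac{(\log N)^{s/2}}{N}.$$ According to Proinov's result that every sequence $\mathcal{S}$ in $[0,1)^s$ satisfies $L_{2,N,\boldsymbol{1}}(\mathcal{S})\gg_s\frac{(\log N)^{s/2}}{N}$ for infinitely many $N\in\mathbb{N}$, this bound is best possible in the order of magnitude in $N$. In particular, for every $N\ge2$ there exists a $\boldsymbol{p}$-adic shift $\boldsymbol{\sigma}_*$ (which depends on $N$) such that the $L_2$-discrepancy of $\mathcal{H}_{\boldsymbol{p},\boldsymbol{\sigma}_*}$ satisfies $$L_{2,N,\boldsymbol{1}}(\mathcal{H}_{\boldsymbol{p},\boldsymbol{\sigma}_*})\ll_s\frac{(\log N)^{s/2}}{N}.$$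
   Context: Notation: $\log$ is the natural logarithm and $[s]=\{1,\ldots,s\}$. For $f,g:\mathbb{N}\to\mathbb{R}^+$, $g(N)\ll f(N)$ (or $g(N)\gg f(N)$) means that there exists $C>0$ such that $g(N)\le Cf(N)$ (or $g(N)\ge Cf(N)$) for all $N\in\mathbb{N}$, $N\ge2$; with the addition "for infinitely many $N$" the inequality is only claimed for infinitely many $N$. A subscript, as in $\ll_s$ or $\gg_s$, indicates that $C$ may also depend on the variable in the subscript. $L_2$-discrepancy: for a sequence $\mathcal{S}=(\boldsymbol{x}_n)_{n\ge0}$ in $[0,1)^s$ and $\boldsymbol{t}=(t_1,\ldots,t_s)\in[0,1]^s$ let $\Delta_N(\boldsymbol{t})=\frac1N\sum_{n=0}^{N-1}1_{[\boldsymbol{0},\boldsymbol{t})}(\boldsymbol{x}_n)-\prod_{i=1}^st_i$, where $1_{[\boldsymbol{0},\boldsymbol{t})}$ is the characteristic function of $[\boldsymbol{0},\boldsymbol{t})=[0,t_1)\times\cdots\times[0,t_s)$. For $\mathfrak{u}\subseteq[s]$ let $(\boldsymbol{t}_{\mathfrak{u}},\boldsymbol{1})$ be the point $\boldsymbol{t}$ with all components $t_j$, $j\notin\mathfrak{u}$, replaced by $1$. In the unweighted case (all weights equal to one), $$L_{2,N,\boldsymbol{1}}(\mathcal{S})=\left(\sum_{\emptyset\ne\mathfrak{u}\subseteq[s]}\int_{[0,1]^{|\mathfrak{u}|}}|\Delta_N(\boldsymbol{t}_{\mathfrak{u}},\boldsymbol{1})|^2\,\mathrm{d}\boldsymbol{t}_{\mathfrak{u}}\right)^{1/2}.$$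 Halton sequence: for a prime $p$ and $n=n_0+n_1p+n_2p^2+\cdots\in\mathbb{N}_0$ (base $p$ expansion) let $\phi_p(n)=\sum_{k\ge1}n_{k-1}p^{-k}$. Then $\mathcal{H}_{\boldsymbol{p}}=(\boldsymbol{x}_n)_{n\ge0}$ with $\boldsymbol{x}_n=(\phi_{p_1}(n),\ldots,\phi_{p_s}(n))$. $\boldsymbol{p}$-adic shift: let $\mathbb{Z}_p$ be the set of $z=\sum_{r\ge0}z_rp^r$, $z_r\in\{0,\ldots,p-1\}$, with $p$-adic addition. Extend $\phi_p$ to $\phi_p:\mathbb{Z}_p\to[0,1)$, $\phi_p(z)=\sum_{r\ge0}z_rp^{-r-1}\pmod 1$, and let $\phi_p^+:[0,1)\to\mathbb{Z}_p$, $\phi_p^+(\sum_{r\ge0}x_rp^{-r-1})=\sum_{r\ge0}x_rp^r$, always using the finite base $p$ expansion when one exists. For $x,\sigma\in[0,1)$ put $x\oplus_p\sigma=\phi_p(\phi_p^+(x)+\phi_p^+(\sigma))$, and for $\boldsymbol{x},\boldsymbol{\sigma}\in[0,1)^s$ put $\boldsymbol{x}\oplus_{\boldsymbol{p}}\boldsymbol{\sigma}=(x_1\oplus_{p_1}\sigma_1,\ldots,x_s\oplus_{p_s}\sigma_s)$. For a shift $\boldsymbol{\sigma}\in[0,1)^s$ let $\mathcal{H}_{\boldsymbol{p},\boldsymbol{\sigma}}=(\boldsymbol{x}_n\oplus_{\boldsymbol{p}}\boldsymbol{\sigma})_{n\ge0}$, where $(\boldsymbol{x}_n)_{n\ge0}=\mathcal{H}_{\boldsymbol{p}}$.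 RMS $L_2$-discrepancy: $\widehat{L}_{2,N,\boldsymbol{1}}(\mathcal{H}_{\boldsymbol{p}})=\sqrt{\mathbb{E}_{\boldsymbol{\sigma}}[L_{2,N,\boldsymbol{1}}(\mathcal{H}_{\boldsymbol{p},\boldsymbol{\sigma}})^2]}$, where the components of $\boldsymbol{\sigma}$ are independent and uniformly distributed in $[0,1)$.
   Formalization: The constants in both upper bounds may depend on the primes p as well as on s; a constant depending on s alone is impossible, since for s = 1 and N = (p-1)/2 the shifted points leave an interval of length at least 1/4 empty, so the discrepancy stays bounded below. *)

theory Defs
  imports "HOL-Probability.Probability" "HOL-Computational_Algebra.Primes"
begin

text \<open>Points of \<open>[0,1)\<^sup>s\<close> are extensional functions on the index set \<open>{1..s}\<close>, and a sequence of
  such points has type \<open>nat \<Rightarrow> nat \<Rightarrow> real\<close> (first argument: position in the sequence).\<close>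

definition unit_cube :: "nat \<Rightarrow> (nat \<Rightarrow> real) set" where
  "unit_cube s = Pi\<^sub>E {1..s} (\<lambda>_. {0..<1})"

section \<open>Discrepancy\<close>

definition local_discrepancy :: "nat \<Rightarrow> (nat \<Rightarrow> nat \<Rightarrow> real) \<Rightarrow> nat \<Rightarrow> (nat \<Rightarrow> real) \<Rightarrow> real" where
  "local_discrepancy s x N t =
     1 / real N * (\<Sum>n<N. indicator (Pi\<^sub>E {1..s} (\<lambda>i. {0..<t i})) (x n)) - (\<Prod>i\<in>{1..s}. t i)"

definition fill_ones :: "nat \<Rightarrow> nat set \<Rightarrow> (nat \<Rightarrow> real) \<Rightarrow> nat \<Rightarrow> real" where
  "fill_ones s u t = (\<lambda>i\<in>{1..s}. if i \<in> u then t i else 1)"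

definition L2_discrepancy :: "nat \<Rightarrow> nat \<Rightarrow> (nat \<Rightarrow> nat \<Rightarrow> real) \<Rightarrow> real" where
  "L2_discrepancy s N x =
     sqrt (\<Sum>u | u \<noteq> {} \<and> u \<subseteq> {1..s}.
       (LINT t : Pi\<^sub>E u (\<lambda>_. {0..1}) | Pi\<^sub>M u (\<lambda>_. lborel).
          \<bar>local_discrepancy s x N (fill_ones s u t)\<bar>\<^sup>2))"

section \<open>p-adic integers and the p-adic shift\<close>

text \<open>A p-adic integer is represented by its sequence of digits, least significant digit first.\<close>

definition padic_ints :: "nat \<Rightarrow> (nat \<Rightarrow> nat) set" where
  "padic_ints p = {z. \<forall>r. z r < p}"

fun padic_carry :: "nat \<Rightarrow> (nat \<Rightarrow> nat) \<Rightarrow> (nat \<Rightarrow> nat) \<Rightarrow> nat \<Rightarrow> nat" where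
  "padic_carry p z w 0 = 0"
| "padic_carry p z w (Suc r) = (z r + w r + padic_carry p z w r) div p"

definition padic_add :: "nat \<Rightarrow> (nat \<Rightarrow> nat) \<Rightarrow> (nat \<Rightarrow> nat) \<Rightarrow> nat \<Rightarrow> nat" where
  "padic_add p z w r = (z r + w r + padic_carry p z w r) mod p"

lemma padic_add_truncated:
  "(\<Sum>r<k. padic_add p z w r * p ^ r) + padic_carry p z w k * p ^ k
     = (\<Sum>r<k. z r * p ^ r) + (\<Sum>r<k. w r * p ^ r)"
proof (induction k)
  case 0
  show ?case by simp
next
  case (Suc k)
  let ?m = "z k + w k + padic_carry p z w k"
  have "padic_add p z w k * p ^ k + padic_carry p z w (Suc k) * p ^ Suc k
      = (?m mod p + ?m div p * p) * p ^ k"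
    by (simp only: padic_add_def padic_carry.simps power_Suc distrib_right mult.assoc)
  also have "\<dots> = ?m * p ^ k" by (simp only: mod_div_mult_eq)
  also have "\<dots> = z k * p ^ k + w k * p ^ k + padic_carry p z w k * p ^ k"
    by (simp only: distrib_right)
  finally show ?case using Suc by (simp del: padic_carry.simps power_Suc)
qed

definition digit_value :: "nat \<Rightarrow> (nat \<Rightarrow> nat) \<Rightarrow> real" where
  "digit_value p z = (\<Sum>r. real (z r) / real p ^ Suc r)"

definition radical_inverse :: "nat \<Rightarrow> nat \<Rightarrow> real" where
  "radical_inverse p n = digit_value p (\<lambda>k. n div p ^ k mod p)"

definition padic_phi :: "nat \<Rightarrow> (nat \<Rightarrow> nat) \<Rightarrow> real" where
  "padic_phi p z = frac (digit_value p z)"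

text \<open>The base-\<open>p\<close> digits of \<open>x \<in> [0,1)\<close>. The floor selects the finite expansion whenever there is
  one; see \<open>padic_phi_plus_value\<close> and \<open>padic_phi_plus_finite\<close> below.\<close>

definition padic_phi_plus :: "nat \<Rightarrow> real \<Rightarrow> nat \<Rightarrow> nat" where
  "padic_phi_plus p x r = nat (\<lfloor>x * real p ^ Suc r\<rfloor> mod int p)"

lemma padic_phi_plus_in_padic_ints: "p > 0 \<Longrightarrow> padic_phi_plus p x \<in> padic_ints p"
  by (auto simp: padic_ints_def padic_phi_plus_def nat_less_iff)

lemma padic_phi_plus_partial_sum:
  assumes "p > 0" "0 \<le> x" "x < 1"
  shows "(\<Sum>r<k. real (padic_phi_plus p x r) / real p ^ Suc r) = \<lfloor>x * real p ^ k\<rfloor> / real p ^ k"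
proof (induction k)
  case 0
  have "\<lfloor>x\<rfloor> = 0" using assms by linarith
  then show ?case by simp
next
  case (Suc k)
  let ?a = "\<lfloor>x * real p ^ Suc k\<rfloor>"
  have "x * real p ^ k = x * real p ^ Suc k / real_of_int (int p)"
    using assms by simp
  then have "\<lfloor>x * real p ^ k\<rfloor> = ?a div int p"
    by (metis floor_divide_real_eq_div of_nat_0_le_iff)
  then have a: "?a = \<lfloor>x * real p ^ k\<rfloor> * int p + ?a mod int p" by simp
  have "real (padic_phi_plus p x k) = real_of_int (?a mod int p)"
    using assms by (simp add: padic_phi_plus_def)
  then show ?case
    using Suc assms arg_cong[OF a, of real_of_int] by (simp add: field_simps)
qed

lemma padic_phi_plus_sums:
  assumes "p \<ge> 2" "0 \<le> x" "x < 1"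
  shows "(\<lambda>r. real (padic_phi_plus p x r) / real p ^ Suc r) sums x"
proof -
  have "(\<lambda>k. (1 / real p) ^ k) \<longlonglongrightarrow> 0"
    using assms by (intro LIMSEQ_power_zero) auto
  then have lo: "(\<lambda>k. x - (1 / real p) ^ k) \<longlonglongrightarrow> x"
    by (auto intro: tendsto_eq_intros)
  have "(\<lambda>k. \<lfloor>x * real p ^ k\<rfloor> / real p ^ k) \<longlonglongrightarrow> x"
  proof (rule tendsto_sandwich[OF _ _ lo tendsto_const])
    have "x - (1 / real p) ^ k \<le> \<lfloor>x * real p ^ k\<rfloor> / real p ^ k" for k
    proof -
      have pk: "real p ^ k > 0" using assms by simp
      have "x * real p ^ k - 1 \<le> \<lfloor>x * real p ^ k\<rfloor>" by linarith
      then have "(x * real p ^ k - 1) / real p ^ k \<le> \<lfloor>x * real p ^ k\<rfloor> / real p ^ k"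
        using pk by (intro divide_right_mono) auto
      moreover have "(x * real p ^ k - 1) / real p ^ k = x - (1 / real p) ^ k"
        using assms by (simp add: diff_divide_distrib power_one_over)
      ultimately show ?thesis by simp
    qed
    then show "\<forall>\<^sub>F k in sequentially. x - (1 / real p) ^ k \<le> \<lfloor>x * real p ^ k\<rfloor> / real p ^ k" by simp
    have "\<lfloor>x * real p ^ k\<rfloor> / real p ^ k \<le> x" for k
      using assms by (simp add: divide_le_eq)
    then show "\<forall>\<^sub>F k in sequentially. \<lfloor>x * real p ^ k\<rfloor> / real p ^ k \<le> x" by simp
  qed
  then show ?thesis
    unfolding sums_def using assms by (simp add: padic_phi_plus_partial_sum del: power_Suc)
qed

lemma padic_phi_plus_value:
  assumes "p \<ge> 2" "0 \<le> x" "x < 1"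
  shows "digit_value p (padic_phi_plus p x) = x"
  using padic_phi_plus_sums[OF assms] unfolding digit_value_def by (rule sums_unique[symmetric])

lemma padic_phi_plus_finite:
  assumes "p \<ge> 2" and "x * real p ^ k \<in> \<int>" and "r \<ge> k"
  shows "padic_phi_plus p x r = 0"
proof -
  obtain m where m: "x * real p ^ k = of_int m" using assms(2) by (auto elim: Ints_cases)
  have "x * real p ^ Suc r = x * real p ^ k * real p ^ (Suc r - k)"
    using assms(3) by (simp add: power_add[symmetric] mult.assoc del: power_Suc)
  also have "\<dots> = of_int (m * int p ^ (Suc r - k))" using m by simp
  finally have "\<lfloor>x * real p ^ Suc r\<rfloor> = m * int p ^ (Suc r - k)" by (metis floor_of_int)
  then show ?thesis
    using assms(3) by (simp add: padic_phi_plus_def Suc_diff_le)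
qed

definition padic_shift :: "nat \<Rightarrow> real \<Rightarrow> real \<Rightarrow> real" where
  "padic_shift p x \<sigma> = padic_phi p (padic_add p (padic_phi_plus p x) (padic_phi_plus p \<sigma>))"

section \<open>Shifted Halton sequences\<close>

definition halton :: "nat \<Rightarrow> (nat \<Rightarrow> nat) \<Rightarrow> nat \<Rightarrow> nat \<Rightarrow> real" where
  "halton s p n = (\<lambda>i\<in>{1..s}. radical_inverse (p i) n)"

definition shifted_halton :: "nat \<Rightarrow> (nat \<Rightarrow> nat) \<Rightarrow> (nat \<Rightarrow> real) \<Rightarrow> nat \<Rightarrow> nat \<Rightarrow> real" where
  "shifted_halton s p \<sigma> n = (\<lambda>i\<in>{1..s}. padic_shift (p i) (halton s p n i) (\<sigma> i))"

definition uniform_shift :: "nat \<Rightarrow> (nat \<Rightarrow> real) measure" where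
  "uniform_shift s = Pi\<^sub>M {1..s} (\<lambda>_. uniform_measure lborel {0..<1})"

definition RMS_L2_discrepancy :: "nat \<Rightarrow> nat \<Rightarrow> (nat \<Rightarrow> nat) \<Rightarrow> real" where
  "RMS_L2_discrepancy s N p =
     sqrt (LINT \<sigma> | uniform_shift s. (L2_discrepancy s N (shifted_halton s p \<sigma>))\<^sup>2)"

end

theory Submission
  imports Defs "HOL-Number_Theory.Cong"
begin

text \<open>Write \<open>N \<Delta>\<^sub>N\<close> for the discrepancy function without the factor \<open>1/N\<close>. The claim is that the mean over the
shift of \<open>\<integral> (N \<Delta>\<^sub>N)\<^sup>2\<close>, summed over the projections, is at most of order \<open>(log N)\<^sup>s\<close>, and that for every
sequence the mean over \<open>N < 2\<^sup>m\<close> of the same quantity is at least of order \<open>m\<^sup>s\<close>.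

Upper bound. Warnock's formula (\<open>has_cube_integral_squared_discrepancy\<close>) expands the integral into
terms that are products over the coordinates. The shift makes the coordinates independent, and the
Halton sequence is the orbit of \<open>0\<close> under adding \<open>1\<close> in the product of the rings of \<open>p\<^sub>i\<close>-adic integers, on
which the shift is Haar-distributed. So the expectation is
\<open>\<Sum>\<^sub>n\<^sub>,\<^sub>m (\<Prod>\<^sub>i \<kappa>\<^sub>i(n - m) - 3\<^bsup>-|u|\<^esup>)\<close> with explicit kernels \<open>\<kappa>\<^sub>i\<close>. Each kernel is the constant \<open>1/3\<close> plus a
sum over levels \<open>r \<ge> 1\<close> of functions of period \<open>p\<^sub>i\<^sup>r\<close> and mean zero, which vanish off the multiples of
\<open>p\<^sub>i\<^bsup>r-1\<^esup>\<close> and are at most \<open>p\<^sub>i\<^bsup>-(r-1)\<^esup>\<close> (\<open>sum_level_terms\<close> and the lemmas after it). A product of level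
functions, not all of level \<open>0\<close>, has by the Chinese remainder theorem mean zero over its period \<open>Q\<close>; hence
its double sum over \<open>n, m < N\<close> equals the one over \<open>n, m < N mod Q\<close>, and there the sparse support makes it
bounded independently of \<open>N\<close> and of the levels (\<open>double_sum_level_product_bound\<close>). Levels above a
multiple of \<open>log N\<close> contribute \<open>O(1)\<close> in total, so the bound is the number of level vectors,
\<open>O((log N)\<^sup>s)\<close>. A shift that is no worse than the mean exists.

Lower bound (Roth's method in the form of Proinov). The pairs \<open>(n, x\<^sub>n)\<close>, \<open>n < 2\<^sup>m\<close>, form a point set of one
dimension more. For each of about \<open>m\<^sup>s\<close> shapes the space-time cube is cut into \<open>2\<^bsup>m+1\<^esup>\<close> dyadic boxes; at
least half of them contain no point. The inner product of the discrepancy with the Haar function of an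
empty box comes from the volume part alone and has the same value for all empty boxes
(\<open>sum_box_coefficient\<close>). The Haar functions are orthogonal (\<open>sum_box_inner\<close>), so Bessel's inequality
gives a lower bound for \<open>\<Sum>\<^sub>N \<integral> (N \<Delta>\<^sub>N)\<^sup>2\<close> over \<open>N < 2\<^sup>m\<close> (\<open>sum_squared_discrepancy_lower_bound\<close>). Because
this bound concerns the mean over \<open>N\<close>, it may be integrated over the shift, which gives the lower bound
for the root mean square as well.\<close>

section \<open>Sums of periodic functions\<close>

lemma sum_lessThan_mult:
  fixes f :: "nat \<Rightarrow> 'a::comm_monoid_add"
  shows "(\<Sum>n<a * b. f n) = (\<Sum>k<a. \<Sum>j<b. f (k * b + j))"
proof (induction a)
  case 0
  then show ?case by simp
next
  case (Suc a)
  have "(\<Sum>n<Suc a * b. f n) = (\<Sum>n<a * b + b. f n)" by (simp add: add.commute)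
  also have "\<dots> = (\<Sum>n<a * b. f n) + (\<Sum>n = a * b..<a * b + b. f n)"
    by (simp add: lessThan_atLeast0 sum.atLeastLessThan_concat)
  also have "(\<Sum>n = a * b..<a * b + b. f n) = (\<Sum>j<b. f (a * b + j))"
    using sum.shift_bounds_nat_ivl[of f 0 "a * b" b]
    by (simp add: lessThan_atLeast0 add.commute)
  finally show ?case using Suc.IH by simp
qed

lemma sum_mod_shift:
  fixes f :: "nat \<Rightarrow> 'a::comm_monoid_add"
  assumes "q > 0"
  shows "(\<Sum>b<q. f ((b + n) mod q)) = (\<Sum>b<q. f b)"
proof -
  let ?h = "\<lambda>b. (b + n) mod q"
  have inj: "inj_on ?h {..<q}"
  proof (rule inj_onI)
    fix a b assume ab: "a \<in> {..<q}" "b \<in> {..<q}" "?h a = ?h b"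
    then have "[a + n = b + n] (mod q)" by (simp add: cong_def)
    then have "[a = b] (mod q)" by (simp only: cong_add_rcancel_nat)
    then show "a = b" using ab by (simp add: cong_def)
  qed
  have "?h ` {..<q} \<subseteq> {..<q}" using assms by auto
  then have img: "?h ` {..<q} = {..<q}" using inj by (simp add: endo_inj_surj)
  have "(\<Sum>b<q. f b) = (\<Sum>b\<in>?h ` {..<q}. f b)" by (simp only: img)
  then show ?thesis by (simp add: sum.reindex[OF inj])
qed

definition periodic :: "nat \<Rightarrow> (int \<Rightarrow> real) \<Rightarrow> bool" where
  "periodic q f \<longleftrightarrow> (\<forall>x. f (x + int q) = f x)"

lemma periodic_mult_int:
  assumes "periodic q f"
  shows "f (x + int q * k) = f x"
proof -
  have nat: "f (x + int q * int m) = f x" for x m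
  proof (induction m)
    case (Suc m)
    have "f (x + int q * int (Suc m)) = f (x + int q * int m + int q)"
      by (simp add: algebra_simps)
    then show ?case using Suc assms by (simp add: periodic_def)
  qed simp
  show ?thesis
  proof (cases "k \<ge> 0")
    case True
    then show ?thesis using nat[of x "nat k"] by simp
  next
    case False
    then show ?thesis using nat[of "x + int q * k" "nat (- k)"] by simp
  qed
qed

lemma periodic_dvd:
  assumes "periodic q f" "q dvd r"
  shows "periodic r f"
  using assms periodic_mult_int[OF assms(1)] by (auto simp: periodic_def elim!: dvdE)

lemma periodic_cong:
  assumes "periodic q f" "x mod int q = y mod int q"
  shows "f x = f y"
proof -
  have "x = y + int q * (x div int q - y div int q)"
    using assms(2) mult_div_mod_eq[of "int q" x] mult_div_mod_eq[of "int q" y]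
    unfolding right_diff_distrib by linarith
  then show ?thesis using periodic_mult_int[OF assms(1)] by metis
qed

lemma sum_periodic_shift:
  assumes "periodic q f"
  shows "(\<Sum>n<q. f (int n + c)) = (\<Sum>n<q. f (int n))"
proof (cases "q = 0")
  case False
  then have q: "int q > 0" by simp
  let ?g = "\<lambda>n. nat ((int n + c) mod int q)"
  have inj: "inj_on ?g {..<q}"
  proof (rule inj_onI)
    fix a b assume ab: "a \<in> {..<q}" "b \<in> {..<q}" "?g a = ?g b"
    then have "(int a + c) mod int q = (int b + c) mod int q" using q by (simp add: nat_eq_iff)
    then have "int a mod int q = int b mod int q"
      by (metis add_diff_cancel_right' mod_diff_left_eq)
    then show "a = b" using ab by simp
  qed
  have "?g ` {..<q} \<subseteq> {..<q}" using q by (auto simp: nat_less_iff)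
  then have img: "?g ` {..<q} = {..<q}"
    using inj by (simp add: endo_inj_surj)
  have "(\<Sum>n<q. f (int n)) = (\<Sum>n\<in>?g ` {..<q}. f (int n))" by (simp only: img)
  also have "\<dots> = (\<Sum>n<q. f (int (?g n)))" by (simp add: sum.reindex[OF inj])
  also have "\<dots> = (\<Sum>n<q. f (int n + c))"
    using q by (intro sum.cong refl periodic_cong[OF assms]) simp
  finally show ?thesis by simp
qed simp

text \<open>Chinese remainder theorem: if the residue modulo \<open>b\<close> is kept fixed, then \<open>g\<close> is constant and the argument
of \<open>f\<close> still runs through all residues modulo \<open>a\<close>.\<close>

lemma sum_periodic_coprime:
  assumes "periodic a f" "periodic b g" "coprime a b" "a > 0" "b > 0"
    and zero: "(\<Sum>n<a. f (int n)) = 0"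
  shows "(\<Sum>n<a * b. f (int n) * g (int n)) = 0"
proof -
  have inner: "(\<Sum>k<a. f (int (k * b + j))) = 0" for j
  proof -
    let ?h = "\<lambda>k. (k * b + j) mod a"
    have inj: "inj_on ?h {..<a}"
    proof (rule inj_onI)
      fix k l assume kl: "k \<in> {..<a}" "l \<in> {..<a}" "?h k = ?h l"
      then have "[k * b + j = l * b + j] (mod a)" by (simp add: cong_def)
      then have "[k = l] (mod a)"
        using assms(3) by (metis cong_add_rcancel_nat cong_mult_rcancel_nat coprime_commute)
      then show "k = l" using kl by (simp add: cong_def)
    qed
    have "?h ` {..<a} \<subseteq> {..<a}" using assms(4) by auto
    then have img: "?h ` {..<a} = {..<a}" using inj by (simp add: endo_inj_surj)
    have "0 = (\<Sum>n\<in>?h ` {..<a}. f (int n))" by (simp only: img zero)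
    also have "\<dots> = (\<Sum>k<a. f (int (?h k)))" by (simp add: sum.reindex[OF inj])
    also have "\<dots> = (\<Sum>k<a. f (int (k * b + j)))"
      by (intro sum.cong refl periodic_cong[OF assms(1)]) (simp add: zmod_int)
    finally show ?thesis by simp
  qed
  have g: "g (int (k * b + j)) = g (int j)" for k j
    using periodic_mult_int[OF assms(2), of "int j" "int k"] by (simp add: algebra_simps)
  have "(\<Sum>n<a * b. f (int n) * g (int n)) = (\<Sum>k<a. \<Sum>j<b. f (int (k * b + j)) * g (int j))"
    by (simp only: sum_lessThan_mult g)
  also have "\<dots> = (\<Sum>j<b. (\<Sum>k<a. f (int (k * b + j))) * g (int j))"
    by (subst sum.swap) (simp only: sum_distrib_right)
  also have "\<dots> = 0" by (simp only: inner) simp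
  finally show ?thesis .
qed

lemma sum_periodic_mod:
  assumes "periodic q f" and zero: "(\<Sum>n<q. f (int n)) = 0"
  shows "(\<Sum>n<N. f (int n + c)) = (\<Sum>n<N mod q. f (int n + c))"
proof -
  have P: "f (int (k * q + j) + c) = f (int j + c)" for k j
    using periodic_mult_int[OF assms(1), of "int j + c" "int k"] by (simp add: algebra_simps)
  have "(\<Sum>n<N. f (int n + c)) = (\<Sum>n<N div q * q + N mod q. f (int n + c))" by simp
  also have "\<dots> = (\<Sum>n<N div q * q. f (int n + c))
       + (\<Sum>n = N div q * q..<N div q * q + N mod q. f (int n + c))"
    by (simp only: lessThan_atLeast0) (simp add: sum.atLeastLessThan_concat)
  also have "(\<Sum>n<N div q * q. f (int n + c)) = 0"
    by (simp only: sum_lessThan_mult P sum_periodic_shift[OF assms(1)] zero) simp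
  also have "(\<Sum>n = N div q * q..<N div q * q + N mod q. f (int n + c)) = (\<Sum>n<N mod q. f (int n + c))"
    using sum.shift_bounds_nat_ivl[of "\<lambda>n. f (int n + c)" 0 "N div q * q" "N mod q"] P
    by (simp add: lessThan_atLeast0 add.commute)
  finally show ?thesis by simp
qed

text \<open>Full periods contribute nothing, in \<open>n\<close> for fixed \<open>m\<close> and then in \<open>m\<close> for fixed \<open>n\<close>. The gain is that the
remaining ranges are shorter than the period, however large \<open>N\<close> is.\<close>

lemma double_sum_periodic_mod:
  assumes "periodic q f" and zero: "(\<Sum>n<q. f (int n)) = 0"
  shows "(\<Sum>n<N. \<Sum>m<N. f (int n - int m)) = (\<Sum>n<N mod q. \<Sum>m<N mod q. f (int n - int m))"
proof -
  let ?f' = "\<lambda>x. f (- x)"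
  have P': "periodic q ?f'"
    unfolding periodic_def
    using periodic_mult_int[OF assms(1), where k = "-1"] by simp
  have "(\<Sum>n<q. ?f' (int n)) = (\<Sum>n<q. f (int n))"
  proof (cases "q = 0")
    case False
    have "(\<Sum>n<q. ?f' (int n)) = (\<Sum>n<q. ?f' (int (q - Suc n)))"
      by (rule sum.nat_diff_reindex[symmetric])
    also have "\<dots> = (\<Sum>n<q. f (int n + (1 - int q)))"
      by (intro sum.cong refl arg_cong[of _ _ f]) auto
    also have "\<dots> = (\<Sum>n<q. f (int n))" by (rule sum_periodic_shift[OF assms(1)])
    finally show ?thesis .
  qed simp
  then have zero': "(\<Sum>n<q. ?f' (int n)) = 0" using zero by simp
  have "(\<Sum>n<N. \<Sum>m<N. f (int n - int m)) = (\<Sum>m<N. \<Sum>n<N. f (int n + - int m))"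
    by (subst sum.swap) simp
  also have "\<dots> = (\<Sum>m<N. \<Sum>n<N mod q. f (int n + - int m))"
    by (intro sum.cong refl sum_periodic_mod[OF assms])
  also have "\<dots> = (\<Sum>n<N mod q. \<Sum>m<N. ?f' (int m + - int n))"
    by (subst sum.swap) simp
  also have "\<dots> = (\<Sum>n<N mod q. \<Sum>m<N mod q. ?f' (int m + - int n))"
    by (intro sum.cong refl sum_periodic_mod[OF P' zero'])
  finally show ?thesis by simp
qed

text \<open>Each of the at most \<open>P q'\<close> rows has at most \<open>P\<close> nonzero entries, each of size at most \<open>1 / q'\<close>. For a
function of period \<open>P q'\<close> with this support and size the bound no longer depends on the period.\<close>

lemma double_sum_sparse_bound:
  assumes "q' > 0" "b \<le> P * q'"
    and bound: "\<And>d. \<bar>f d\<bar> \<le> 1 / real q'" and supp: "\<And>d. \<not> int q' dvd d \<Longrightarrow> f d = 0"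
  shows "\<bar>\<Sum>n<b. \<Sum>m<b. f (int n - int m)\<bar> \<le> (real P)\<^sup>2"
proof -
  have row: "(\<Sum>m<b. \<bar>f (int n - int m)\<bar>) \<le> real P / real q'" for n
  proof -
    let ?S = "{m\<in>{..<b}. int q' dvd int n - int m}"
    have inj: "inj_on (\<lambda>m. m div q') ?S"
    proof (rule inj_onI)
      fix m l assume ml: "m \<in> ?S" "l \<in> ?S" "m div q' = l div q'"
      then have "int q' dvd (int n - int l) - (int n - int m)"
        by (intro dvd_diff[of "int q'" "int n - int l"]) simp_all
      then have "int m mod int q' = int l mod int q'" by (simp add: mod_eq_dvd_iff)
      then have "m mod q' = l mod q'" by (metis zmod_int of_nat_eq_iff)
      then show "m = l" using ml(3) by (metis div_mult_mod_eq)
    qed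
    have "(\<lambda>m. m div q') ` ?S \<subseteq> {..<P}"
      using assms(1,2) by (auto simp: div_less_iff_less_mult)
    then have "card ?S \<le> card {..<P}" using inj by (intro card_inj_on_le) auto
    then have card: "real (card ?S) \<le> real P" by simp
    have "(\<Sum>m<b. \<bar>f (int n - int m)\<bar>) = (\<Sum>m\<in>?S. \<bar>f (int n - int m)\<bar>)"
      by (intro sum.mono_neutral_right) (auto simp: supp)
    also have "\<dots> \<le> (\<Sum>m\<in>?S. 1 / real q')" by (intro sum_mono bound)
    also have "\<dots> \<le> real P / real q'" using card by (simp add: divide_right_mono)
    finally show ?thesis .
  qed
  have "\<bar>\<Sum>n<b. \<Sum>m<b. f (int n - int m)\<bar> \<le> (\<Sum>n<b. \<Sum>m<b. \<bar>f (int n - int m)\<bar>)"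
    by (intro order_trans[OF sum_abs] sum_mono sum_abs)
  also have "\<dots> \<le> (\<Sum>n<b. real P / real q')" by (intro sum_mono row)
  also have "\<dots> = real b * (real P / real q')" by simp
  also have "\<dots> \<le> real (P * q') * (real P / real q')"
    using assms(2) by (intro mult_right_mono) (simp_all only: of_nat_le_iff, simp)
  also have "\<dots> = (real P)\<^sup>2" using assms by (simp add: power2_eq_square)
  finally show ?thesis .
qed

section \<open>Digit reversal and the mean distance of shifted points\<close>

text \<open>The radical inverse truncated after \<open>k\<close> digits. It is the value of the first \<open>k\<close> digits of any \<open>p\<close>-adic
integer congruent to \<open>b\<close> modulo \<open>p\<^sup>k\<close>, and therefore the finite model of the random point.\<close>

fun digit_reversal :: "nat \<Rightarrow> nat \<Rightarrow> nat \<Rightarrow> real" where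
  "digit_reversal p 0 b = 0"
| "digit_reversal p (Suc k) b = (real (b mod p) + digit_reversal p k (b div p)) / real p"

lemma digit_reversal_bounds:
  assumes "p > 0"
  shows "0 \<le> digit_reversal p k b" "digit_reversal p k b \<le> 1 - 1 / real p ^ k"
proof -
  have "0 \<le> digit_reversal p k b \<and> digit_reversal p k b \<le> 1 - 1 / real p ^ k"
  proof (induction k arbitrary: b)
    case (Suc k)
    have "b mod p < p" using assms by simp
    then have "real (b mod p) + 1 \<le> real p" by linarith
    then have "(real (b mod p) + digit_reversal p k (b div p)) / real p \<le> (real p - 1 / real p ^ k) / real p"
      using Suc.IH[of "b div p"] assms by (intro divide_right_mono) auto
    also have "\<dots> = 1 - 1 / real p ^ Suc k" using assms by (simp add: field_simps)
    finally show ?case using Suc.IH[of "b div p"] assms by simp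
  qed simp
  then show "0 \<le> digit_reversal p k b" "digit_reversal p k b \<le> 1 - 1 / real p ^ k" by auto
qed

lemma sum_lessThan_power_digits:
  fixes f :: "nat \<Rightarrow> 'a::comm_monoid_add"
  shows "(\<Sum>b<p ^ Suc k. f b) = (\<Sum>a<p. \<Sum>c<p ^ k. f (a + p * c))"
proof -
  have "(\<Sum>b<p ^ Suc k. f b) = (\<Sum>b<p ^ k * p. f b)" by (simp add: mult.commute)
  also have "\<dots> = (\<Sum>c<p ^ k. \<Sum>a<p. f (a + p * c))"
    by (simp only: sum_lessThan_mult mult.commute[of p] add.commute)
  also have "\<dots> = (\<Sum>a<p. \<Sum>c<p ^ k. f (a + p * c))" by (rule sum.swap)
  finally show ?thesis .
qed

text \<open>Reversing the digits permutes the fractions with denominator \<open>p\<^sup>k\<close>.\<close>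

lemma sum_digit_reversal:
  fixes f :: "real \<Rightarrow> 'a::comm_monoid_add"
  assumes "p > 0"
  shows "(\<Sum>b<p ^ k. f (digit_reversal p k b)) = (\<Sum>j<p ^ k. f (real j / real p ^ k))"
proof (induction k arbitrary: f)
  case (Suc k)
  have "(\<Sum>b<p ^ Suc k. f (digit_reversal p (Suc k) b))
      = (\<Sum>a<p. \<Sum>c<p ^ k. f ((real a + digit_reversal p k c) / real p))"
    unfolding sum_lessThan_power_digits using assms by (intro sum.cong refl) simp
  also have "\<dots> = (\<Sum>a<p. \<Sum>j<p ^ k. f ((real a + real j / real p ^ k) / real p))"
    by (intro sum.cong refl Suc.IH)
  also have "\<dots> = (\<Sum>a<p. \<Sum>j<p ^ k. f (real (a * p ^ k + j) / real p ^ Suc k))"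
    using assms by (intro sum.cong refl arg_cong[of _ _ f]) (simp add: field_simps)
  also have "\<dots> = (\<Sum>j<p * p ^ k. f (real j / real p ^ Suc k))"
    by (simp only: sum_lessThan_mult)
  finally show ?case by simp
qed simp

lemma inj_on_digit_reversal:
  assumes "p > 0"
  shows "inj_on (digit_reversal p k) {..<p ^ k}"
proof (rule eq_card_imp_inj_on)
  have "real j / real p ^ k \<in> digit_reversal p k ` {..<p ^ k}" if "j < p ^ k" for j
  proof (rule ccontr)
    assume *: "real j / real p ^ k \<notin> digit_reversal p k ` {..<p ^ k}"
    let ?f = "\<lambda>x. if x = real j / real p ^ k then 1::nat else 0"
    have "?f (digit_reversal p k b) = 0" if "b < p ^ k" for b
      using * that by (metis imageI lessThan_iff)
    then have "(\<Sum>b<p ^ k. ?f (digit_reversal p k b)) = 0" by (intro sum.neutral) blast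
    moreover have "(\<Sum>i\<in>{j}. ?f (real i / real p ^ k)) \<le> (\<Sum>i<p ^ k. ?f (real i / real p ^ k))"
      using that by (intro sum_mono2) simp_all
    ultimately show False using sum_digit_reversal[OF assms, of ?f k] by simp
  qed
  then have "(\<lambda>j. real j / real p ^ k) ` {..<p ^ k} \<subseteq> digit_reversal p k ` {..<p ^ k}" by auto
  then have "card ((\<lambda>j. real j / real p ^ k) ` {..<p ^ k}) \<le> card (digit_reversal p k ` {..<p ^ k})"
    by (intro card_mono) auto
  moreover have "card ((\<lambda>j. real j / real p ^ k) ` {..<p ^ k}) = p ^ k"
    using assms by (subst card_image) (auto simp: inj_on_def)
  ultimately show "card (digit_reversal p k ` {..<p ^ k}) = card {..<p ^ k}"
    using card_image_le[of "{..<p ^ k}" "digit_reversal p k"] by simp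
qed simp

lemma digit_reversal_add_period:
  "p > 0 \<Longrightarrow> digit_reversal p k (b + p ^ k * c) = digit_reversal p k b"
proof (induction k arbitrary: b)
  case (Suc k)
  have "(b + p ^ Suc k * c) div p = b div p + p ^ k * c"
    using Suc.prems by (simp add: mult.assoc)
  moreover have "(b + p ^ Suc k * c) mod p = b mod p" by (simp add: mult.assoc)
  ultimately show ?case using Suc by (simp only: digit_reversal.simps)
qed simp

lemma digit_reversal_mod: "p > 0 \<Longrightarrow> digit_reversal p k (b mod p ^ k) = digit_reversal p k b"
  using digit_reversal_add_period[of p k "b mod p ^ k" "b div p ^ k"] by simp

lemma sum_digit_reversal_shift:
  fixes f :: "real \<Rightarrow> 'a::comm_monoid_add"
  assumes "p > 0"
  shows "(\<Sum>b<p ^ k. f (digit_reversal p k (b + n))) = (\<Sum>b<p ^ k. f (digit_reversal p k b))"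
  using sum_mod_shift[of "p ^ k" "\<lambda>b. f (digit_reversal p k b)" n] assms
  by (simp add: digit_reversal_mod)

text \<open>For two points whose indices differ by \<open>d\<close>, the expected value of \<open>max x y\<close> exceeds \<open>1/2\<close> by the gap, which
is half of their mean distance. The recursion removes a common first digit, and the second case is the
explicit value when the first digits differ by \<open>e = d mod p\<close>. The parameter \<open>z\<close> is used for the remainders
after \<open>k\<close> common digits: \<open>z = 0\<close> gives the exact gap of the points truncated to \<open>k\<close> digits, and \<open>z = 1/6\<close>,
the mean of the gap over all \<open>d\<close>, is the value for which \<open>1/2\<close> minus the gap is a sum of level terms.\<close>

fun pair_gap :: "real \<Rightarrow> nat \<Rightarrow> nat \<Rightarrow> int \<Rightarrow> real" where
  "pair_gap z p 0 d = z"
| "pair_gap z p (Suc k) d = (if int p dvd d then pair_gap z p k (d div int p) / real p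
     else real_of_int (d mod int p) * (real p - real_of_int (d mod int p)) / (real p)\<^sup>2)"

text \<open>A rotation by \<open>e\<close> moves \<open>p - e\<close> residues up by \<open>e\<close> and the other \<open>e\<close> residues down by \<open>p - e\<close>.\<close>

lemma sum_abs_rotation:
  assumes "e \<le> p"
  shows "(\<Sum>b<p. \<bar>real ((b + e) mod p) - real b\<bar>) = 2 * real e * (real p - real e)"
proof -
  have "(\<Sum>b<p. \<bar>real ((b + e) mod p) - real b\<bar>)
     = (\<Sum>b<p - e. \<bar>real ((b + e) mod p) - real b\<bar>) + (\<Sum>b=p - e..<p. \<bar>real ((b + e) mod p) - real b\<bar>)"
    unfolding lessThan_atLeast0 by (rule sum.atLeastLessThan_concat[symmetric]) simp_all
  also have "(\<Sum>b<p - e. \<bar>real ((b + e) mod p) - real b\<bar>) = (\<Sum>b<p - e. real e)"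
    by (intro sum.cong) auto
  also have "(\<Sum>b=p - e..<p. \<bar>real ((b + e) mod p) - real b\<bar>) = (\<Sum>b=p - e..<p. real p - real e)"
  proof (intro sum.cong refl)
    fix b assume "b \<in> {p - e..<p}"
    then have "(b + e) mod p = b + e - p" and "b + e \<ge> p" using assms by (auto simp: mod_if)
    then show "\<bar>real ((b + e) mod p) - real b\<bar> = real p - real e" using assms by (simp add: of_nat_diff)
  qed
  finally show ?thesis using assms by (simp add: of_nat_diff algebra_simps)
qed

lemma sum_abs_rotation_shift:
  assumes "p > 0"
  shows "(\<Sum>b<p. \<bar>real ((b + n) mod p) - real ((b + m) mod p)\<bar>)
    = 2 * real_of_int ((int n - int m) mod int p) * (real p - real_of_int ((int n - int m) mod int p))"
proof -
  let ?e = "nat ((int n - int m) mod int p)"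
  have e: "int ?e = (int n - int m) mod int p" "?e \<le> p"
    using assms by (auto simp: nat_le_iff order_less_imp_le)
  let ?h = "\<lambda>b. (b + m) mod p"
  have h: "(?h b + ?e) mod p = (b + n) mod p" for b
  proof -
    have "int ((?h b + ?e) mod p) = (int b + int m + (int n - int m)) mod int p"
      using assms by (simp add: zmod_int mod_add_eq)
    also have "\<dots> = int ((b + n) mod p)" by (simp add: zmod_int)
    finally show ?thesis by simp
  qed
  have "(\<Sum>b<p. \<bar>real ((b + ?e) mod p) - real b\<bar>) = (\<Sum>b<p. \<bar>real ((?h b + ?e) mod p) - real (?h b)\<bar>)"
    using sum_mod_shift[OF assms, of "\<lambda>b. \<bar>real ((b + ?e) mod p) - real b\<bar>" m] by (rule sym)
  also have "\<dots> = (\<Sum>b<p. \<bar>real ((b + n) mod p) - real ((b + m) mod p)\<bar>)"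
    by (simp only: h)
  finally have "(\<Sum>b<p. \<bar>real ((b + n) mod p) - real ((b + m) mod p)\<bar>)
      = 2 * real ?e * (real p - real ?e)"
    unfolding sum_abs_rotation[OF e(2)] by (rule sym)
  moreover have "real ?e = real_of_int ((int n - int m) mod int p)" 
    using arg_cong[OF e(1), of real_of_int] by (simp only: of_int_of_nat_eq)
  ultimately show ?thesis by (simp only:)
qed

text \<open>Split off the lowest digit, which becomes the leading one. If \<open>p\<close> divides \<open>n - m\<close>, the leading digits agree
and the distance is the one of the remaining digits divided by \<open>p\<close>; both carries are the same, so the
indices still differ by the quotient. Otherwise the leading digits decide which point is larger, and
the remaining digits cancel since their mean does not depend on the shift.\<close>

lemma sum_abs_diff_digit_reversal:
  assumes "p > 0"
  shows "(\<Sum>b<p ^ k. \<bar>digit_reversal p k (b + n) - digit_reversal p k (b + m)\<bar>)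
    = 2 * real p ^ k * pair_gap 0 p k (int n - int m)"
proof (induction k arbitrary: n m)
  case (Suc k)
  let ?D = "digit_reversal p"
  have step: "?D (Suc k) (a + p * c + x) = (real ((a + x) mod p) + ?D k (c + (a + x) div p)) / real p" for a c x
  proof -
    have "a + p * c + x = (a + x) + p * c" by simp
    then show ?thesis using assms by (simp only: digit_reversal.simps) (simp add: add.commute)
  qed
  have split: "(\<Sum>b<p ^ Suc k. \<bar>?D (Suc k) (b + n) - ?D (Suc k) (b + m)\<bar>)
     = (\<Sum>a<p. \<Sum>c<p ^ k. \<bar>(real ((a + n) mod p) - real ((a + m) mod p))
           + (?D k (c + (a + n) div p) - ?D k (c + (a + m) div p))\<bar> / real p)"
    unfolding sum_lessThan_power_digits step
    by (intro sum.cong refl) (simp add: diff_divide_distrib[symmetric] abs_divide[symmetric] algebra_simps)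
  show ?case
  proof (cases "int p dvd int n - int m")
    case True
    have eq: "int ((a + n) mod p) = int ((a + m) mod p)"
      and quot: "int ((a + n) div p) - int ((a + m) div p) = (int n - int m) div int p" for a
    proof -
      have "(int a + int n) mod int p = (int a + int m) mod int p"
        using True by (simp add: mod_eq_dvd_iff)
      then show eq: "int ((a + n) mod p) = int ((a + m) mod p)" by (simp add: zmod_int)
      have "int (a + n) - int (a + m) = int p * (int ((a + n) div p) - int ((a + m) div p))"
        using eq by (metis add_diff_cancel_right mult_div_mod_eq of_nat_add of_nat_mult right_diff_distrib')
      then show "int ((a + n) div p) - int ((a + m) div p) = (int n - int m) div int p"
        using assms by simp
    qed
    have zero: "real ((a + n) mod p) - real ((a + m) mod p) = 0" for a using eq by simp
    have "(\<Sum>b<p ^ Suc k. \<bar>?D (Suc k) (b + n) - ?D (Suc k) (b + m)\<bar>)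
      = (\<Sum>a<p. (\<Sum>c<p ^ k. \<bar>?D k (c + (a + n) div p) - ?D k (c + (a + m) div p)\<bar>) / real p)"
      by (simp only: split zero sum_divide_distrib add_0)
    also have "\<dots> = (\<Sum>a<p. 2 * real p ^ k * pair_gap 0 p k ((int n - int m) div int p) / real p)"
      by (simp only: Suc.IH quot)
    finally show ?thesis using True by simp
  next
    case False
    have inner: "(\<Sum>c<p ^ k. \<bar>(real ((a + n) mod p) - real ((a + m) mod p))
           + (?D k (c + (a + n) div p) - ?D k (c + (a + m) div p))\<bar> / real p)
       = real p ^ k * \<bar>real ((a + n) mod p) - real ((a + m) mod p)\<bar> / real p" for a
    proof -
      let ?u = "real ((a + n) mod p) - real ((a + m) mod p)"
      have "(a + n) mod p \<noteq> (a + m) mod p"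
      proof
        assume "(a + n) mod p = (a + m) mod p"
        then have "(int a + int n) mod int p = (int a + int m) mod int p"
          by (metis of_nat_add zmod_int)
        then show False using False by (simp add: mod_eq_dvd_iff)
      qed
      then have u: "\<bar>?u\<bar> \<ge> 1" by linarith
      have expand: "\<bar>v + w\<bar> = \<bar>v\<bar> + sgn v * w" if "\<bar>v\<bar> \<ge> 1" "\<bar>w\<bar> \<le> 1" for v w :: real
        using that by (cases "v > 0") auto
      have "\<bar>?D k x - ?D k y\<bar> \<le> 1" for x y
      proof -
        have "0 \<le> 1 / real p ^ k" by simp
        then show ?thesis
          using digit_reversal_bounds[OF assms, of k x] digit_reversal_bounds[OF assms, of k y]
          unfolding abs_le_iff by linarith
      qed
      then have "\<bar>?u + (?D k x - ?D k y)\<bar> = \<bar>?u\<bar> + sgn ?u * (?D k x - ?D k y)" for x y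
        using u by (intro expand)
      then have "(\<Sum>c<p ^ k. \<bar>?u + (?D k (c + (a + n) div p) - ?D k (c + (a + m) div p))\<bar>)
         = (\<Sum>c<p ^ k. \<bar>?u\<bar>) + sgn ?u * ((\<Sum>c<p ^ k. ?D k (c + (a + n) div p)) - (\<Sum>c<p ^ k. ?D k (c + (a + m) div p)))"
        by (simp only: sum.distrib sum_subtractf sum_distrib_left right_diff_distrib)
      also have "\<dots> = real p ^ k * \<bar>?u\<bar>"
        using sum_digit_reversal_shift[OF assms, of "\<lambda>x. x"] by simp
      finally show ?thesis by (simp add: sum_divide_distrib[symmetric])
    qed
    have "(\<Sum>b<p ^ Suc k. \<bar>?D (Suc k) (b + n) - ?D (Suc k) (b + m)\<bar>)
       = real p ^ k / real p * (\<Sum>a<p. \<bar>real ((a + n) mod p) - real ((a + m) mod p)\<bar>)"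
      by (simp only: split inner sum_distrib_left) (simp add: mult.commute)
    then show ?thesis using False assms
      by (simp add: sum_abs_rotation_shift power2_eq_square)
  qed
qed simp

lemma sum_real_lessThan: "(\<Sum>j<M. real j) = real M * (real M - 1) / 2"
proof (induction M)
  case (Suc M)
  have "x * (x - 1) / 2 + x = (x + 1) * (x + 1 - 1) / 2" for x :: real
    by (simp add: field_simps)
  then show ?case by (simp only: sum.lessThan_Suc Suc.IH of_nat_Suc add.commute[of 1])
qed simp

lemma sum_real_squares_lessThan: "(\<Sum>j<M. (real j)\<^sup>2) = real M * (real M - 1) * (2 * real M - 1) / 6"
proof (induction M)
  case (Suc M)
  have "x * (x - 1) * (2 * x - 1) / 6 + x\<^sup>2 = (x + 1) * (x + 1 - 1) * (2 * (x + 1) - 1) / 6" for x :: real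
    by (simp add: field_simps power2_eq_square)
  then show ?case by (simp only: sum.lessThan_Suc Suc.IH of_nat_Suc add.commute[of 1])
qed simp

lemma mean_digit_reversal:
  assumes "p > 0"
  shows "(\<Sum>b<p ^ k. digit_reversal p k (b + n)) / real p ^ k = (1 - 1 / real p ^ k) / 2"
proof -
  have "(\<Sum>b<p ^ k. digit_reversal p k (b + n)) = (\<Sum>j<p ^ k. real j) / real p ^ k"
    using sum_digit_reversal_shift[OF assms, of "\<lambda>x. x"] sum_digit_reversal[OF assms, of "\<lambda>x. x" k]
    by (simp add: sum_divide_distrib)
  also have "\<dots> = (real p ^ k - 1) / 2" using assms by (simp add: sum_real_lessThan)
  finally show ?thesis using assms by (simp add: diff_divide_distrib)
qed

lemma mean_one_minus_square_digit_reversal: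
  assumes "p > 0"
  shows "\<bar>(\<Sum>b<p ^ k. (1 - (digit_reversal p k (b + n))\<^sup>2) / 2) / real p ^ k - 1 / 3\<bar> \<le> 1 / real p ^ k"
proof -
  let ?M = "real p ^ k"
  have M: "?M \<ge> 1" using assms by simp
  have "(\<Sum>b<p ^ k. (1 - (digit_reversal p k (b + n))\<^sup>2) / 2) = (\<Sum>j<p ^ k. (1 - (real j / ?M)\<^sup>2) / 2)"
    using sum_digit_reversal_shift[OF assms, of "\<lambda>x. (1 - x\<^sup>2) / 2"]
      sum_digit_reversal[OF assms, of "\<lambda>x. (1 - x\<^sup>2) / 2" k] by simp
  also have "\<dots> = ?M / 2 - (\<Sum>j<p ^ k. (real j)\<^sup>2) / ?M\<^sup>2 / 2"
    by (simp add: sum_divide_distrib[symmetric] sum_subtractf power_divide diff_divide_distrib)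
  also have "\<dots> = ?M / 2 - (?M - 1) * (2 * ?M - 1) / (12 * ?M)"
    using M unfolding sum_real_squares_lessThan by (simp add: power2_eq_square)
  finally have total: "(\<Sum>b<p ^ k. (1 - (digit_reversal p k (b + n))\<^sup>2) / 2)
     = ?M / 2 - (?M - 1) * (2 * ?M - 1) / (12 * ?M)" .
  have "(\<Sum>b<p ^ k. (1 - (digit_reversal p k (b + n))\<^sup>2) / 2) / ?M - 1 / 3
     = (3 * ?M - 1) / (12 * ?M\<^sup>2)"
  proof -
    have "(x / 2 - (x - 1) * (2 * x - 1) / (12 * x)) / x - 1 / 3 = (3 * x - 1) / (12 * x\<^sup>2)"
      if "x \<ge> 1" for x :: real
      using that by (simp add: divide_simps power2_eq_square) (simp add: algebra_simps)
    then show ?thesis unfolding total using M by blast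
  qed
  moreover have "(3 * ?M - 1) / (12 * ?M\<^sup>2) \<le> (12 * ?M) / (12 * ?M\<^sup>2)"
    using M by (intro divide_right_mono) auto
  moreover have "(12 * ?M) / (12 * ?M\<^sup>2) = 1 / ?M" using M by (simp add: power2_eq_square)
  moreover have "(3 * ?M - 1) / (12 * ?M\<^sup>2) \<ge> 0" using M by simp
  ultimately show ?thesis by linarith
qed

lemma mean_one_minus_max_digit_reversal:
  assumes "p > 0"
  shows "(\<Sum>b<p ^ k. 1 - max (digit_reversal p k (b + n)) (digit_reversal p k (b + m))) / real p ^ k
    = 1 / 2 + 1 / (2 * real p ^ k) - pair_gap 0 p k (int n - int m)"
proof -
  let ?D = "digit_reversal p k" and ?M = "real p ^ k"
  have max: "1 - max x y = 1 - x / 2 - y / 2 - \<bar>x - y\<bar> / 2" for x y :: real by (auto simp: max_def field_simps)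
  have "(\<Sum>b<p ^ k. 1 - max (?D (b + n)) (?D (b + m)))
     = ?M - (\<Sum>b<p ^ k. ?D (b + n)) / 2 - (\<Sum>b<p ^ k. ?D (b + m)) / 2
         - (\<Sum>b<p ^ k. \<bar>?D (b + n) - ?D (b + m)\<bar>) / 2"
    by (simp add: max sum_subtractf sum_divide_distrib[symmetric])
  then have "(\<Sum>b<p ^ k. 1 - max (?D (b + n)) (?D (b + m))) / ?M
     = 1 - ((\<Sum>b<p ^ k. ?D (b + n)) / ?M) / 2 - ((\<Sum>b<p ^ k. ?D (b + m)) / ?M) / 2
         - (\<Sum>b<p ^ k. \<bar>?D (b + n) - ?D (b + m)\<bar>) / ?M / 2"
    using assms by (simp add: diff_divide_distrib)
  also have "\<dots> = 1 - (1 - 1 / ?M) / 4 - (1 - 1 / ?M) / 4 - pair_gap 0 p k (int n - int m)"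
    unfolding mean_digit_reversal[OF assms] sum_abs_diff_digit_reversal[OF assms]
    using assms by simp
  finally show ?thesis by (simp add: field_simps)
qed

section \<open>Decomposition of the kernel into levels\<close>

text \<open>The kernel is \<open>1/2\<close> minus the gap, and level \<open>0\<close> is its mean. Its part of level \<open>r > 0\<close> is the difference
of its conditional means modulo \<open>p\<^sup>r\<close> and modulo \<open>p\<^bsup>r-1\<^esup>\<close>. The gap at \<open>d\<close> depends only on the residue class of \<open>d\<close> modulo the first power
of \<open>p\<close> that does not divide \<open>d\<close>, so the two conditional means agree unless \<open>p\<^bsup>r-1\<^esup>\<close> divides \<open>d\<close>. By
self-similarity, the recursion in the last equation passes from one level to the next.\<close>

fun level_term :: "nat \<Rightarrow> nat \<Rightarrow> int \<Rightarrow> real" where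
  "level_term p 0 d = 1 / 3"
| "level_term p (Suc 0) d = (if int p dvd d then (1 - 1 / real p) / 6
     else 1 / 6 - real_of_int (d mod int p) * (real p - real_of_int (d mod int p)) / (real p)\<^sup>2)"
| "level_term p (Suc (Suc r)) d = (if int p dvd d then level_term p (Suc r) (d div int p) / real p else 0)"

text \<open>The levels up to \<open>k\<close> add up to the conditional mean modulo \<open>p\<^sup>k\<close>. This mean is the kernel with the gap of
numbers divisible by \<open>p\<^sup>k\<close> replaced by its average, a multiple of \<open>1/6\<close>.\<close>

lemma sum_level_terms:
  assumes "p > 0"
  shows "(\<Sum>r\<le>k. level_term p r d) = 1 / 2 - pair_gap (1 / 6) p k d"
proof -
  have "(\<Sum>r<k. level_term p (Suc r) d) = 1 / 6 - pair_gap (1 / 6) p k d"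
  proof (induction k arbitrary: d)
    case (Suc k)
    have *: "(\<Sum>r<Suc k. level_term p (Suc r) d)
        = level_term p (Suc 0) d + (\<Sum>r<k. level_term p (Suc (Suc r)) d)"
      by (rule sum.lessThan_Suc_shift)
    show ?case
    proof (cases "int p dvd d")
      case True
      then have "(\<Sum>r<k. level_term p (Suc (Suc r)) d) = (1 / 6 - pair_gap (1 / 6) p k (d div int p)) / real p"
        by (simp add: sum_divide_distrib[symmetric] Suc.IH)
      then show ?thesis unfolding * using True assms by (simp add: field_simps)
    next
      case False
      then show ?thesis unfolding * by simp
    qed
  qed simp
  then show ?thesis by (simp add: lessThan_Suc_atMost[symmetric] sum.lessThan_Suc_shift del: sum.lessThan_Suc)
qed

lemma residue_product_bounds:
  assumes "p > 0"
  shows "0 \<le> real_of_int (d mod int p) * (real p - real_of_int (d mod int p)) / (real p)\<^sup>2"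
    "real_of_int (d mod int p) * (real p - real_of_int (d mod int p)) / (real p)\<^sup>2 \<le> 1 / 4"
proof -
  let ?e = "real_of_int (d mod int p)"
  have "0 \<le> d mod int p" "d mod int p < int p" using assms by simp_all
  then have e: "0 \<le> ?e" "?e \<le> real p"
    by (simp, metis of_int_le_iff of_int_of_nat_eq order_less_imp_le)
  then show "0 \<le> ?e * (real p - ?e) / (real p)\<^sup>2" by simp
  have "?e * (real p - ?e) \<le> (real p)\<^sup>2 / 4"
    using zero_le_power2[of "2 * ?e - real p"] by (simp add: power2_eq_square algebra_simps)
  then have "?e * (real p - ?e) / (real p)\<^sup>2 \<le> (real p)\<^sup>2 / 4 / (real p)\<^sup>2"
    by (rule divide_right_mono) simp
  then show "?e * (real p - ?e) / (real p)\<^sup>2 \<le> 1 / 4" using assms by simp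
qed

lemma pair_gap_bounds:
  assumes "p > 0" "0 \<le> z" "z \<le> 1 / 4"
  shows "0 \<le> pair_gap z p k d \<and> pair_gap z p k d \<le> 1 / 4"
proof (induction k arbitrary: d)
  case (Suc k)
  have "x / real p \<le> 1 / 4" if "x \<le> 1 / 4" "0 \<le> x" for x
  proof -
    have "x / real p \<le> x / 1" using assms that by (intro divide_left_mono) auto
    then show ?thesis using that by linarith
  qed
  then show ?case using Suc.IH[of "d div int p"] residue_product_bounds[OF assms(1), of d] assms(1) by auto
qed (use assms in simp)

text \<open>The truncated gap and the sum of the levels differ only in the starting value, whose influence decays
like \<open>p\<^bsup>-k\<^esup>\<close>.\<close>

lemma pair_gap_diff:
  assumes "p > 0"
  shows "\<bar>pair_gap z p k d - pair_gap w p k d\<bar> \<le> \<bar>z - w\<bar> / real p ^ k"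
proof (induction k arbitrary: d)
  case (Suc k)
  have "\<bar>pair_gap z p k d' / real p - pair_gap w p k d' / real p\<bar> \<le> \<bar>z - w\<bar> / real p ^ Suc k" for d'
  proof -
    have "\<bar>pair_gap z p k d' / real p - pair_gap w p k d' / real p\<bar>
        = \<bar>pair_gap z p k d' - pair_gap w p k d'\<bar> / real p"
      by (simp add: diff_divide_distrib[symmetric])
    also have "\<dots> \<le> \<bar>z - w\<bar> / real p ^ k / real p" by (intro divide_right_mono Suc.IH) simp
    finally show ?thesis by (simp add: mult.commute)
  qed
  then show ?case by simp
qed simp

lemma periodic_level_term:
  assumes "p > 0"
  shows "periodic (p ^ r) (level_term p r)"
proof (cases r)
  case 0
  then show ?thesis by (simp add: periodic_def)
next
  case (Suc q)
  have "periodic (p ^ Suc q) (level_term p (Suc q))"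
  proof (induction q)
    case 0
    show ?case by (simp add: periodic_def)
  next
    case (Suc q)
    have "(d + int (p ^ Suc (Suc q))) div int p = d div int p + int (p ^ Suc q)" for d
      using assms by simp
    moreover have "int p dvd d + int (p ^ Suc (Suc q)) \<longleftrightarrow> int p dvd d" for d
      by (simp add: dvd_add_left_iff)
    ultimately show ?case using Suc by (simp only: periodic_def level_term.simps) simp
  qed
  then show ?thesis using Suc by simp
qed

lemma sum_level_term_period:
  assumes "p > 0" "r > 0"
  shows "(\<Sum>n<p ^ r. level_term p r (int n)) = 0"
proof -
  have "(\<Sum>n<p ^ Suc q. level_term p (Suc q) (int n)) = 0" for q
  proof (induction q)
    case 0
    let ?g = "\<lambda>n. real n * (real p - real n) / (real p)\<^sup>2"
    have "level_term p (Suc 0) (int n) = 1 / 6 - ?g n - (if n = 0 then 1 / (6 * real p) else 0)"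
      if "n < p" for n
    proof (cases "n = 0")
      case True
      then show ?thesis using assms by (simp add: diff_divide_distrib)
    next
      case False
      then have "\<not> int p dvd int n" using that by (auto dest: dvd_imp_le)
      then show ?thesis using that False by (simp add: zmod_int[symmetric])
    qed
    then have "(\<Sum>n<p ^ Suc 0. level_term p (Suc 0) (int n))
       = (\<Sum>n<p. 1 / 6 - ?g n - (if n = 0 then 1 / (6 * real p) else 0))"
      by (intro sum.cong) auto
    also have "\<dots> = real p / 6 - (\<Sum>n<p. ?g n) - 1 / (6 * real p)"
      using assms by (simp add: sum_subtractf)
    also have "(\<Sum>n<p. ?g n) = (real p * (\<Sum>n<p. real n) - (\<Sum>n<p. (real n)\<^sup>2)) / (real p)\<^sup>2"
      by (simp add: sum_divide_distrib[symmetric] right_diff_distrib sum_subtractf sum_distrib_left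
          power2_eq_square mult.commute)
    also have "real p / 6 - (real p * (\<Sum>n<p. real n) - (\<Sum>n<p. (real n)\<^sup>2)) / (real p)\<^sup>2 - 1 / (6 * real p) = 0"
      unfolding sum_real_lessThan sum_real_squares_lessThan
      using assms by (simp add: field_simps power2_eq_square)
    finally show ?case .
  next
    case (Suc q)
    have t: "level_term p (Suc (Suc q)) (int (a + p * c))
        = (if a = 0 then level_term p (Suc q) (int c) / real p else 0)" if "a < p" for a c
    proof -
      have "int p dvd int (a + p * c) \<longleftrightarrow> p dvd a" by (simp add: dvd_add_left_iff del: of_nat_add of_nat_mult)
      moreover have "p dvd a \<longleftrightarrow> a = 0" using that by (auto dest: dvd_imp_le)
      ultimately show ?thesis using assms by simp
    qed
    have "(\<Sum>n<p ^ Suc (Suc q). level_term p (Suc (Suc q)) (int n))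
       = (\<Sum>a<p. \<Sum>c<p ^ Suc q. if a = 0 then level_term p (Suc q) (int c) / real p else 0)"
      unfolding sum_lessThan_power_digits[of _ p "Suc q"] by (intro sum.cong refl) (simp only: t lessThan_iff)
    also have "\<dots> = (\<Sum>a<p. if a = 0 then (\<Sum>c<p ^ Suc q. level_term p (Suc q) (int c)) / real p else 0)"
      by (intro sum.cong refl) (simp add: sum_divide_distrib)
    also have "\<dots> = 0" by (simp only: Suc.IH) simp
    finally show ?case .
  qed
  then show ?thesis using assms(2) by (cases r) auto
qed

lemma level_term_bound:
  assumes "p > 0"
  shows "\<bar>level_term p r d\<bar> \<le> 1 / real (p ^ (r - 1))"
proof (cases r)
  case (Suc q)
  have "\<bar>level_term p (Suc q) d\<bar> \<le> 1 / real p ^ q"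
  proof (induction q arbitrary: d)
    case 0
    have "0 \<le> 1 / real p" "1 / real p \<le> 1" using assms by auto
    moreover have "\<bar>(1 - x) / 6\<bar> \<le> 1" if "0 \<le> x" "x \<le> 1" for x :: real using that unfolding abs_le_iff by simp
    ultimately have "\<bar>(1 - 1 / real p) / 6\<bar> \<le> 1" by blast
    moreover have "\<bar>1 / 6 - x\<bar> \<le> 1" if "0 \<le> x" "x \<le> 1 / 4" for x :: real using that by linarith
    ultimately show ?case using residue_product_bounds[OF assms, of d] by simp
  next
    case (Suc q)
    have "\<bar>level_term p (Suc q) d' / real p\<bar> \<le> 1 / real p ^ Suc q" for d'
    proof -
      have "\<bar>level_term p (Suc q) d'\<bar> / real p \<le> 1 / real p ^ q / real p"
        by (intro divide_right_mono Suc.IH) simp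
      then show ?thesis by (simp add: mult.commute)
    qed
    then show ?case by simp
  qed
  then show ?thesis using Suc by simp
qed simp

lemma level_term_support:
  assumes "level_term p r d \<noteq> 0"
  shows "int (p ^ (r - 1)) dvd d"
proof (cases r)
  case (Suc q)
  have "level_term p (Suc q) d \<noteq> 0 \<Longrightarrow> int p ^ q dvd d" for d
  proof (induction q arbitrary: d)
    case (Suc q)
    then have "int p dvd d" and "level_term p (Suc q) (d div int p) \<noteq> 0" by (auto split: if_splits)
    then have "int p ^ q dvd d div int p" using Suc.IH by blast
    then have "int p * int p ^ q dvd int p * (d div int p)" by (intro mult_dvd_mono) auto
    then show ?case using \<open>int p dvd d\<close> by simp
  qed simp
  then show ?thesis using Suc assms by simp
qed simp

lemma periodic_prod:
  assumes "\<And>i. i \<in> u \<Longrightarrow> periodic (q i) (f i)"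
    and "finite u"
  shows "periodic (\<Prod>i\<in>u. q i) (\<lambda>d. \<Prod>i\<in>u. f i d)"
proof -
  have "periodic (\<Prod>i\<in>u. q i) (f i)" if "i \<in> u" for i
    using assms that by (intro periodic_dvd[OF assms(1)] dvd_prodI)
  then show ?thesis by (simp add: periodic_def)
qed

lemma prod_dvd_of_pairwise_coprime:
  fixes a :: "'i \<Rightarrow> nat"
  assumes "finite u" "\<And>i. i \<in> u \<Longrightarrow> a i dvd c"
    and "\<And>i j. i \<in> u \<Longrightarrow> j \<in> u \<Longrightarrow> i \<noteq> j \<Longrightarrow> coprime (a i) (a j)"
  shows "(\<Prod>i\<in>u. a i) dvd c"
  using assms
proof (induction u)
  case (insert i u)
  have "coprime (a i) (\<Prod>j\<in>u. a j)"
    using insert.hyps insert.prems(2) by (intro prod_coprime_right) auto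
  then show ?case using insert by (simp add: divides_mult)
qed simp

text \<open>The estimate on which the upper bound rests. The product has period \<open>Q = \<Prod>\<^sub>i p\<^sub>i\<^bsup>r\<^sub>i\<^esup>\<close> and mean zero because the
factor with \<open>r\<^sub>i > 0\<close> has mean zero and the period of the others is coprime to its own. Its support
consists of multiples of \<open>Q' = \<Prod>\<^sub>i p\<^sub>i\<^bsup>r\<^sub>i-1\<^esup>\<close> and its size is at most \<open>1 / Q'\<close>, while \<open>Q \<le> Q' \<Prod>\<^sub>i p\<^sub>i\<close>. For
\<open>r\<^sub>i = 0\<close> the truncated exponent \<open>r\<^sub>i - 1 = 0\<close> is the right one.\<close>

lemma double_sum_level_product_bound:
  assumes "finite u" and prime: "\<And>i. i \<in> u \<Longrightarrow> prime (p i)" and inj: "inj_on p u"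
    and nz: "i0 \<in> u" "r i0 > 0"
  shows "\<bar>\<Sum>n<N. \<Sum>m<N. \<Prod>i\<in>u. level_term (p i) (r i) (int n - int m)\<bar> \<le> (real (\<Prod>i\<in>u. p i))\<^sup>2"
proof -
  let ?q = "\<Prod>i\<in>u. p i ^ r i" and ?q' = "\<Prod>i\<in>u. p i ^ (r i - 1)"
  let ?F = "\<lambda>d. \<Prod>i\<in>u. level_term (p i) (r i) d"
  have pos: "p i > 0" if "i \<in> u" for i using prime[OF that] by (rule prime_gt_0_nat)
  have cop: "coprime (p i ^ a) (p j ^ b)" if "i \<in> u" "j \<in> u" "i \<noteq> j" for i j a b
  proof -
    have "p i \<noteq> p j" using that inj by (auto dest: inj_onD)
    then show ?thesis using prime that by (simp add: primes_coprime)
  qed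
  have per: "periodic ?q ?F"
    using assms pos by (intro periodic_prod periodic_level_term) auto
  \<comment> \<open>Mean zero comes from the single factor \<open>i0\<close> of positive level.\<close>
  have zero: "(\<Sum>n<?q. ?F (int n)) = 0"
  proof -
    let ?Q0 = "\<Prod>i\<in>u - {i0}. p i ^ r i" and ?G = "\<lambda>d. \<Prod>i\<in>u - {i0}. level_term (p i) (r i) d"
    have "?q = p i0 ^ r i0 * ?Q0" using assms by (simp add: prod.remove)
    moreover have "?F d = level_term (p i0) (r i0) d * ?G d" for d using assms by (simp add: prod.remove)
    moreover have "coprime (p i0 ^ r i0) ?Q0"
      using nz cop by (intro prod_coprime_right) auto
    moreover have "periodic ?Q0 ?G" using assms pos by (intro periodic_prod periodic_level_term) auto
    moreover have "?Q0 > 0" using pos by (intro prod_pos) auto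
    ultimately show ?thesis
      using sum_periodic_coprime[OF periodic_level_term[of "p i0" "r i0"], of ?Q0 ?G]
        sum_level_term_period[of "p i0" "r i0"] pos nz by simp
  qed
  have q'_pos: "?q' > 0" using pos by (intro prod_pos) auto
  have "?q > 0" using pos by (intro prod_pos) auto
  then have "N mod ?q \<le> ?q" by (simp add: order_less_imp_le)
  also have "?q \<le> (\<Prod>i\<in>u. p i) * ?q'"
  proof -
    have "?q \<le> (\<Prod>i\<in>u. p i * p i ^ (r i - 1))"
    proof (intro prod_mono conjI)
      fix i assume i: "i \<in> u"
      show "p i ^ r i \<le> p i * p i ^ (r i - 1)"
        using pos[OF i] by (cases "r i") auto
    qed simp
    then show ?thesis by (simp add: prod.distrib)
  qed
  finally have le: "N mod ?q \<le> (\<Prod>i\<in>u. p i) * ?q'" .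
  have bound: "\<bar>?F d\<bar> \<le> 1 / real ?q'" for d
  proof -
    have "\<bar>?F d\<bar> = (\<Prod>i\<in>u. \<bar>level_term (p i) (r i) d\<bar>)" by (rule abs_prod)
    also have "\<dots> \<le> (\<Prod>i\<in>u. 1 / real (p i ^ (r i - 1)))"
      using pos by (intro prod_mono conjI level_term_bound) auto
    also have "\<dots> = 1 / real ?q'" by (simp add: prod_dividef)
    finally show ?thesis .
  qed
  have supp: "?F d = 0" if "\<not> int ?q' dvd d" for d
  proof (rule ccontr)
    assume "?F d \<noteq> 0"
    then have "level_term (p i) (r i) d \<noteq> 0" if "i \<in> u" for i using assms(1) that by auto
    then have dvd: "p i ^ (r i - 1) dvd nat \<bar>d\<bar>" if "i \<in> u" for i
      unfolding dvd_nat_abs_iff using level_term_support that by blast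
    have "?q' dvd nat \<bar>d\<bar>"
      by (rule prod_dvd_of_pairwise_coprime[OF assms(1) dvd cop])
    then show False using that by (simp only: dvd_nat_abs_iff)
  qed
  show ?thesis
    by (subst double_sum_periodic_mod[OF per zero])
      (rule double_sum_sparse_bound[OF q'_pos le bound supp])
qed

text \<open>Expanding the product of sums gives one term for each vector of levels. The zero vector gives the
subtracted constant, and each of the fewer than \<open>(k + 1)\<^bsup>|u|\<^esup>\<close> others is bounded by \<open>double_sum_level_product_bound\<close>.\<close>

lemma double_sum_truncated_kernel_bound:
  assumes "finite u" and prime: "\<And>i. i \<in> u \<Longrightarrow> prime (p i)" and inj: "inj_on p u"
  shows "(\<Sum>n<N. \<Sum>m<N. (\<Prod>i\<in>u. \<Sum>r\<le>k. level_term (p i) r (int n - int m)) - (1 / 3) ^ card u)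
    \<le> real (k + 1) ^ card u * (real (\<Prod>i\<in>u. p i))\<^sup>2"
proof -
  let ?R = "Pi\<^sub>E u (\<lambda>_. {..k})" and ?z = "\<lambda>i\<in>u. 0::nat"
  let ?T = "\<lambda>r d. \<Prod>i\<in>u. level_term (p i) (r i) d"
  have fin: "finite ?R" using assms(1) by (intro finite_PiE) auto
  have z: "?z \<in> ?R" by auto
  have expand: "(\<Prod>i\<in>u. \<Sum>r\<le>k. level_term (p i) r d) - (1 / 3) ^ card u = (\<Sum>r\<in>?R - {?z}. ?T r d)" for d
  proof -
    have "(\<Prod>i\<in>u. \<Sum>r\<le>k. level_term (p i) r d) = (\<Sum>r\<in>?R. ?T r d)"
      using assms(1) by (intro prod_sum_PiE) auto
    also have "\<dots> = ?T ?z d + (\<Sum>r\<in>?R - {?z}. ?T r d)" using fin z by (rule sum.remove)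
    also have "?T ?z d = (1 / 3) ^ card u" by simp
    finally show ?thesis by linarith
  qed
  have "(\<Sum>n<N. \<Sum>m<N. (\<Prod>i\<in>u. \<Sum>r\<le>k. level_term (p i) r (int n - int m)) - (1 / 3) ^ card u)
     = (\<Sum>n<N. \<Sum>r\<in>?R - {?z}. \<Sum>m<N. ?T r (int n - int m))"
    unfolding expand by (intro sum.cong refl sum.swap)
  also have "\<dots> = (\<Sum>r\<in>?R - {?z}. \<Sum>n<N. \<Sum>m<N. ?T r (int n - int m))" by (rule sum.swap)
  also have "\<dots> \<le> (\<Sum>r\<in>?R - {?z}. (real (\<Prod>i\<in>u. p i))\<^sup>2)"
  proof (intro sum_mono)
    fix r assume r: "r \<in> ?R - {?z}"
    then obtain i0 where "i0 \<in> u" "r i0 \<noteq> 0"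
      by (metis DiffE PiE_ext insertI1 restrict_apply' z)
    then show "(\<Sum>n<N. \<Sum>m<N. ?T r (int n - int m)) \<le> (real (\<Prod>i\<in>u. p i))\<^sup>2"
      using double_sum_level_product_bound[OF assms, of i0 r N] by simp
  qed
  also have "\<dots> = real (card (?R - {?z})) * (real (\<Prod>i\<in>u. p i))\<^sup>2" by simp
  also have "\<dots> \<le> real (k + 1) ^ card u * (real (\<Prod>i\<in>u. p i))\<^sup>2"
  proof (intro mult_right_mono)
    have "card (?R - {?z}) \<le> card ?R" using fin by (intro card_mono) auto
    also have "card ?R = (k + 1) ^ card u" using assms(1) by (simp add: card_PiE)
    finally show "real (card (?R - {?z})) \<le> real (k + 1) ^ card u"
      by (metis of_nat_le_iff of_nat_power)
  qed simp
  finally show ?thesis .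
qed

section \<open>Expectations over a random shift in one coordinate\<close>

definition unit_measure :: "real measure" where
  "unit_measure = uniform_measure lborel {0..<1}"

lemma prob_space_unit_measure: "prob_space unit_measure"
  unfolding unit_measure_def by (rule prob_space_uniform_measure) auto

lemma sets_unit_measure [measurable_cong, simp]: "sets unit_measure = sets borel"
  and space_unit_measure [simp]: "space unit_measure = UNIV"
  by (auto simp: unit_measure_def)

lemma AE_unit_measure: "AE x in unit_measure. 0 \<le> x \<and> x < 1"
  unfolding unit_measure_def by (rule AE_uniform_measureI) auto

lemma measure_unit_measure_cell:
  assumes "0 \<le> a" "a \<le> b" "b \<le> 1"
  shows "measure unit_measure {a..<b} = b - a"
proof -
  have "{0..<1} \<inter> {a..<b} = {a..<b}" using assms by auto
  then show ?thesis unfolding unit_measure_def using assms by (subst measure_uniform_measure) auto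
qed

lemma integral_step_function:
  fixes c :: "nat \<Rightarrow> real"
  assumes "M > 0"
  shows "(LINT x|unit_measure. c (nat \<lfloor>x * real M\<rfloor>)) = (\<Sum>j<M. c j) / real M"
proof -
  interpret prob_space unit_measure by (rule prob_space_unit_measure)
  let ?I = "\<lambda>j. {real j / real M..<(real j + 1) / real M}"
  have cell: "x \<in> ?I j \<longleftrightarrow> j = nat \<lfloor>x * real M\<rfloor>" if "0 \<le> x" for x j
  proof -
    have "x \<in> ?I j \<longleftrightarrow> real j \<le> x * real M \<and> x * real M < real j + 1"
      using assms by (simp add: divide_le_eq less_divide_eq)
    also have "\<dots> \<longleftrightarrow> \<lfloor>x * real M\<rfloor> = int j" by (simp add: floor_eq_iff)
    also have "\<dots> \<longleftrightarrow> j = nat \<lfloor>x * real M\<rfloor>" using that by auto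
    finally show ?thesis .
  qed
  have [measurable]: "(\<lambda>x. nat \<lfloor>x * real M\<rfloor>) \<in> borel \<rightarrow>\<^sub>M count_space UNIV" by measurable
  have "AE x in unit_measure. c (nat \<lfloor>x * real M\<rfloor>) = (\<Sum>j<M. c j * indicator (?I j) x)"
    using AE_unit_measure
  proof eventually_elim
    case (elim x)
    then have lt: "nat \<lfloor>x * real M\<rfloor> < M"
      using assms by (simp add: nat_less_iff floor_less_iff)
    have "(\<Sum>j<M. c j * indicator (?I j) x) = (\<Sum>j<M. if nat \<lfloor>x * real M\<rfloor> = j then c j else 0)"
      using elim cell[of x] by (intro sum.cong refl) (auto simp: indicator_def)
    also have "\<dots> = c (nat \<lfloor>x * real M\<rfloor>)" using lt by simp
    finally show ?case by simp
  qed
  then have "(LINT x|unit_measure. c (nat \<lfloor>x * real M\<rfloor>)) = (LINT x|unit_measure. (\<Sum>j<M. c j * indicator (?I j) x))"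
    by (intro integral_cong_AE) measurable
  also have "\<dots> = (\<Sum>j<M. (LINT x|unit_measure. c j * indicator (?I j) x))"
    by (intro Bochner_Integration.integral_sum integrable_mult_right) (auto simp: emeasure_eq_measure)
  also have "\<dots> = (\<Sum>j<M. c j * (1 / real M))"
  proof (intro sum.cong refl)
    fix j assume "j \<in> {..<M}"
    then have "real j + 1 \<le> real M" by auto
    then have "measure unit_measure (?I j) = (real j + 1) / real M - real j / real M"
      using assms by (intro measure_unit_measure_cell) (auto simp: divide_right_mono)
    then show "(LINT x|unit_measure. c j * indicator (?I j) x) = c j * (1 / real M)"
      by (simp add: add_divide_distrib)
  qed
  finally show ?thesis by (simp add: sum_divide_distrib)
qed

definition digit_prefix :: "nat \<Rightarrow> (nat \<Rightarrow> nat) \<Rightarrow> nat \<Rightarrow> nat" where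
  "digit_prefix p z k = (\<Sum>r<k. z r * p ^ r)"

lemma digit_prefix_Suc:
  "digit_prefix p z (Suc k) = z 0 + p * digit_prefix p (\<lambda>r. z (Suc r)) k"
  unfolding digit_prefix_def sum.lessThan_Suc_shift
  by (simp add: sum_distrib_left ac_simps)

lemma digit_prefix_less:
  assumes "z \<in> padic_ints p"
  shows "digit_prefix p z k < p ^ k"
  using assms
proof (induction k arbitrary: z)
  case (Suc k)
  have "z 0 < p" "(\<lambda>r. z (Suc r)) \<in> padic_ints p" using Suc.prems by (auto simp: padic_ints_def)
  then have "digit_prefix p (\<lambda>r. z (Suc r)) k + 1 \<le> p ^ k" using Suc.IH by (simp add: Suc_le_eq)
  then have "p * (digit_prefix p (\<lambda>r. z (Suc r)) k + 1) \<le> p * p ^ k" by (rule mult_le_mono2)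
  then show ?case using \<open>z 0 < p\<close> by (simp add: digit_prefix_Suc)
qed (simp add: digit_prefix_def)

lemma digit_reversal_prefix:
  assumes "z \<in> padic_ints p"
  shows "digit_reversal p k (digit_prefix p z k) = (\<Sum>r<k. real (z r) / real p ^ Suc r)"
  using assms
proof (induction k arbitrary: z)
  case (Suc k)
  have z: "z 0 < p" "(\<lambda>r. z (Suc r)) \<in> padic_ints p" using Suc.prems by (auto simp: padic_ints_def)
  have "digit_reversal p (Suc k) (digit_prefix p z (Suc k))
      = (real (z 0) + digit_reversal p k (digit_prefix p (\<lambda>r. z (Suc r)) k)) / real p"
    using z by (simp add: digit_prefix_Suc)
  also have "\<dots> = real (z 0) / real p + (\<Sum>r<k. real (z (Suc r)) / real p ^ Suc (Suc r))"
    unfolding Suc.IH[OF z(2)]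
    by (simp add: add_divide_distrib sum_divide_distrib mult.commute mult.left_commute)
  also have "\<dots> = (\<Sum>r<Suc k. real (z r) / real p ^ Suc r)"
    by (simp only: sum.lessThan_Suc_shift) simp
  finally show ?case .
qed simp

lemma digit_prefix_digits: "digit_prefix p (\<lambda>r. n div p ^ r mod p) k = n mod p ^ k"
proof (induction k)
  case (Suc k)
  have "n mod p ^ Suc k = p ^ k * (n div p ^ k mod p) + n mod p ^ k"
    using mod_mult2_eq[of n "p ^ k" p] by (simp add: mult.commute)
  then show ?case using Suc by (simp add: digit_prefix_def mult.commute)
qed (simp add: digit_prefix_def)

lemma summable_digits:
  assumes "z \<in> padic_ints p"
  shows "summable (\<lambda>r. real (z r) / real p ^ Suc r)"
proof (rule summableI_nonneg_bounded)
  have p: "p > 0" using assms by (auto simp: padic_ints_def intro: gr_zeroI)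
  show "(\<Sum>r<k. real (z r) / real p ^ Suc r) \<le> 1" for k
  proof -
    have "0 \<le> 1 / real p ^ k" by simp
    then show ?thesis
      using digit_reversal_bounds(2)[OF p, of k "digit_prefix p z k"] digit_reversal_prefix[OF assms, of k]
      by linarith
  qed
qed simp

lemma digit_value_bounds:
  assumes "z \<in> padic_ints p"
  shows "0 \<le> digit_value p z" "digit_value p z \<le> 1"
proof -
  have p: "p > 0" using assms by (auto simp: padic_ints_def intro: gr_zeroI)
  show "0 \<le> digit_value p z"
    unfolding digit_value_def by (intro suminf_nonneg summable_digits[OF assms]) simp
  show "digit_value p z \<le> 1"
    unfolding digit_value_def
  proof (rule suminf_le_const[OF summable_digits[OF assms]])
    fix k
    have "0 \<le> 1 / real p ^ k" by simp
    then show "(\<Sum>r<k. real (z r) / real p ^ Suc r) \<le> 1"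
      using digit_reversal_bounds(2)[OF p, of k "digit_prefix p z k"] digit_reversal_prefix[OF assms, of k]
      by linarith
  qed
qed

lemma digit_value_split:
  assumes "z \<in> padic_ints p"
  shows "digit_value p z = digit_reversal p k (digit_prefix p z k) + digit_value p (\<lambda>r. z (r + k)) / real p ^ k"
proof -
  have z: "(\<lambda>r. z (r + k)) \<in> padic_ints p" using assms by (auto simp: padic_ints_def)
  have "digit_value p z = (\<Sum>r. real (z (r + k)) / real p ^ Suc (r + k)) + (\<Sum>r<k. real (z r) / real p ^ Suc r)"
    unfolding digit_value_def by (rule suminf_split_initial_segment[OF summable_digits[OF assms]])
  also have "(\<Sum>r. real (z (r + k)) / real p ^ Suc (r + k)) = (\<Sum>r. real (z (r + k)) / real p ^ Suc r / real p ^ k)"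
    by (simp add: power_add mult.assoc)
  also have "\<dots> = digit_value p (\<lambda>r. z (r + k)) / real p ^ k"
    unfolding digit_value_def by (rule suminf_divide[OF summable_digits[OF z]])
  finally show ?thesis by (simp add: digit_reversal_prefix[OF assms])
qed

lemma digits_in_padic_ints: "p > 0 \<Longrightarrow> (\<lambda>r. n div p ^ r mod p) \<in> padic_ints p"
  by (simp add: padic_ints_def)

lemma radical_inverse_eq_digit_reversal:
  assumes "p > 0" "n < p ^ k"
  shows "radical_inverse p n = digit_reversal p k n"
proof -
  have "n div p ^ r = 0" if "r \<ge> k" for r
  proof -
    have "p ^ k \<le> p ^ r" using assms that by (intro power_increasing) auto
    then show ?thesis using assms by simp
  qed
  then have "(\<lambda>r. n div p ^ (r + k) mod p) = (\<lambda>r. 0)" by auto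
  then show ?thesis
    using digit_value_split[OF digits_in_padic_ints[OF assms(1)], of n k] assms
    by (simp add: radical_inverse_def digit_prefix_digits digit_value_def)
qed

lemma radical_inverse_bounds:
  assumes "p \<ge> 2"
  shows "0 \<le> radical_inverse p n" "radical_inverse p n < 1"
proof -
  have "n < p ^ n" using assms by (intro power_gt_expt) auto
  then have eq: "radical_inverse p n = digit_reversal p n n"
    using assms by (intro radical_inverse_eq_digit_reversal) auto
  have "0 < 1 / real p ^ n" using assms by simp
  then show "0 \<le> radical_inverse p n" "radical_inverse p n < 1"
    using digit_reversal_bounds[of p n n] assms unfolding eq by linarith+
qed

lemma radical_inverse_rec:
  assumes "p \<ge> 2"
  shows "radical_inverse p n = (real (n mod p) + radical_inverse p (n div p)) / real p"
proof -
  have n: "n < p ^ n" using assms by (intro power_gt_expt) auto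
  also have "p ^ n \<le> p ^ Suc n" using assms by (intro power_increasing) auto
  finally have "radical_inverse p n = digit_reversal p (Suc n) n"
    using assms by (intro radical_inverse_eq_digit_reversal) auto
  moreover have "n div p \<le> n" by simp
  then have "n div p < p ^ n" using n by (rule le_less_trans)
  then have "radical_inverse p (n div p) = digit_reversal p n (n div p)"
    using assms by (intro radical_inverse_eq_digit_reversal) auto
  ultimately show ?thesis by simp
qed

lemma padic_phi_plus_radical_inverse:
  assumes "p \<ge> 2"
  shows "padic_phi_plus p (radical_inverse p n) = (\<lambda>r. n div p ^ r mod p)"
proof
  have step: "radical_inverse p n * real p = real (n mod p) + radical_inverse p (n div p)" for n
    using assms by (subst radical_inverse_rec[OF assms]) simp
  show "padic_phi_plus p (radical_inverse p n) r = n div p ^ r mod p" for r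
  proof (induction r arbitrary: n)
    case 0
    have "\<lfloor>radical_inverse p n * real p\<rfloor> = int (n mod p)"
      unfolding step using radical_inverse_bounds[OF assms, of "n div p"] by (simp add: floor_eq_iff)
    then show ?case by (simp add: padic_phi_plus_def zmod_int[symmetric])
  next
    case (Suc r)
    have "radical_inverse p n * real p ^ Suc (Suc r)
        = radical_inverse p (n div p) * real p ^ Suc r + of_int (int p * int (n mod p * p ^ r))"
    proof -
      have "radical_inverse p n * real p ^ Suc (Suc r) = (radical_inverse p n * real p) * real p ^ Suc r"
        by simp
      also have "\<dots> = radical_inverse p (n div p) * real p ^ Suc r + real (n mod p) * real p ^ Suc r"
        unfolding step by (simp only: distrib_right add.commute)
      finally show ?thesis by simp
    qed
    then have "\<lfloor>radical_inverse p n * real p ^ Suc (Suc r)\<rfloor>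
        = \<lfloor>radical_inverse p (n div p) * real p ^ Suc r\<rfloor> + int p * int (n mod p * p ^ r)"
      by (simp only: floor_add_int)
    then have "padic_phi_plus p (radical_inverse p n) (Suc r) = padic_phi_plus p (radical_inverse p (n div p)) r"
      unfolding padic_phi_plus_def by (simp only: mod_mult_self2)
    then show ?case using Suc.IH by (simp add: div_mult2_eq)
  qed
qed

lemma padic_add_in_padic_ints: "p > 0 \<Longrightarrow> padic_add p z w \<in> padic_ints p"
  by (simp add: padic_ints_def padic_add_def)

lemma digit_prefix_padic_add:
  assumes "p > 0"
  shows "digit_prefix p (padic_add p z w) k = (digit_prefix p z k + digit_prefix p w k) mod p ^ k"
proof -
  have "digit_prefix p (padic_add p z w) k < p ^ k"
    by (intro digit_prefix_less padic_add_in_padic_ints assms)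
  then show ?thesis
    using padic_add_truncated[where p = p and z = z and w = w and k = k, THEN arg_cong[of _ _ "\<lambda>x. x mod p ^ k"]]
    by (simp add: digit_prefix_def)
qed

text \<open>The first \<open>k\<close> digits of the shifted point depend only on the first \<open>k\<close> digits of the shift; the other
digits and the carry into them change the value by at most \<open>p\<^bsup>-k\<^esup>\<close>. The exception is the topmost cell,
where the digits may all be \<open>p - 1\<close>, so that the value \<open>1\<close> is identified with \<open>0\<close>.\<close>

lemma padic_shift_approx:
  assumes "p \<ge> 2" 
  defines "\<psi> \<equiv> \<lambda>x k n. digit_reversal p k (digit_prefix p (padic_phi_plus p x) k + n)"
  shows "\<bar>padic_shift p (radical_inverse p n) x - \<psi> x k n\<bar>
    \<le> 1 / real p ^ k + (if \<psi> x k n \<ge> 1 - 1 / real p ^ k then 1 else 0)"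
proof -
  let ?z = "padic_add p (\<lambda>r. n div p ^ r mod p) (padic_phi_plus p x)"
  have p: "p > 0" using assms by simp
  have z: "?z \<in> padic_ints p" and z': "(\<lambda>r. ?z (r + k)) \<in> padic_ints p"
    using padic_add_in_padic_ints[OF p] by (auto simp: padic_ints_def)
  have "digit_reversal p k (digit_prefix p ?z k) = \<psi> x k n"
    unfolding digit_prefix_padic_add[OF p] digit_prefix_digits \<psi>_def
    using digit_reversal_mod[OF p] by (metis add.commute mod_add_left_eq)
  then have v: "digit_value p ?z = \<psi> x k n + digit_value p (\<lambda>r. ?z (r + k)) / real p ^ k"
    using digit_value_split[OF z, of k] by simp
  have tail: "0 \<le> digit_value p (\<lambda>r. ?z (r + k)) / real p ^ k"
    "digit_value p (\<lambda>r. ?z (r + k)) / real p ^ k \<le> 1 / real p ^ k"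
    using digit_value_bounds[OF z'] p by (auto intro!: divide_right_mono)
  have y: "padic_shift p (radical_inverse p n) x = frac (digit_value p ?z)"
    unfolding padic_shift_def padic_phi_def padic_phi_plus_radical_inverse[OF assms(1)] ..
  have \<psi>: "0 \<le> \<psi> x k n" "\<psi> x k n \<le> 1 - 1 / real p ^ k"
    unfolding \<psi>_def by (rule digit_reversal_bounds[OF p])+
  have pk: "0 \<le> 1 / real p ^ k" by simp
  show ?thesis
  proof (cases "\<psi> x k n \<ge> 1 - 1 / real p ^ k")
    case True
    have "0 \<le> frac (digit_value p ?z)" "frac (digit_value p ?z) < 1" by (simp_all add: frac_lt_1)
    then have "\<bar>frac (digit_value p ?z) - \<psi> x k n\<bar> \<le> 1" using \<psi> pk unfolding abs_le_iff by linarith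
    then have "\<bar>frac (digit_value p ?z) - \<psi> x k n\<bar> \<le> 1 / real p ^ k + 1" using pk by linarith
    then show ?thesis using True unfolding y by simp
  next
    case False
    then have "0 \<le> digit_value p ?z" "digit_value p ?z < 1" using v tail \<psi> by linarith+
    then have "frac (digit_value p ?z) = digit_value p ?z" by (simp add: frac_eq)
    then show ?thesis using False v tail unfolding y by simp
  qed
qed

lemma padic_shift_bounds: "0 \<le> padic_shift p x \<sigma>" "padic_shift p x \<sigma> < 1"
  by (simp_all add: padic_shift_def padic_phi_def frac_lt_1)

lemma measurable_padic_phi_plus [measurable]:
  "(\<lambda>\<sigma>. padic_phi_plus p \<sigma> r) \<in> borel \<rightarrow>\<^sub>M count_space UNIV"
  unfolding padic_phi_plus_def by measurable

lemma measurable_digit_prefix [measurable]: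
  "(\<lambda>\<sigma>. digit_prefix p (padic_phi_plus p \<sigma>) k) \<in> borel \<rightarrow>\<^sub>M count_space UNIV"
  unfolding digit_prefix_def by measurable

lemma measurable_padic_shift [measurable]: "padic_shift p x \<in> borel_measurable borel"
proof -
  have carry [measurable]: "(\<lambda>\<sigma>. padic_carry p z (padic_phi_plus p \<sigma>) r) \<in> borel \<rightarrow>\<^sub>M count_space UNIV" for z r
    by (induction r) simp_all
  have [measurable]: "(\<lambda>\<sigma>. padic_add p z (padic_phi_plus p \<sigma>) r) \<in> borel \<rightarrow>\<^sub>M count_space UNIV" for z r
    unfolding padic_add_def by measurable
  show ?thesis
    unfolding padic_shift_def padic_phi_def digit_value_def frac_def by measurable
qed

text \<open>The first \<open>k\<close> digits of a uniform shift are a uniform residue modulo \<open>p\<^sup>k\<close>: by injectivity of digit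
reversal they are determined by the cell of length \<open>p\<^bsup>-k\<^esup>\<close> that contains the shift.\<close>

lemma integral_digit_prefix:
  fixes c :: "nat \<Rightarrow> real"
  assumes "p \<ge> 2"
  shows "(LINT x|unit_measure. c (digit_prefix p (padic_phi_plus p x) k)) = (\<Sum>b<p ^ k. c b) / real p ^ k"
proof -
  have p: "p > 0" using assms by simp
  \<comment> \<open>\<open>c\<close> as a function of the cell: the prefix is recovered from its digit reversal.\<close>
  define c' where "c' = (\<lambda>y. c (the_inv_into {..<p ^ k} (digit_reversal p k) y))"
  have inv: "c' (digit_reversal p k b) = c b" if "b < p ^ k" for b
    using that by (simp add: c'_def the_inv_into_f_f[OF inj_on_digit_reversal[OF p]])
  have [measurable]: "(\<lambda>x. c (digit_prefix p (padic_phi_plus p x) k)) \<in> borel_measurable borel"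
    by measurable
  have "(\<lambda>x. nat \<lfloor>x * real (p ^ k)\<rfloor>) \<in> borel \<rightarrow>\<^sub>M count_space UNIV" by measurable
  then have [measurable]: "(\<lambda>x. c' (real (nat \<lfloor>x * real (p ^ k)\<rfloor>) / real p ^ k)) \<in> borel_measurable borel"
    by measurable
  have "AE x in unit_measure. c (digit_prefix p (padic_phi_plus p x) k) = c' (real (nat \<lfloor>x * real (p ^ k)\<rfloor>) / real p ^ k)"
    using AE_unit_measure
  proof eventually_elim
    case (elim x)
    have z: "padic_phi_plus p x \<in> padic_ints p" by (rule padic_phi_plus_in_padic_ints[OF p])
    have "digit_reversal p k (digit_prefix p (padic_phi_plus p x) k) = \<lfloor>x * real p ^ k\<rfloor> / real p ^ k"
      unfolding digit_reversal_prefix[OF z] using elim by (intro padic_phi_plus_partial_sum p) auto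
    also have "\<dots> = real (nat \<lfloor>x * real (p ^ k)\<rfloor>) / real p ^ k" using elim by simp
    finally show ?case using inv[OF digit_prefix_less[OF z]] by simp
  qed
  then have "(LINT x|unit_measure. c (digit_prefix p (padic_phi_plus p x) k))
     = (LINT x|unit_measure. c' (real (nat \<lfloor>x * real (p ^ k)\<rfloor>) / real p ^ k))"
    by (intro integral_cong_AE) auto
  also have "\<dots> = (\<Sum>j<p ^ k. c' (real j / real p ^ k)) / real (p ^ k)"
    using p by (intro integral_step_function[of "p ^ k" "\<lambda>j. c' (real j / real p ^ k)"]) simp
  also have "(\<Sum>j<p ^ k. c' (real j / real p ^ k)) = (\<Sum>b<p ^ k. c b)"
    by (simp only: sum_digit_reversal[OF p, symmetric]) (simp add: inv)
  finally show ?thesis by simp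
qed

text \<open>The error bound of \<open>padic_shift_approx\<close> as a function of the first \<open>k\<close> digits of the shift.\<close>

definition shift_error :: "nat \<Rightarrow> nat \<Rightarrow> nat \<Rightarrow> nat \<Rightarrow> real" where
  "shift_error p k n b = 1 / real p ^ k + (if digit_reversal p k (b + n) \<ge> 1 - 1 / real p ^ k then 1 else 0)"

text \<open>The topmost cell is reached by a single residue, so even this crude bound has mean \<open>O(p\<^bsup>-k\<^esup>)\<close>.\<close>

lemma mean_shift_error:
  assumes "p > 0"
  shows "(\<Sum>b<p ^ k. shift_error p k n b) / real p ^ k = 2 / real p ^ k"
proof -
  let ?f = "\<lambda>x. if x \<ge> 1 - 1 / real p ^ k then 1 else 0 :: real"
  have "(\<Sum>b<p ^ k. ?f (digit_reversal p k (b + n))) = (\<Sum>j<p ^ k. ?f (real j / real p ^ k))"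
    using sum_digit_reversal_shift[OF assms, of ?f] sum_digit_reversal[OF assms, of ?f] by simp
  also have "\<dots> = (\<Sum>j<p ^ k. if j = p ^ k - 1 then 1 else 0)"
  proof (intro sum.cong refl)
    fix j assume "j \<in> {..<p ^ k}"
    moreover have "1 - 1 / real p ^ k \<le> real j / real p ^ k \<longleftrightarrow> real p ^ k \<le> real j + 1"
    proof -
      have "1 - 1 / real p ^ k \<le> real j / real p ^ k \<longleftrightarrow> 1 \<le> (real j + 1) / real p ^ k"
        by (simp add: add_divide_distrib algebra_simps)
      then show ?thesis using assms by (simp add: le_divide_eq)
    qed
    moreover have "real p ^ k \<le> real j + 1 \<longleftrightarrow> p ^ k \<le> j + 1"
      by (metis of_nat_1 of_nat_add of_nat_le_iff of_nat_power)
    ultimately show "?f (real j / real p ^ k) = (if j = p ^ k - 1 then 1 else 0)" by auto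
  qed
  also have "\<dots> = 1" using assms by simp
  finally show ?thesis
    unfolding shift_error_def using assms by (simp add: sum.distrib add_divide_distrib)
qed

lemma integral_approx_by_digit_mean:
  fixes f :: "real \<Rightarrow> real" and c e :: "nat \<Rightarrow> real"
  assumes "p \<ge> 2" and [measurable]: "f \<in> borel_measurable borel"
    and bound: "\<And>x. \<bar>f x - c (digit_prefix p (padic_phi_plus p x) k)\<bar> \<le> e (digit_prefix p (padic_phi_plus p x) k)"
    and f: "\<And>x. \<bar>f x\<bar> \<le> 1"
  shows "\<bar>(LINT x|unit_measure. f x) - (\<Sum>b<p ^ k. c b) / real p ^ k\<bar> \<le> (\<Sum>b<p ^ k. e b) / real p ^ k"
proof -
  interpret prob_space unit_measure by (rule prob_space_unit_measure)
  let ?B = "\<lambda>x. digit_prefix p (padic_phi_plus p x) k"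
  have p: "p > 0" using assms by simp
  have int: "integrable unit_measure (\<lambda>x. g (?B x))" for g :: "nat \<Rightarrow> real"
  proof (rule integrable_const_bound)
    show "AE x in unit_measure. norm (g (?B x)) \<le> (\<Sum>b<p ^ k. \<bar>g b\<bar>)"
    proof (rule AE_I2)
      fix x
      have "?B x < p ^ k" by (intro digit_prefix_less padic_phi_plus_in_padic_ints p)
      then show "norm (g (?B x)) \<le> (\<Sum>b<p ^ k. \<bar>g b\<bar>)"
        using member_le_sum[of "?B x" "{..<p ^ k}" "\<lambda>b. \<bar>g b\<bar>"] by simp
    qed
  qed measurable
  have intf: "integrable unit_measure f"
    using f by (intro integrable_const_bound[where B = 1]) auto
  have "(LINT x|unit_measure. f x) - (\<Sum>b<p ^ k. c b) / real p ^ k = (LINT x|unit_measure. f x - c (?B x))"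
    by (simp add: int intf integral_digit_prefix[OF assms(1)])
  also have "\<bar>\<dots>\<bar> \<le> (LINT x|unit_measure. \<bar>f x - c (?B x)\<bar>)"
    by (rule integral_abs_bound)
  also have "\<dots> \<le> (LINT x|unit_measure. e (?B x))"
    using bound by (intro integral_mono) (auto intro!: int intf integrable_abs Bochner_Integration.integrable_diff)
  finally show ?thesis by (simp add: integral_digit_prefix[OF assms(1)])
qed

lemma expectation_one_minus_square:
  assumes "p \<ge> 2"
  shows "\<bar>(LINT \<sigma>|unit_measure. (1 - (padic_shift p (radical_inverse p n) \<sigma>)\<^sup>2) / 2) - 1 / 3\<bar> \<le> 5 / real p ^ k"
proof -
  have p: "p > 0" using assms by simp
  let ?y = "padic_shift p (radical_inverse p n)" and ?\<psi> = "\<lambda>b. digit_reversal p k (b + n)"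
  have sq: "\<bar>(1 - x\<^sup>2) / 2 - (1 - y\<^sup>2) / 2\<bar> \<le> \<bar>x - y\<bar>" if "0 \<le> x" "x \<le> 1" "0 \<le> y" "y \<le> 1" for x y :: real
  proof -
    have "(1 - x\<^sup>2) / 2 - (1 - y\<^sup>2) / 2 = - ((x - y) * ((x + y) / 2))"
      by (simp add: field_simps power2_eq_square)
    then have "\<bar>(1 - x\<^sup>2) / 2 - (1 - y\<^sup>2) / 2\<bar> = \<bar>x - y\<bar> * ((x + y) / 2)"
      using that by (simp add: abs_mult)
    also have "\<dots> \<le> \<bar>x - y\<bar> * 1" using that by (intro mult_left_mono) auto
    finally show ?thesis by simp
  qed
  have \<psi>: "0 \<le> ?\<psi> b" "?\<psi> b \<le> 1" for b
  proof -
    have "0 \<le> 1 / real p ^ k" by simp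
    then show "0 \<le> ?\<psi> b" "?\<psi> b \<le> 1" using digit_reversal_bounds[OF p, of k "b + n"] by linarith+
  qed
  have "\<bar>(LINT \<sigma>|unit_measure. (1 - (?y \<sigma>)\<^sup>2) / 2) - (\<Sum>b<p ^ k. (1 - (?\<psi> b)\<^sup>2) / 2) / real p ^ k\<bar>
      \<le> (\<Sum>b<p ^ k. shift_error p k n b) / real p ^ k"
  proof (rule integral_approx_by_digit_mean[OF assms])
    fix \<sigma>
    let ?b = "digit_prefix p (padic_phi_plus p \<sigma>) k"
    have y: "0 \<le> ?y \<sigma>" "?y \<sigma> \<le> 1" using padic_shift_bounds[of p _ \<sigma>] by (auto intro: less_imp_le)
    show "\<bar>(1 - (?y \<sigma>)\<^sup>2) / 2 - (1 - (?\<psi> ?b)\<^sup>2) / 2\<bar> \<le> shift_error p k n ?b"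
      using sq[OF y \<psi>] padic_shift_approx[OF assms, of n \<sigma> k] unfolding shift_error_def by (rule order_trans)
    have "0 \<le> (?y \<sigma>)\<^sup>2" "(?y \<sigma>)\<^sup>2 \<le> 1" using y by (auto simp: power_le_one)
    moreover have "\<bar>(1 - t) / 2\<bar> \<le> 1" if "0 \<le> t" "t \<le> 1" for t :: real
      using that unfolding abs_le_iff by simp
    ultimately show "\<bar>(1 - (?y \<sigma>)\<^sup>2) / 2\<bar> \<le> 1" by blast
  qed measurable
  moreover have "2 / real p ^ k + 1 / real p ^ k \<le> 5 / real p ^ k"
    by (simp add: add_divide_distrib[symmetric] divide_right_mono)
  ultimately show ?thesis
    using mean_one_minus_square_digit_reversal[OF p, of k n] unfolding mean_shift_error[OF p] by linarith
qed

lemma expectation_one_minus_max: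
  assumes "p \<ge> 2"
  shows "\<bar>(LINT \<sigma>|unit_measure. 1 - max (padic_shift p (radical_inverse p n) \<sigma>) (padic_shift p (radical_inverse p m) \<sigma>))
    - (1 / 2 - pair_gap (1 / 6) p k (int n - int m))\<bar> \<le> 5 / real p ^ k"
proof -
  have p: "p > 0" using assms by simp
  let ?y = "\<lambda>n. padic_shift p (radical_inverse p n)" and ?\<psi> = "\<lambda>n b. digit_reversal p k (b + n)"
  have "\<bar>(LINT \<sigma>|unit_measure. 1 - max (?y n \<sigma>) (?y m \<sigma>)) - (\<Sum>b<p ^ k. 1 - max (?\<psi> n b) (?\<psi> m b)) / real p ^ k\<bar>
      \<le> (\<Sum>b<p ^ k. shift_error p k n b + shift_error p k m b) / real p ^ k"
  proof (rule integral_approx_by_digit_mean[OF assms])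
    fix \<sigma>
    let ?b = "digit_prefix p (padic_phi_plus p \<sigma>) k"
    have max: "\<bar>(1 - max x y) - (1 - max x' y')\<bar> \<le> a + b" if "\<bar>x - x'\<bar> \<le> a" "\<bar>y - y'\<bar> \<le> b"
      for x y x' y' a b :: real using that by (auto simp: max_def abs_le_iff)
    show "\<bar>(1 - max (?y n \<sigma>) (?y m \<sigma>)) - (1 - max (?\<psi> n ?b) (?\<psi> m ?b))\<bar> \<le> shift_error p k n ?b + shift_error p k m ?b"
      unfolding shift_error_def by (intro max padic_shift_approx assms)
    have "0 \<le> max (?y n \<sigma>) (?y m \<sigma>)" "max (?y n \<sigma>) (?y m \<sigma>) < 1"
      by (simp_all add: padic_shift_bounds le_max_iff_disj)
    then show "\<bar>1 - max (?y n \<sigma>) (?y m \<sigma>)\<bar> \<le> 1" unfolding abs_le_iff by linarith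
  qed measurable
  moreover have "(\<Sum>b<p ^ k. shift_error p k n b + shift_error p k m b) / real p ^ k = 4 / real p ^ k"
    by (simp only: sum.distrib add_divide_distrib mean_shift_error[OF p])
  moreover have "\<bar>pair_gap 0 p k (int n - int m) - pair_gap (1 / 6) p k (int n - int m)\<bar> \<le> (1 / 6) / real p ^ k"
    using pair_gap_diff[OF p, of 0 k _ "1 / 6"] by simp
  moreover have "4 / real p ^ k + 1 / (2 * real p ^ k) + (1 / 6) / real p ^ k \<le> 5 / real p ^ k"
    using p by (simp add: field_simps)
  moreover have "0 \<le> 1 / (2 * real p ^ k)" by simp
  ultimately show ?thesis
    unfolding mean_one_minus_max_digit_reversal[OF p] by linarith
qed

section \<open>Warnock's formula\<close>

definition unit_integral :: "(real \<Rightarrow> real) \<Rightarrow> real" where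
  "unit_integral g = (LINT x|lborel. indicator {0..1} x * g x)"

definition bounded_on_unit :: "(real \<Rightarrow> real) \<Rightarrow> bool" where
  "bounded_on_unit g \<longleftrightarrow> g \<in> borel_measurable borel \<and> (\<exists>B. \<forall>x\<in>{0..1}. \<bar>g x\<bar> \<le> B)"

lemma bounded_on_unitI:
  assumes "g \<in> borel_measurable borel" "\<And>x. x \<in> {0..1} \<Longrightarrow> \<bar>g x\<bar> \<le> B"
  shows "bounded_on_unit g"
  using assms unfolding bounded_on_unit_def by blast

lemma bounded_on_unit_mult:
  assumes "bounded_on_unit f" "bounded_on_unit g"
  shows "bounded_on_unit (\<lambda>x. f x * g x)"
proof -
  from assms obtain A B where AB: "\<And>x. x \<in> {0..1} \<Longrightarrow> \<bar>f x\<bar> \<le> A" "\<And>x. x \<in> {0..1} \<Longrightarrow> \<bar>g x\<bar> \<le> B"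
    and [measurable]: "f \<in> borel_measurable borel" "g \<in> borel_measurable borel"
    unfolding bounded_on_unit_def by blast
  have "\<bar>f x * g x\<bar> \<le> A * B" if "x \<in> {0..1}" for x
    unfolding abs_mult using AB[OF that] by (intro mult_mono) (auto intro: order_trans[OF abs_ge_zero])
  then show ?thesis by (intro bounded_on_unitI) auto
qed

lemma bounded_on_unit_id: "bounded_on_unit (\<lambda>x. x)"
  by (rule bounded_on_unitI[where B = 1]) auto

lemma bounded_on_unit_indicator: "A \<in> sets borel \<Longrightarrow> bounded_on_unit (indicator A)"
  by (rule bounded_on_unitI[where B = 1]) (auto simp: indicator_def)

lemma integrable_unit:
  assumes "bounded_on_unit g"
  shows "integrable lborel (\<lambda>x. indicator {0..1} x * g x)"
proof -
  from assms obtain B where "g \<in> borel_measurable borel" "\<And>x. x \<in> {0..1} \<Longrightarrow> \<bar>g x\<bar> \<le> B"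
    unfolding bounded_on_unit_def by blast
  then have "integrable lborel (\<lambda>x. indicator {0..1} x *\<^sub>R g x)"
    by (intro integrableI_bounded_set_indicator[where B = B]) auto
  then show ?thesis by simp
qed

text \<open>Integrability and value are kept together, so that integrals of expanded squares follow from linearity
and from the integrals of products over the coordinates.\<close>

definition has_cube_integral :: "nat set \<Rightarrow> ((nat \<Rightarrow> real) \<Rightarrow> real) \<Rightarrow> real \<Rightarrow> bool" where
  "has_cube_integral u f v \<longleftrightarrow> has_bochner_integral (Pi\<^sub>M u (\<lambda>_. lborel))
     (\<lambda>t. indicator (Pi\<^sub>E u (\<lambda>_. {0..1})) t * f t) v"

lemma has_cube_integral_unique:
  "has_cube_integral u f v \<Longrightarrow> (LINT t : Pi\<^sub>E u (\<lambda>_. {0..1}) | Pi\<^sub>M u (\<lambda>_. lborel). f t) = v"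
  by (simp add: has_cube_integral_def set_lebesgue_integral_def has_bochner_integral_iff)

lemma has_cube_integral_add:
  "has_cube_integral u f v \<Longrightarrow> has_cube_integral u g w \<Longrightarrow> has_cube_integral u (\<lambda>t. f t + g t) (v + w)"
  unfolding has_cube_integral_def distrib_left by (rule has_bochner_integral_add)

lemma has_cube_integral_diff:
  "has_cube_integral u f v \<Longrightarrow> has_cube_integral u g w \<Longrightarrow> has_cube_integral u (\<lambda>t. f t - g t) (v - w)"
  unfolding has_cube_integral_def right_diff_distrib by (rule has_bochner_integral_diff)

lemma has_cube_integral_cmult:
  "has_cube_integral u f v \<Longrightarrow> has_cube_integral u (\<lambda>t. c * f t) (c * v)"
  unfolding has_cube_integral_def mult.left_commute[of _ c]
  by (rule has_bochner_integral_mult_right) simp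

lemma has_cube_integral_sum:
  "(\<And>j. j \<in> J \<Longrightarrow> has_cube_integral u (f j) (v j)) \<Longrightarrow>
    has_cube_integral u (\<lambda>t. \<Sum>j\<in>J. f j t) (\<Sum>j\<in>J. v j)"
  unfolding has_cube_integral_def sum_distrib_left by (rule has_bochner_integral_sum)

lemma has_cube_integral_nonneg:
  assumes "has_cube_integral u f v" "\<And>t. f t \<ge> 0"
  shows "v \<ge> 0"
  using assms unfolding has_cube_integral_def has_bochner_integral_iff
  by (auto intro!: integral_nonneg)

lemma has_cube_integral_prod:
  assumes "finite u" "\<And>i. i \<in> u \<Longrightarrow> bounded_on_unit (g i)"
  shows "has_cube_integral u (\<lambda>t. \<Prod>i\<in>u. g i (t i)) (\<Prod>i\<in>u. unit_integral (g i))"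
proof -
  interpret product_sigma_finite "\<lambda>_::nat. lborel :: real measure"
    by standard
  let ?h = "\<lambda>i x. indicator {0..1} x * g i x"
  have "indicator (Pi\<^sub>E u (\<lambda>_. {0..1})) t * (\<Prod>i\<in>u. g i (t i)) = (\<Prod>i\<in>u. ?h i (t i))"
    if "t \<in> space (Pi\<^sub>M u (\<lambda>_. lborel))" for t :: "nat \<Rightarrow> real"
  proof -
    have "t \<in> extensional u" using that by (simp add: space_PiM PiE_def)
    then have "indicator (Pi\<^sub>E u (\<lambda>_. {0..1})) t = (\<Prod>i\<in>u. indicator {0..1} (t i) :: real)"
      using assms(1) by (auto simp: indicator_def PiE_def Pi_def)
    then show ?thesis by (simp add: prod.distrib)
  qed
  then show ?thesis
    unfolding has_cube_integral_def has_bochner_integral_iff unit_integral_def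
    using product_integrable_prod[OF assms(1) integrable_unit[OF assms(2)]]
      product_integral_prod[OF assms(1) integrable_unit[OF assms(2)]]
    by (simp cong: Bochner_Integration.integrable_cong Bochner_Integration.integral_cong)
qed

lemma unit_integral_indicators:
  assumes "0 \<le> a" "a \<le> 1" "0 \<le> b" "b \<le> 1"
  shows "unit_integral (\<lambda>x. indicator {a<..} x * indicator {b<..} x) = 1 - max a b"
proof -
  have "unit_integral (\<lambda>x. indicator {a<..} x * indicator {b<..} x) = (LINT x|lborel. indicator {max a b<..1} x)"
    unfolding unit_integral_def using assms
    by (intro Bochner_Integration.integral_cong) (auto simp: indicator_def)
  also have "\<dots> = 1 - max a b" using assms by simp
  finally show ?thesis .
qed

lemma unit_integral_indicator_id:
  assumes "0 \<le> a" "a \<le> 1"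
  shows "unit_integral (\<lambda>x. indicator {a<..} x * x) = (1 - a\<^sup>2) / 2"
proof -
  have "unit_integral (\<lambda>x. indicator {a<..} x * x) = (LINT x|lborel. x ^ 1 * indicator {a..1} x)"
    unfolding unit_integral_def
  proof (rule integral_cong_AE)
    show "AE x in lborel. indicator {0..1} x * (indicator {a<..} x * x) = x ^ 1 * indicator {a..1} x"
      using AE_lborel_singleton[of a] by eventually_elim (use assms in \<open>auto simp: indicator_def\<close>)
  qed measurable
  also have "\<dots> = (1 - a\<^sup>2) / 2"
    using integral_power[of a 1 1] assms by (simp add: power2_eq_square)
  finally show ?thesis .
qed

lemma unit_integral_square: "unit_integral (\<lambda>x. x * x) = 1 / 3"
proof -
  have "unit_integral (\<lambda>x. x * x) = (LINT x|lborel. x ^ 2 * indicator {0..1} x)"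
    unfolding unit_integral_def by (simp add: power2_eq_square mult.commute)
  also have "\<dots> = 1 / 3" by (subst integral_power) auto
  finally show ?thesis .
qed

definition scaled_discrepancy :: "nat set \<Rightarrow> (nat \<Rightarrow> nat \<Rightarrow> real) \<Rightarrow> nat \<Rightarrow> (nat \<Rightarrow> real) \<Rightarrow> real" where
  "scaled_discrepancy u y N t = (\<Sum>n<N. \<Prod>i\<in>u. indicator {y n i<..} (t i)) - real N * (\<Prod>i\<in>u. t i)"

definition squared_discrepancy :: "nat set \<Rightarrow> (nat \<Rightarrow> nat \<Rightarrow> real) \<Rightarrow> nat \<Rightarrow> real" where
  "squared_discrepancy u y N = (\<Sum>n<N. \<Sum>m<N. \<Prod>i\<in>u. 1 - max (y n i) (y m i))
     - 2 * real N * (\<Sum>n<N. \<Prod>i\<in>u. (1 - (y n i)\<^sup>2) / 2) + (real N)\<^sup>2 * (1 / 3) ^ card u"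

text \<open>Warnock's formula: every term of the expanded square is a product of functions of one coordinate, and
the one-dimensional integrals are \<open>1 - max a b\<close>, \<open>(1 - a\<^sup>2) / 2\<close> and \<open>1/3\<close>.\<close>

lemma has_cube_integral_squared_discrepancy:
  assumes "finite u" and y: "\<And>n i. i \<in> u \<Longrightarrow> 0 \<le> y n i \<and> y n i \<le> 1"
  shows "has_cube_integral u (\<lambda>t. (scaled_discrepancy u y N t)\<^sup>2) (squared_discrepancy u y N)"
proof -
  let ?A = "\<lambda>n i x. indicator {y n i<..} x :: real"
  have A: "bounded_on_unit (?A n i)" for n i by (rule bounded_on_unit_indicator) simp
  have AA: "has_cube_integral u (\<lambda>t. \<Prod>i\<in>u. ?A n i (t i) * ?A m i (t i)) (\<Prod>i\<in>u. 1 - max (y n i) (y m i))" for n m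
    using has_cube_integral_prod[OF assms(1), of "\<lambda>i x. ?A n i x * ?A m i x"] y
    by (simp add: bounded_on_unit_mult A unit_integral_indicators)
  have AT: "has_cube_integral u (\<lambda>t. \<Prod>i\<in>u. ?A n i (t i) * t i) (\<Prod>i\<in>u. (1 - (y n i)\<^sup>2) / 2)" for n
    using has_cube_integral_prod[OF assms(1), of "\<lambda>i x. ?A n i x * x"] y
    by (simp add: bounded_on_unit_mult A bounded_on_unit_id unit_integral_indicator_id)
  have TT: "has_cube_integral u (\<lambda>t. \<Prod>i\<in>u. t i * t i) ((1 / 3) ^ card u)"
    using has_cube_integral_prod[OF assms(1), of "\<lambda>i x. x * x"]
    by (simp add: bounded_on_unit_mult bounded_on_unit_id unit_integral_square)
  have "(scaled_discrepancy u y N t)\<^sup>2 = (\<Sum>n<N. \<Sum>m<N. \<Prod>i\<in>u. ?A n i (t i) * ?A m i (t i))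
      - 2 * real N * (\<Sum>n<N. \<Prod>i\<in>u. ?A n i (t i) * t i) + (real N)\<^sup>2 * (\<Prod>i\<in>u. t i * t i)" for t
  proof -
    have "(a - real N * b)\<^sup>2 = a * a - 2 * real N * (a * b) + (real N)\<^sup>2 * (b * b)" for a b :: real
      by (simp add: power2_eq_square algebra_simps)
    then show ?thesis
      unfolding scaled_discrepancy_def prod.distrib sum_product[symmetric] sum_distrib_right[symmetric] .
  qed
  then show ?thesis
    unfolding squared_discrepancy_def
    by (simp only:) (intro has_cube_integral_add has_cube_integral_diff has_cube_integral_cmult
        has_cube_integral_sum AA AT TT)
qed

lemma indicator_anchored_box:
  assumes "u \<subseteq> {1..s}" "x n \<in> unit_cube s"
  shows "indicator (Pi\<^sub>E {1..s} (\<lambda>i. {0..<fill_ones s u t i})) (x n) = (\<Prod>i\<in>u. indicator {x n i<..} (t i) :: real)"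
proof -
  have fin: "finite u" using assms(1) by (rule finite_subset) simp
  have "x n \<in> Pi\<^sub>E {1..s} (\<lambda>i. {0..<fill_ones s u t i}) \<longleftrightarrow> (\<forall>i\<in>u. x n i < t i)"
    using assms by (auto simp: unit_cube_def PiE_def Pi_def fill_ones_def subset_eq)
  then show ?thesis using fin by (auto simp: indicator_def)
qed

lemma scaled_discrepancy_eq:
  assumes "u \<subseteq> {1..s}" "\<And>n. x n \<in> unit_cube s"
  shows "real N * local_discrepancy s x N (fill_ones s u t) = scaled_discrepancy u x N t"
proof -
  have "(\<Prod>i\<in>{1..s}. fill_ones s u t i) = (\<Prod>i\<in>u. t i)"
    using assms(1) by (intro prod.mono_neutral_cong_right) (auto simp: fill_ones_def)
  then show ?thesis
    unfolding local_discrepancy_def scaled_discrepancy_def indicator_anchored_box[of u s x, OF assms]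
    by (simp add: right_diff_distrib)
qed

lemma unit_cube_bounds:
  assumes "x \<in> unit_cube s" "i \<in> {1..s}"
  shows "0 \<le> x i \<and> x i \<le> 1"
  using PiE_mem[OF assms[unfolded unit_cube_def]] by auto

text \<open>A coordinate \<open>i \<notin> u\<close> of the test point equals \<open>1\<close> and imposes no condition on points of the cube, so each
projection has the same form as the full discrepancy, with index set \<open>u\<close>.\<close>

lemma scaled_L2_discrepancy:
  assumes "\<And>n. x n \<in> unit_cube s"
  shows "(real N * L2_discrepancy s N x)\<^sup>2 = (\<Sum>u | u \<noteq> {} \<and> u \<subseteq> {1..s}. squared_discrepancy u x N)"
proof -
  let ?I = "\<lambda>u f. (LINT t : Pi\<^sub>E u (\<lambda>_. {0..1}) | Pi\<^sub>M u (\<lambda>_. lborel). f t) :: real"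
  let ?d = "\<lambda>u t. \<bar>local_discrepancy s x N (fill_ones s u t)\<bar>\<^sup>2"
  have "(\<Sum>u | u \<noteq> {} \<and> u \<subseteq> {1..s}. ?I u (?d u)) \<ge> 0"
    unfolding set_lebesgue_integral_def by (intro sum_nonneg integral_nonneg) simp
  then have "(real N * L2_discrepancy s N x)\<^sup>2 = (real N)\<^sup>2 * (\<Sum>u | u \<noteq> {} \<and> u \<subseteq> {1..s}. ?I u (?d u))"
    unfolding L2_discrepancy_def by (simp add: power_mult_distrib)
  also have "\<dots> = (\<Sum>u | u \<noteq> {} \<and> u \<subseteq> {1..s}. squared_discrepancy u x N)"
    unfolding sum_distrib_left
  proof (intro sum.cong refl)
    fix u assume "u \<in> {u. u \<noteq> {} \<and> u \<subseteq> {1..s}}"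
    then have u: "u \<subseteq> {1..s}" by simp
    then have "finite u" by (rule finite_subset) simp
    have "(real N)\<^sup>2 * ?I u (?d u) = ?I u (\<lambda>t. (real N)\<^sup>2 * ?d u t)" by simp
    also have "\<dots> = ?I u (\<lambda>t. (scaled_discrepancy u x N t)\<^sup>2)"
      unfolding scaled_discrepancy_eq[OF u assms, symmetric] by (simp add: power_mult_distrib)
    also have "\<dots> = squared_discrepancy u x N"
      using unit_cube_bounds[OF assms] u \<open>finite u\<close>
      by (intro has_cube_integral_unique has_cube_integral_squared_discrepancy) auto
    finally show "(real N)\<^sup>2 * ?I u (?d u) = squared_discrepancy u x N" .
  qed
  finally show ?thesis .
qed

lemma squared_discrepancy_nonneg:
  assumes "finite u" "\<And>n i. i \<in> u \<Longrightarrow> 0 \<le> y n i \<and> y n i \<le> 1"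
  shows "squared_discrepancy u y N \<ge> 0"
  by (rule has_cube_integral_nonneg[OF has_cube_integral_squared_discrepancy[OF assms]]) simp_all

lemma L2_discrepancy_nonneg: "L2_discrepancy s N x \<ge> 0"
  unfolding L2_discrepancy_def set_lebesgue_integral_def
  by (intro real_sqrt_ge_zero sum_nonneg integral_nonneg) simp

section \<open>The upper bound for the mean square discrepancy\<close>

lemma uniform_shift_eq: "uniform_shift s = Pi\<^sub>M {1..s} (\<lambda>_. unit_measure)"
  by (simp add: uniform_shift_def unit_measure_def)

lemma has_bochner_integral_shift_prod:
  fixes f :: "nat \<Rightarrow> real \<Rightarrow> real"
  assumes "u \<subseteq> {1..s}" and [measurable]: "\<And>i. i \<in> u \<Longrightarrow> f i \<in> borel_measurable borel"
    and bound: "\<And>i x. i \<in> u \<Longrightarrow> \<bar>f i x\<bar> \<le> 1"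
  shows "has_bochner_integral (uniform_shift s) (\<lambda>\<sigma>. \<Prod>i\<in>u. f i (\<sigma> i)) (\<Prod>i\<in>u. LINT x|unit_measure. f i x)"
proof -
  interpret U: prob_space unit_measure by (rule prob_space_unit_measure)
  interpret product_sigma_finite "\<lambda>_::nat. unit_measure"
    by standard
  let ?g = "\<lambda>i x. if i \<in> u then f i x else 1"
  have int: "integrable unit_measure (?g i)" for i
    using bound by (cases "i \<in> u") (auto intro!: U.integrable_const_bound[where B = 1])
  have prod: "(\<Prod>i\<in>{1..s}. if i \<in> u then h i else 1) = (\<Prod>i\<in>u. h i)" for h :: "nat \<Rightarrow> real"
    using assms(1) by (intro prod.mono_neutral_cong_right) auto
  have g: "(LINT x|unit_measure. ?g i x) = (if i \<in> u then LINT x|unit_measure. f i x else 1)" for i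
    using U.prob_space by simp
  show ?thesis
    unfolding has_bochner_integral_iff uniform_shift_eq
    using product_integrable_prod[of "{1..s}" ?g] product_integral_prod[of "{1..s}" ?g] int
    by (simp only: finite_atLeastAtMost g prod)
qed

lemma shifted_halton_in_unit_cube: "shifted_halton s p \<sigma> n \<in> unit_cube s"
  by (auto simp: shifted_halton_def unit_cube_def padic_shift_bounds)

lemma shifted_halton_component:
  "i \<in> {1..s} \<Longrightarrow> shifted_halton s p \<sigma> n i = padic_shift (p i) (radical_inverse (p i) n) (\<sigma> i)"
  by (simp add: shifted_halton_def halton_def)

definition shift_kernel :: "nat \<Rightarrow> nat \<Rightarrow> nat \<Rightarrow> real" where
  "shift_kernel p n m = (LINT \<sigma>|unit_measure.
     1 - max (padic_shift p (radical_inverse p n) \<sigma>) (padic_shift p (radical_inverse p m) \<sigma>))"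

definition shift_moment :: "nat \<Rightarrow> nat \<Rightarrow> real" where
  "shift_moment p n = (LINT \<sigma>|unit_measure. (1 - (padic_shift p (radical_inverse p n) \<sigma>)\<^sup>2) / 2)"

lemma shift_integrand_bounds:
  "0 \<le> 1 - max (padic_shift p x \<sigma>) (padic_shift p y \<sigma>)" "1 - max (padic_shift p x \<sigma>) (padic_shift p y \<sigma>) \<le> 1"
  "0 \<le> (1 - (padic_shift p x \<sigma>)\<^sup>2) / 2" "(1 - (padic_shift p x \<sigma>)\<^sup>2) / 2 \<le> 1"
proof -
  have "padic_shift p x \<sigma> \<le> 1" "padic_shift p y \<sigma> \<le> 1" using padic_shift_bounds by (auto intro: less_imp_le)
  then show "0 \<le> 1 - max (padic_shift p x \<sigma>) (padic_shift p y \<sigma>)" "0 \<le> (1 - (padic_shift p x \<sigma>)\<^sup>2) / 2"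
    using padic_shift_bounds(1)[of p x \<sigma>] by (auto simp: power_le_one)
  show "1 - max (padic_shift p x \<sigma>) (padic_shift p y \<sigma>) \<le> 1"
    using padic_shift_bounds(1)[of p x \<sigma>] by (auto simp: le_max_iff_disj)
  have "-1 \<le> (padic_shift p x \<sigma>)\<^sup>2" by (rule order_trans[of _ 0]) auto
  then show "(1 - (padic_shift p x \<sigma>)\<^sup>2) / 2 \<le> 1" by simp
qed

lemma expectation_bounds:
  fixes f :: "real \<Rightarrow> real"
  assumes "\<And>x. 0 \<le> f x" "\<And>x. f x \<le> 1"
  shows "0 \<le> (LINT x|unit_measure. f x)" "(LINT x|unit_measure. f x) \<le> 1"
proof -
  interpret U: prob_space unit_measure by (rule prob_space_unit_measure)
  show "0 \<le> (LINT x|unit_measure. f x)" using assms by (intro Bochner_Integration.integral_nonneg)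
  show "(LINT x|unit_measure. f x) \<le> 1"
    using assms by (cases "integrable unit_measure f") (auto intro!: U.integral_le_const simp: not_integrable_integral_eq)
qed

definition expected_squared_discrepancy :: "nat set \<Rightarrow> (nat \<Rightarrow> nat) \<Rightarrow> nat \<Rightarrow> real" where
  "expected_squared_discrepancy u p N = (\<Sum>n<N. \<Sum>m<N. \<Prod>i\<in>u. shift_kernel (p i) n m)
     - 2 * real N * (\<Sum>n<N. \<Prod>i\<in>u. shift_moment (p i) n) + (real N)\<^sup>2 * (1 / 3) ^ card u"

lemma has_bochner_integral_squared_discrepancy:
  assumes "u \<subseteq> {1..s}"
  shows "has_bochner_integral (uniform_shift s) (\<lambda>\<sigma>. squared_discrepancy u (shifted_halton s p \<sigma>) N)
    (expected_squared_discrepancy u p N)"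
proof -
  interpret P: prob_space "uniform_shift s"
    unfolding uniform_shift_eq by (intro prob_space_PiM prob_space_unit_measure)
  let ?y = "\<lambda>n i. padic_shift (p i) (radical_inverse (p i) n)"
  have eq: "squared_discrepancy u (shifted_halton s p \<sigma>) N =
     (\<Sum>n<N. \<Sum>m<N. \<Prod>i\<in>u. 1 - max (?y n i (\<sigma> i)) (?y m i (\<sigma> i)))
     - 2 * real N * (\<Sum>n<N. \<Prod>i\<in>u. (1 - (?y n i (\<sigma> i))\<^sup>2) / 2) + (real N)\<^sup>2 * (1 / 3) ^ card u" for \<sigma>
    unfolding squared_discrepancy_def
    using assms by (intro arg_cong2[where f = "(+)"] arg_cong2[where f = "(-)"] arg_cong2[where f = "(*)"]
        refl sum.cong prod.cong) (auto simp: shifted_halton_component subset_eq)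
  have "has_bochner_integral (uniform_shift s) (\<lambda>\<sigma>. \<Prod>i\<in>u. 1 - max (?y n i (\<sigma> i)) (?y m i (\<sigma> i)))
     (\<Prod>i\<in>u. shift_kernel (p i) n m)" for n m
    unfolding shift_kernel_def
    by (rule has_bochner_integral_shift_prod[OF assms, of "\<lambda>i x. 1 - max (?y n i x) (?y m i x)"])
      (simp_all only: abs_of_nonneg shift_integrand_bounds, measurable)
  moreover have "has_bochner_integral (uniform_shift s) (\<lambda>\<sigma>. \<Prod>i\<in>u. (1 - (?y n i (\<sigma> i))\<^sup>2) / 2)
     (\<Prod>i\<in>u. shift_moment (p i) n)" for n
    unfolding shift_moment_def
    by (rule has_bochner_integral_shift_prod[OF assms, of "\<lambda>i x. (1 - (?y n i x)\<^sup>2) / 2"])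
      (simp_all only: abs_of_nonneg shift_integrand_bounds, measurable)
  moreover have "has_bochner_integral (uniform_shift s) (\<lambda>\<sigma>. c) c" for c :: real
    using P.prob_space by (simp add: has_bochner_integral_iff)
  ultimately show ?thesis
    unfolding eq expected_squared_discrepancy_def
    by (intro has_bochner_integral_add has_bochner_integral_diff has_bochner_integral_mult_right
        has_bochner_integral_sum) auto
qed

lemma prod_diff_bound:
  fixes a b :: "'i \<Rightarrow> real"
  assumes "\<And>i. i \<in> u \<Longrightarrow> \<bar>a i\<bar> \<le> 1" "\<And>i. i \<in> u \<Longrightarrow> \<bar>b i\<bar> \<le> 1"
    and "\<And>i. i \<in> u \<Longrightarrow> \<bar>a i - b i\<bar> \<le> e"
  shows "\<bar>(\<Prod>i\<in>u. a i) - (\<Prod>i\<in>u. b i)\<bar> \<le> real (card u) * e"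
proof -
  have "\<bar>(\<Prod>i\<in>u. a i) - (\<Prod>i\<in>u. b i)\<bar> \<le> (\<Sum>i\<in>u. \<bar>a i - b i\<bar>)"
    using norm_prod_diff[of u a b] assms by simp
  also have "\<dots> \<le> (\<Sum>i\<in>u. e)" by (intro sum_mono assms(3))
  finally show ?thesis by simp
qed

text \<open>With \<open>2\<^sup>k \<ge> N\<^sup>2\<close> the kernels may be replaced by the sums of their first \<open>k\<close> levels and the moments by \<open>1/3\<close>:
each of the \<open>N\<^sup>2\<close> terms changes by \<open>O(2\<^bsup>-k\<^esup>)\<close>.\<close>

lemma expected_squared_discrepancy_bound:
  assumes fin: "finite u" and prime: "\<And>i. i \<in> u \<Longrightarrow> prime (p i)" and inj: "inj_on p u"
    and N: "(real N)\<^sup>2 \<le> 2 ^ k"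
  shows "expected_squared_discrepancy u p N
    \<le> real (k + 1) ^ card u * (real (\<Prod>i\<in>u. p i))\<^sup>2 + 15 * real (card u)"
proof -
  let ?S = "\<lambda>i d. \<Sum>r\<le>k. level_term (p i) r d" and ?e = "real (card u) * (5 / 2 ^ k)"
  have p2: "p i \<ge> 2" if "i \<in> u" for i using prime[OF that] by (rule prime_ge_2_nat)
  have e: "5 / real (p i) ^ k \<le> 5 / 2 ^ k" if "i \<in> u" for i
    using p2[OF that] by (intro divide_left_mono power_mono mult_pos_pos) auto
  have S: "?S i d = 1 / 2 - pair_gap (1 / 6) (p i) k d" "\<bar>?S i d\<bar> \<le> 1" if "i \<in> u" for i d
  proof -
    show S: "?S i d = 1 / 2 - pair_gap (1 / 6) (p i) k d" using p2[OF that] by (intro sum_level_terms) auto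
    show "\<bar>?S i d\<bar> \<le> 1"
      unfolding S using pair_gap_bounds[of "p i" "1 / 6" k d] p2[OF that] by (simp add: abs_le_iff)
  qed
  have kernel: "\<bar>(\<Prod>i\<in>u. shift_kernel (p i) n m) - (\<Prod>i\<in>u. ?S i (int n - int m))\<bar> \<le> ?e" for n m
  proof (rule prod_diff_bound)
    fix i assume i: "i \<in> u"
    show "\<bar>shift_kernel (p i) n m\<bar> \<le> 1"
      unfolding shift_kernel_def
      using expectation_bounds[of "\<lambda>\<sigma>. 1 - max (padic_shift (p i) _ \<sigma>) (padic_shift (p i) _ \<sigma>)"]
      by (simp only: abs_of_nonneg shift_integrand_bounds)
    show "\<bar>?S i (int n - int m)\<bar> \<le> 1" by (rule S(2)[OF i])
    show "\<bar>shift_kernel (p i) n m - ?S i (int n - int m)\<bar> \<le> 5 / 2 ^ k"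
      unfolding S(1)[OF i] shift_kernel_def
      using expectation_one_minus_max[OF p2[OF i]] e[OF i] by (rule order_trans)
  qed
  have moment: "\<bar>(\<Prod>i\<in>u. shift_moment (p i) n) - (\<Prod>i\<in>u. 1 / 3)\<bar> \<le> ?e" for n
  proof (rule prod_diff_bound)
    fix i assume i: "i \<in> u"
    show "\<bar>shift_moment (p i) n\<bar> \<le> 1"
      unfolding shift_moment_def
      using expectation_bounds[of "\<lambda>\<sigma>. (1 - (padic_shift (p i) _ \<sigma>)\<^sup>2) / 2"]
      by (simp only: abs_of_nonneg shift_integrand_bounds)
    show "\<bar>shift_moment (p i) n - 1 / 3\<bar> \<le> 5 / 2 ^ k"
      unfolding shift_moment_def
      using expectation_one_minus_square[OF p2[OF i]] e[OF i] by (rule order_trans)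
  qed simp
  \<comment> \<open>The error is \<open>N\<^sup>2 ?e\<close> from the kernels and twice as much from the moments.\<close>
  have Ne: "(real N)\<^sup>2 * ?e \<le> 5 * real (card u)"
  proof -
    have "(real N)\<^sup>2 * ?e \<le> 2 ^ k * ?e" using N by (intro mult_right_mono) auto
    then show ?thesis by simp
  qed
  have "(\<Sum>n<N. \<Sum>m<N. \<Prod>i\<in>u. shift_kernel (p i) n m)
     \<le> (\<Sum>n<N. \<Sum>m<N. ((\<Prod>i\<in>u. ?S i (int n - int m)) - (1 / 3) ^ card u) + (1 / 3) ^ card u + ?e)"
    using kernel by (intro sum_mono) (simp add: abs_le_iff algebra_simps)
  also have "\<dots> = (\<Sum>n<N. \<Sum>m<N. (\<Prod>i\<in>u. ?S i (int n - int m)) - (1 / 3) ^ card u)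
     + (real N)\<^sup>2 * (1 / 3) ^ card u + (real N)\<^sup>2 * ?e"
    by (simp only: sum.distrib sum_constant card_lessThan) (simp add: power2_eq_square)
  also have "\<dots> \<le> real (k + 1) ^ card u * (real (\<Prod>i\<in>u. p i))\<^sup>2
     + (real N)\<^sup>2 * (1 / 3) ^ card u + 5 * real (card u)"
    using Ne by (intro add_mono double_sum_truncated_kernel_bound fin prime inj) simp_all
  finally have 1: "(\<Sum>n<N. \<Sum>m<N. \<Prod>i\<in>u. shift_kernel (p i) n m)
     \<le> real (k + 1) ^ card u * (real (\<Prod>i\<in>u. p i))\<^sup>2 + (real N)\<^sup>2 * (1 / 3) ^ card u + 5 * real (card u)" .
  have "(\<Sum>n<N. \<Prod>i\<in>u. shift_moment (p i) n) \<ge> (\<Sum>n<N. (1 / 3) ^ card u - ?e)"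
    using moment by (intro sum_mono) (simp add: abs_le_iff algebra_simps)
  then have "2 * real N * (\<Sum>n<N. \<Prod>i\<in>u. shift_moment (p i) n) \<ge> 2 * real N * (real N * ((1 / 3) ^ card u - ?e))"
    by (intro mult_left_mono) simp_all
  also have "2 * real N * (real N * ((1 / 3) ^ card u - ?e)) = 2 * ((real N)\<^sup>2 * (1 / 3) ^ card u) - 2 * ((real N)\<^sup>2 * ?e)"
    by (simp add: power2_eq_square algebra_simps)
  finally show ?thesis
    unfolding expected_squared_discrepancy_def using 1 Ne by linarith
qed

lemma scaled_RMS_L2_discrepancy:
  "(real N * RMS_L2_discrepancy s N p)\<^sup>2 = (\<Sum>u | u \<noteq> {} \<and> u \<subseteq> {1..s}. expected_squared_discrepancy u p N)"
  and has_bochner_integral_scaled_L2: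
  "has_bochner_integral (uniform_shift s) (\<lambda>\<sigma>. (real N * L2_discrepancy s N (shifted_halton s p \<sigma>))\<^sup>2)
     ((real N * RMS_L2_discrepancy s N p)\<^sup>2)"
proof -
  let ?L = "\<lambda>\<sigma>. (L2_discrepancy s N (shifted_halton s p \<sigma>))\<^sup>2"
  have E: "has_bochner_integral (uniform_shift s) (\<lambda>\<sigma>. (real N * L2_discrepancy s N (shifted_halton s p \<sigma>))\<^sup>2)
     (\<Sum>u | u \<noteq> {} \<and> u \<subseteq> {1..s}. expected_squared_discrepancy u p N)"
    unfolding scaled_L2_discrepancy[OF shifted_halton_in_unit_cube]
    by (intro has_bochner_integral_sum has_bochner_integral_squared_discrepancy) simp
  have "(real N * RMS_L2_discrepancy s N p)\<^sup>2 = (real N)\<^sup>2 * (LINT \<sigma>|uniform_shift s. ?L \<sigma>)"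
    unfolding RMS_L2_discrepancy_def by (simp add: power_mult_distrib integral_nonneg)
  also have "\<dots> = (LINT \<sigma>|uniform_shift s. (real N * L2_discrepancy s N (shifted_halton s p \<sigma>))\<^sup>2)"
    by (simp add: power_mult_distrib)
  also have "\<dots> = (\<Sum>u | u \<noteq> {} \<and> u \<subseteq> {1..s}. expected_squared_discrepancy u p N)"
    using E by (rule has_bochner_integral_integral_eq)
  finally show eq: "(real N * RMS_L2_discrepancy s N p)\<^sup>2 = (\<Sum>u | u \<noteq> {} \<and> u \<subseteq> {1..s}. expected_squared_discrepancy u p N)" .
  show "has_bochner_integral (uniform_shift s) (\<lambda>\<sigma>. (real N * L2_discrepancy s N (shifted_halton s p \<sigma>))\<^sup>2)
     ((real N * RMS_L2_discrepancy s N p)\<^sup>2)"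
    unfolding eq by (rule E)
qed

lemma scaled_RMS_bound:
  assumes prime: "\<And>i. i \<in> {1..s} \<Longrightarrow> prime (p i)" and inj: "inj_on p {1..s}"
    and N: "(real N)\<^sup>2 \<le> 2 ^ k"
  shows "(real N * RMS_L2_discrepancy s N p)\<^sup>2
    \<le> 2 ^ s * ((real (\<Prod>i\<in>{1..s}. p i))\<^sup>2 + 15 * real s) * real (k + 1) ^ s"
proof -
  let ?P = "(real (\<Prod>i\<in>{1..s}. p i))\<^sup>2"
  have "expected_squared_discrepancy u p N \<le> (?P + 15 * real s) * real (k + 1) ^ s" if "u \<subseteq> {1..s}" for u
  proof -
    have fin: "finite u" using that by (rule finite_subset) simp
    have card: "card u \<le> s" using card_mono[OF _ that] by simp
    have "(\<Prod>i\<in>u. p i) \<le> (\<Prod>i\<in>{1..s}. p i)"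
    proof (rule dvd_imp_le)
      show "(\<Prod>i\<in>u. p i) dvd (\<Prod>i\<in>{1..s}. p i)" using that by (intro prod_dvd_prod_subset) auto
      show "0 < (\<Prod>i\<in>{1..s}. p i)" using prime by (intro prod_pos) (auto intro: prime_gt_0_nat)
    qed
    then have P: "(real (\<Prod>i\<in>u. p i))\<^sup>2 \<le> ?P" by (intro power_mono) (simp_all only: of_nat_le_iff of_nat_0_le_iff)
    have "expected_squared_discrepancy u p N
        \<le> real (k + 1) ^ card u * (real (\<Prod>i\<in>u. p i))\<^sup>2 + 15 * real (card u)"
      using that prime inj_on_subset[OF inj that] N
      by (intro expected_squared_discrepancy_bound fin) auto
    also have "\<dots> \<le> real (k + 1) ^ s * ?P + 15 * real s * real (k + 1) ^ s"
    proof (rule add_mono)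
      show "real (k + 1) ^ card u * (real (\<Prod>i\<in>u. p i))\<^sup>2 \<le> real (k + 1) ^ s * ?P"
        using card by (intro mult_mono power_increasing P) auto
      have "15 * real (card u) * 1 \<le> 15 * real s * real (k + 1) ^ s"
        using card by (intro mult_mono one_le_power) auto
      then show "15 * real (card u) \<le> 15 * real s * real (k + 1) ^ s" by simp
    qed
    finally show ?thesis by (simp add: algebra_simps)
  qed
  then have "(real N * RMS_L2_discrepancy s N p)\<^sup>2
      \<le> (\<Sum>u | u \<noteq> {} \<and> u \<subseteq> {1..s}. (?P + 15 * real s) * real (k + 1) ^ s)"
    unfolding scaled_RMS_L2_discrepancy by (intro sum_mono) simp
  also have "\<dots> = real (card {u. u \<noteq> {} \<and> u \<subseteq> {1..s}}) * ((?P + 15 * real s) * real (k + 1) ^ s)" by simp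
  also have "\<dots> \<le> 2 ^ s * ((?P + 15 * real s) * real (k + 1) ^ s)"
  proof (intro mult_right_mono)
    have "card {u. u \<noteq> {} \<and> u \<subseteq> {1..s}} \<le> card (Pow {1..s})" by (intro card_mono) auto
    then have "card {u. u \<noteq> {} \<and> u \<subseteq> {1..s}} \<le> 2 ^ s" by (simp add: card_Pow)
    then have "real (card {u. u \<noteq> {} \<and> u \<subseteq> {1..s}}) \<le> real (2 ^ s)" by (simp only: of_nat_le_iff)
    then show "real (card {u. u \<noteq> {} \<and> u \<subseteq> {1..s}}) \<le> 2 ^ s" by simp
  qed simp
  finally show ?thesis by (simp only: mult.assoc)
qed

lemma ln_powr_half_power2:
  assumes "N \<ge> 2" "c \<ge> 0"
  shows "(c * ln (real N) powr (real s / 2))\<^sup>2 = c\<^sup>2 * ln (real N) ^ s"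
proof -
  have "ln (real N) > 0" using assms by simp
  then have "(ln (real N) powr (real s / 2))\<^sup>2 = ln (real N) ^ s"
    by (simp add: power2_eq_square powr_add[symmetric] powr_realpow)
  then show ?thesis by (simp add: power_mult_distrib)
qed

text \<open>The depth \<open>k = 2 \<lceil>log\<^sub>2 N\<rceil>\<close> suffices for every base, and \<open>k + 1 \<le> (5 / ln 2) ln N\<close>.\<close>

lemma RMS_L2_discrepancy_upper_bound:
  assumes prime: "\<And>i. i \<in> {1..s} \<Longrightarrow> prime (p i)" and inj: "inj_on p {1..s}"
  shows "\<exists>C>0. \<forall>N\<ge>2. RMS_L2_discrepancy s N p \<le> C * (ln (real N) powr (real s / 2) / real N)"
proof -
  let ?A = "2 ^ s * ((real (\<Prod>i\<in>{1..s}. p i))\<^sup>2 + 15 * real s)"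
  let ?C = "sqrt (?A * (5 / ln 2) ^ s) + 1"
  have "RMS_L2_discrepancy s N p \<le> ?C * (ln (real N) powr (real s / 2) / real N)" if "N \<ge> 2" for N
  proof -
    have lnN: "ln (real N) \<ge> ln 2" using that by (subst ln_le_cancel_iff) auto
    define l where "l = nat \<lceil>log 2 (real N)\<rceil>"
    have log: "0 \<le> log 2 (real N)" using that by simp
    then have l: "log 2 (real N) \<le> real l" "real l \<le> log 2 (real N) + 1" unfolding l_def by linarith+
    have "real N \<le> 2 ^ l"
      using l(1) that by (simp add: log_le_iff powr_realpow)
    then have "(real N)\<^sup>2 \<le> (2 ^ l)\<^sup>2" by (intro power_mono) auto
    also have "\<dots> = 2 ^ (2 * l)" by (simp only: power_mult[symmetric] mult.commute)
    finally have N: "(real N)\<^sup>2 \<le> 2 ^ (2 * l)" .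
    have "1 \<le> ln (real N) / ln 2" using lnN by (simp add: le_divide_eq)
    moreover have "real l \<le> ln (real N) / ln 2 + 1" using l(2) by (simp add: log_def)
    ultimately have "real (2 * l + 1) \<le> 5 * (ln (real N) / ln 2)"
      unfolding of_nat_add of_nat_mult by linarith
    then have k: "real (2 * l + 1) \<le> 5 / ln 2 * ln (real N)" by simp
    have "(real N * RMS_L2_discrepancy s N p)\<^sup>2 \<le> ?A * real (2 * l + 1) ^ s"
      by (rule scaled_RMS_bound[OF prime inj N])
    also have "\<dots> \<le> ?A * (5 / ln 2 * ln (real N)) ^ s"
      by (intro mult_left_mono power_mono k) auto
    also have "\<dots> = (sqrt (?A * (5 / ln 2) ^ s))\<^sup>2 * ln (real N) ^ s"
      by (simp add: power_mult_distrib power_divide)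
    also have "\<dots> \<le> ?C\<^sup>2 * ln (real N) ^ s"
      using lnN by (intro mult_right_mono power_mono zero_le_power) (auto intro: order_trans[of 0 "ln 2"])
    also have "\<dots> = (?C * ln (real N) powr (real s / 2))\<^sup>2"
      using that by (intro ln_powr_half_power2[symmetric]) auto
    finally have "real N * RMS_L2_discrepancy s N p \<le> ?C * ln (real N) powr (real s / 2)"
      by (rule power2_le_imp_le) auto
    then show ?thesis using that by (simp add: field_simps)
  qed
  moreover have "?C > 0" by (intro add_nonneg_pos) auto
  ultimately show ?thesis by blast
qed

text \<open>Otherwise the discrepancy exceeds \<open>b\<close> on the whole cube, hence for almost all shifts, and its root mean
square is at least \<open>b\<close>.\<close>

lemma exists_shift_below_RMS:
  assumes "RMS_L2_discrepancy s N p < b" "N > 0"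
  shows "\<exists>\<sigma>\<in>unit_cube s. L2_discrepancy s N (shifted_halton s p \<sigma>) \<le> b"
proof (rule ccontr)
  assume "\<not> ?thesis"
  then have large: "b < L2_discrepancy s N (shifted_halton s p \<sigma>)" if "\<sigma> \<in> unit_cube s" for \<sigma>
    using that by force
  interpret P: prob_space "uniform_shift s"
    unfolding uniform_shift_eq by (intro prob_space_PiM prob_space_unit_measure)
  interpret U: prob_space unit_measure by (rule prob_space_unit_measure)
  interpret F: finite_product_sigma_finite "\<lambda>_::nat. unit_measure" "{1..s}"
    by standard auto
  have RMS0: "RMS_L2_discrepancy s N p \<ge> 0"
    unfolding RMS_L2_discrepancy_def by (intro real_sqrt_ge_zero integral_nonneg) simp
  have "measure unit_measure {0..<1} = 1" by (subst measure_unit_measure_cell) auto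
  then have "emeasure unit_measure {0..<1} = 1" by (simp add: U.emeasure_eq_measure)
  then have "emeasure (uniform_shift s) (unit_cube s) = 1"
    unfolding uniform_shift_eq unit_cube_def by (subst F.emeasure_PiM) auto
  then have "P.prob (unit_cube s) = 1" by (simp add: P.emeasure_eq_measure)
  then have "AE \<sigma> in uniform_shift s. \<sigma> \<in> unit_cube s" by (rule P.AE_prob_1)
  then have "AE \<sigma> in uniform_shift s. (real N * b)\<^sup>2 \<le> (real N * L2_discrepancy s N (shifted_halton s p \<sigma>))\<^sup>2"
  proof eventually_elim
    case (elim \<sigma>)
    show ?case using large[OF elim] assms(1) RMS0 by (intro power_mono mult_left_mono) auto
  qed
  then have "(real N * b)\<^sup>2 \<le> (LINT \<sigma>|uniform_shift s. (real N * L2_discrepancy s N (shifted_halton s p \<sigma>))\<^sup>2)"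
    using has_bochner_integral_scaled_L2[of s N p] by (intro P.integral_ge_const) (auto simp: has_bochner_integral_iff)
  also have "\<dots> = (real N * RMS_L2_discrepancy s N p)\<^sup>2"
    using has_bochner_integral_scaled_L2[of s N p] by (rule has_bochner_integral_integral_eq)
  finally have "real N * b \<le> real N * RMS_L2_discrepancy s N p"
    using RMS0 by (intro power2_le_imp_le[of "real N * b"]) auto
  then show False using assms by simp
qed

section \<open>Haar functions of empty boxes and the lower bound\<close>

definition haar_sign :: "nat \<Rightarrow> int \<Rightarrow> real" where
  "haar_sign k j = (if j = 2 * int k then -1 else if j = 2 * int k + 1 then 1 else 0)"

definition haar :: "nat \<Rightarrow> nat \<Rightarrow> real \<Rightarrow> real" where
  "haar r k x = haar_sign k \<lfloor>x * 2 ^ Suc r\<rfloor>"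

lemma measurable_haar [measurable]: "haar r k \<in> borel_measurable borel"
proof -
  have [measurable]: "haar_sign k \<in> borel_measurable (count_space UNIV)" by simp
  show ?thesis unfolding haar_def by measurable
qed

lemma bounded_on_unit_haar: "bounded_on_unit (haar r k)"
  by (rule bounded_on_unitI[where B = 1]) (auto simp: haar_def haar_sign_def)

lemma haar_eq_indicators:
  "haar r k x = indicator {(2 * real k + 1) / 2 ^ Suc r..<(2 * real k + 2) / 2 ^ Suc r} x
     - indicator {2 * real k / 2 ^ Suc r..<(2 * real k + 1) / 2 ^ Suc r} x"
proof -
  have 1: "\<lfloor>x * 2 ^ Suc r\<rfloor> = 2 * int k \<longleftrightarrow> x \<in> {2 * real k / 2 ^ Suc r..<(2 * real k + 1) / 2 ^ Suc r}"
    unfolding floor_eq_iff by (simp add: divide_le_eq less_divide_eq del: power_Suc)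
  have 2: "\<lfloor>x * 2 ^ Suc r\<rfloor> = 2 * int k + 1
      \<longleftrightarrow> x \<in> {(2 * real k + 1) / 2 ^ Suc r..<(2 * real k + 2) / 2 ^ Suc r}"
    unfolding floor_eq_iff by (simp add: divide_le_eq less_divide_eq add.assoc del: power_Suc)
  have 3: "\<not> (x \<in> {2 * real k / 2 ^ Suc r..<(2 * real k + 1) / 2 ^ Suc r}
      \<and> x \<in> {(2 * real k + 1) / 2 ^ Suc r..<(2 * real k + 2) / 2 ^ Suc r})"
    by auto
  show ?thesis
    unfolding haar_def haar_sign_def 1 2 indicator_def of_bool_def using 3 by auto
qed

lemma haar_intervals:
  assumes "k < 2 ^ r"
  shows "0 \<le> 2 * real k / 2 ^ Suc r" "2 * real k / 2 ^ Suc r \<le> (2 * real k + 1) / 2 ^ Suc r"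
    "(2 * real k + 1) / 2 ^ Suc r \<le> (2 * real k + 2) / 2 ^ Suc r" "(2 * real k + 2) / 2 ^ Suc r \<le> 1"
proof -
  have "k + 1 \<le> 2 ^ r" using assms by simp
  then have "real (k + 1) \<le> real (2 ^ r)" by (simp only: of_nat_le_iff)
  then show "(2 * real k + 2) / 2 ^ Suc r \<le> 1" by (simp add: divide_le_eq)
qed (simp_all add: divide_right_mono del: power_Suc)

lemma unit_integral_diff:
  assumes "bounded_on_unit f" "bounded_on_unit g"
  shows "unit_integral (\<lambda>x. f x - g x) = unit_integral f - unit_integral g"
  using integrable_unit[OF assms(1)] integrable_unit[OF assms(2)]
  by (simp add: unit_integral_def right_diff_distrib)

lemma unit_integral_cmult: "unit_integral (\<lambda>x. c * f x) = c * unit_integral f"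
  by (simp add: unit_integral_def mult.left_commute[of _ c])

lemma unit_integral_interval:
  assumes "0 \<le> a" "a \<le> b" "b \<le> 1"
  shows "unit_integral (indicator {a..<b}) = b - a"
proof -
  have "unit_integral (indicator {a..<b}) = (LINT x|lborel. indicator {a..<b} x)"
    unfolding unit_integral_def using assms
    by (intro Bochner_Integration.integral_cong) (auto simp: indicator_def)
  then show ?thesis using assms by simp
qed

lemma unit_integral_interval_id:
  assumes "0 \<le> a" "a \<le> b" "b \<le> 1"
  shows "unit_integral (\<lambda>x. x * indicator {a..<b} x) = (b\<^sup>2 - a\<^sup>2) / 2"
proof -
  have "unit_integral (\<lambda>x. x * indicator {a..<b} x) = (LINT x|lborel. x ^ 1 * indicator {a..b} x)"
    unfolding unit_integral_def
  proof (rule integral_cong_AE)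
    show "AE x in lborel. indicator {0..1} x * (x * indicator {a..<b} x) = x ^ 1 * indicator {a..b} x"
      using AE_lborel_singleton[of b] by eventually_elim (use assms in \<open>auto simp: indicator_def\<close>)
  qed measurable
  also have "\<dots> = (b\<^sup>2 - a\<^sup>2) / 2"
    using integral_power[of a b 1] assms by (simp add: power2_eq_square)
  finally show ?thesis .
qed

lemma unit_integral_haar:
  assumes "k < 2 ^ r"
  shows "unit_integral (haar r k) = 0"
  unfolding haar_eq_indicators[abs_def] using haar_intervals[OF assms]
  by (subst unit_integral_diff)
    (simp_all add: bounded_on_unit_indicator unit_integral_interval diff_divide_distrib[symmetric] del: power_Suc)

lemma unit_integral_id_haar:
  assumes "k < 2 ^ r"
  shows "unit_integral (\<lambda>x. x * haar r k x) = 1 / 4 ^ Suc r"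
proof -
  let ?a = "2 * real k / 2 ^ Suc r" and ?b = "(2 * real k + 1) / 2 ^ Suc r" and ?c = "(2 * real k + 2) / 2 ^ Suc r"
  have "unit_integral (\<lambda>x. x * haar r k x) = unit_integral (\<lambda>x. x * indicator {?b..<?c} x - x * indicator {?a..<?b} x)"
    unfolding haar_eq_indicators right_diff_distrib ..
  also have "\<dots> = (?c\<^sup>2 - ?b\<^sup>2) / 2 - (?b\<^sup>2 - ?a\<^sup>2) / 2"
    using haar_intervals[OF assms]
    by (subst unit_integral_diff)
      (simp_all add: bounded_on_unit_mult bounded_on_unit_id bounded_on_unit_indicator unit_integral_interval_id
        del: power_Suc)
  also have "\<dots> = 1 / (2 ^ Suc r)\<^sup>2"
    by (simp add: power2_eq_square field_simps)
  also have "(2 ^ Suc r)\<^sup>2 = (4 ^ Suc r :: real)"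
    by (simp add: power2_eq_square power_mult_distrib[symmetric] del: power_Suc)
  finally show ?thesis .
qed

lemma unit_integral_haar_square:
  assumes "k < 2 ^ r"
  shows "unit_integral (\<lambda>x. haar r k x * haar r k x) = 1 / 2 ^ r"
proof -
  let ?a = "2 * real k / 2 ^ Suc r" and ?c = "(2 * real k + 2) / 2 ^ Suc r"
  have "haar r k x * haar r k x = indicator {?a..<?c} x" for x
    unfolding haar_eq_indicators using haar_intervals[OF assms] by (auto simp: indicator_def simp del: power_Suc)
  then have "unit_integral (\<lambda>x. haar r k x * haar r k x) = ?c - ?a"
    using haar_intervals[OF assms] by (simp add: unit_integral_interval del: power_Suc)
  then show ?thesis by (simp add: add_divide_distrib)
qed

lemma haar_nonzero_position:
  assumes "haar r k x \<noteq> 0"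
  shows "\<lfloor>x * 2 ^ r\<rfloor> = int k"
proof -
  have "x * 2 ^ r = x * 2 ^ Suc r / real_of_int (int 2)" by simp
  then have "\<lfloor>x * 2 ^ r\<rfloor> = \<lfloor>x * 2 ^ Suc r\<rfloor> div int 2" by (metis floor_divide_real_eq_div of_nat_0_le_iff)
  then show ?thesis using assms by (auto simp: haar_def haar_sign_def split: if_splits)
qed

text \<open>The coarser function is constant on the support of the finer one, and the finer one has mean zero.\<close>

lemma unit_integral_haar_levels:
  assumes "r < r'" "k' < 2 ^ r'"
  shows "unit_integral (\<lambda>x. haar r k x * haar r' k' x) = 0"
proof -
  define c where "c = haar_sign k (int k' div int (2 ^ (r' - Suc r)))"
  have "(\<lambda>x. haar r k x * haar r' k' x) = (\<lambda>x. c * haar r' k' x)"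
  proof
    fix x show "haar r k x * haar r' k' x = c * haar r' k' x"
    proof (cases "haar r' k' x = 0")
      case False
      have "x * 2 ^ Suc r * 2 ^ (r' - Suc r) = x * 2 ^ r'"
        using assms(1) by (simp add: power_add[symmetric] mult.assoc del: power_Suc)
      then have "x * 2 ^ Suc r = x * 2 ^ r' / real_of_int (int (2 ^ (r' - Suc r)))"
        by (simp add: field_simps)
      then have "\<lfloor>x * 2 ^ Suc r\<rfloor> = \<lfloor>x * 2 ^ r'\<rfloor> div int (2 ^ (r' - Suc r))"
        by (metis floor_divide_real_eq_div of_nat_0_le_iff)
      then show ?thesis unfolding haar_nonzero_position[OF False] by (simp only: haar_def[of r k] c_def)
    qed simp
  qed
  then show ?thesis using unit_integral_haar[OF assms(2)] by (simp only: unit_integral_cmult mult_zero_right)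
qed

lemma unit_integral_haar_orthogonal:
  assumes "(r, k) \<noteq> (r', k')" "k < 2 ^ r" "k' < 2 ^ r'"
  shows "unit_integral (\<lambda>x. haar r k x * haar r' k' x) = 0"
proof -
  consider "r < r'" | "r' < r" | "r = r'" "k \<noteq> k'" using assms(1) by fastforce
  then show ?thesis
  proof cases
    case 1
    then show ?thesis using assms by (intro unit_integral_haar_levels)
  next
    case 2
    then show ?thesis using unit_integral_haar_levels[of r' r k k'] assms by (simp add: mult.commute)
  next
    case 3
    have "(\<lambda>x. haar r k x * haar r' k' x) = (\<lambda>x. 0)"
    proof
      fix x
      have "haar r k x = 0 \<or> haar r' k' x = 0"
        using haar_nonzero_position[of r k x] haar_nonzero_position[of r' k' x] 3 by fastforce
      then show "haar r k x * haar r' k' x = 0" by simp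
    qed
    then show ?thesis by (simp only:) (simp add: unit_integral_def)
  qed
qed

text \<open>The indicator is constant on the interval of the Haar function when its endpoint lies outside. This is
why the points of the sequence do not contribute to the coefficient of an empty box.\<close>

lemma unit_integral_indicator_haar:
  assumes "\<lfloor>a * 2 ^ r\<rfloor> \<noteq> int k" "k < 2 ^ r"
  shows "unit_integral (\<lambda>x. indicator {a<..} x * haar r k x) = 0"
proof (cases "a * 2 ^ r < real k")
  case True
  have "(\<lambda>x. indicator {a<..} x * haar r k x) = haar r k"
  proof
    fix x show "indicator {a<..} x * haar r k x = haar r k x"
    proof (cases "haar r k x = 0")
      case False
      then have "real k \<le> x * 2 ^ r" using haar_nonzero_position[OF False] by linarith
      then have "a * 2 ^ r < x * 2 ^ r" using True by linarith
      then show ?thesis by simp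
    qed simp
  qed
  then show ?thesis using unit_integral_haar[OF assms(2)] by (simp only:)
next
  case False
  then have a: "real k + 1 \<le> a * 2 ^ r" using assms(1) by linarith
  have "(\<lambda>x. indicator {a<..} x * haar r k x) = (\<lambda>x. 0)"
  proof
    fix x show "indicator {a<..} x * haar r k x = 0"
    proof (cases "haar r k x = 0")
      case False
      then have "x * 2 ^ r < real k + 1" using haar_nonzero_position[OF False] by linarith
      then have "x * 2 ^ r < a * 2 ^ r" using a by linarith
      then show ?thesis by simp
    qed simp
  qed
  then show ?thesis by (simp only:) (simp add: unit_integral_def)
qed

text \<open>A Haar function in the index \<open>N\<close>: it is \<open>-1\<close> on the first and \<open>1\<close> on the second half of the block of length
\<open>2 h\<close> with number \<open>k\<close>.\<close>

definition time_haar :: "nat \<Rightarrow> nat \<Rightarrow> nat \<Rightarrow> real" where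
  "time_haar h k N = haar_sign k (int (N div h))"

lemma sum_time_haar:
  assumes "h > 0" "k < K"
  shows "(\<Sum>N<K * 2 * h. f N * time_haar h k N) = (\<Sum>b<h. f ((2 * k + 1) * h + b)) - (\<Sum>b<h. f (2 * k * h + b))"
proof -
  have "(\<Sum>N<K * 2 * h. f N * time_haar h k N) = (\<Sum>a<K * 2. \<Sum>b<h. f (a * h + b) * haar_sign k (int a))"
    unfolding sum_lessThan_mult[of _ "K * 2" h] time_haar_def using assms(1) by (intro sum.cong refl) simp
  also have "\<dots> = (\<Sum>a<K * 2. haar_sign k (int a) * (\<Sum>b<h. f (a * h + b)))"
    by (simp add: sum_distrib_left mult.commute)
  also have "\<dots> = (\<Sum>a\<in>{2 * k, 2 * k + 1}. haar_sign k (int a) * (\<Sum>b<h. f (a * h + b)))"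
    using assms(2) by (intro sum.mono_neutral_right) (auto simp: haar_sign_def)
  also have "\<dots> = (\<Sum>b<h. f ((2 * k + 1) * h + b)) - (\<Sum>b<h. f (2 * k * h + b))"
    by (simp add: haar_sign_def)
  finally show ?thesis .
qed

lemma sum_time_haar_square:
  assumes "h > 0" "k < K"
  shows "(\<Sum>N<K * 2 * h. time_haar h k N * time_haar h k N) = 2 * real h"
proof -
  have "(c * h + b) div h = c" if "b < h" for b c using that by simp
  then show ?thesis
    unfolding sum_time_haar[OF assms] by (simp add: time_haar_def haar_sign_def del: distrib_right mult_Suc)
qed

lemma sum_time_haar_id:
  assumes "h > 0" "k < K"
  shows "(\<Sum>N<K * 2 * h. real N * time_haar h k N) = (real h)\<^sup>2"
proof -
  have "(\<Sum>b<h. real ((2 * k + 1) * h + b)) - (\<Sum>b<h. real (2 * k * h + b)) = (\<Sum>b<h. real h)"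
    unfolding sum_subtractf[symmetric] by (intro sum.cong refl) (simp add: algebra_simps)
  then show ?thesis unfolding sum_time_haar[OF assms] by (simp add: power2_eq_square)
qed

lemma sum_time_haar_after:
  assumes "h > 0" "k < K" "n div (2 * h) \<noteq> k"
  shows "(\<Sum>N<K * 2 * h. (if n < N then 1 else 0) * time_haar h k N) = 0"
proof (cases "n < k * (2 * h)")
  case True
  then show ?thesis unfolding sum_time_haar[OF assms(1,2)] by (simp add: algebra_simps)
next
  case False
  then have "k \<le> n div (2 * h)" using assms(1) by (simp add: less_eq_div_iff_mult_less_eq)
  then have "(k + 1) * (2 * h) \<le> n"
    using assms(1,3) less_eq_div_iff_mult_less_eq[of "2 * h" "k + 1" n] by simp
  then have "\<not> n < (2 * k + 1) * h + b" "\<not> n < 2 * k * h + b" if "b < h" for b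
    using that by (auto simp: algebra_simps)
  then show ?thesis unfolding sum_time_haar[OF assms(1,2)] by (simp del: mult_Suc)
qed

lemma time_haar_orthogonal:
  assumes "k \<noteq> k'"
  shows "time_haar h k N * time_haar h k' N = 0"
  using assms by (auto simp: time_haar_def haar_sign_def split: if_splits)

text \<open>A box is given by its levels in space, its position in time and its positions in space. The level in
time is determined by the levels in space, since all boxes have the same volume.\<close>

type_synonym box = "(nat \<Rightarrow> nat) \<times> nat \<times> (nat \<Rightarrow> nat)"

definition box_weight :: "nat \<Rightarrow> (nat \<Rightarrow> nat) \<Rightarrow> nat" where
  "box_weight s r = (\<Sum>i\<in>{1..s}. r i)"

text \<open>With \<open>w\<close> the sum of the levels, it is chosen such that a time block of length \<open>2\<^bsup>w-1\<^esup>\<close> times a space box of volume \<open>2\<^bsup>-w\<^esup>\<close> has measure \<open>1/2\<close>. Then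
\<open>2\<^sup>m\<close> points and \<open>2\<^bsup>m+1\<^esup>\<close> boxes face each other for every vector of levels.\<close>

definition time_half_length :: "nat \<Rightarrow> (nat \<Rightarrow> nat) \<Rightarrow> nat" where
  "time_half_length s r = 2 ^ (box_weight s r - 2)"

definition box_time :: "nat \<Rightarrow> box \<Rightarrow> nat \<Rightarrow> real" where
  "box_time s = (\<lambda>(r, a, k). time_haar (time_half_length s r) a)"

definition box_space :: "nat \<Rightarrow> box \<Rightarrow> (nat \<Rightarrow> real) \<Rightarrow> real" where
  "box_space s = (\<lambda>(r, a, k) t. \<Prod>i\<in>{1..s}. haar (r i) (k i) (t i))"

text \<open>Levels start at \<open>2\<close> so that the exponent \<open>w - 2\<close> in \<open>time_half_length\<close> is not truncated. The levels in space
vary independently; hence two different vectors differ in a space coordinate, and orthogonality of the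
space factors suffices.\<close>

definition level_vectors :: "nat \<Rightarrow> nat \<Rightarrow> (nat \<Rightarrow> nat) set" where
  "level_vectors s q = Pi\<^sub>E {1..s} (\<lambda>_. {2..q + 1})"

definition boxes_of_level :: "nat \<Rightarrow> nat \<Rightarrow> (nat \<Rightarrow> nat) \<Rightarrow> (nat \<times> (nat \<Rightarrow> nat)) set" where
  "boxes_of_level s m r = {..<2 ^ (m + 1 - box_weight s r)} \<times> Pi\<^sub>E {1..s} (\<lambda>i. {..<2 ^ r i})"

definition point_box :: "nat \<Rightarrow> (nat \<Rightarrow> nat \<Rightarrow> real) \<Rightarrow> (nat \<Rightarrow> nat) \<Rightarrow> nat \<Rightarrow> nat \<times> (nat \<Rightarrow> nat)" where
  "point_box s x r n = (n div (2 * time_half_length s r), \<lambda>i\<in>{1..s}. nat \<lfloor>x n i * 2 ^ r i\<rfloor>)"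

definition empty_boxes :: "nat \<Rightarrow> nat \<Rightarrow> nat \<Rightarrow> (nat \<Rightarrow> nat \<Rightarrow> real) \<Rightarrow> box set" where
  "empty_boxes s m q x = (SIGMA r:level_vectors s q. boxes_of_level s m r - point_box s x r ` {..<2 ^ m})"

lemma box_weight_bounds:
  assumes "r \<in> level_vectors s q" "s \<ge> 1" "s * (q + 1) \<le> m + 1"
  shows "2 \<le> box_weight s r" "box_weight s r \<le> m + 1"
proof -
  have r: "2 \<le> r i" "r i \<le> q + 1" if "i \<in> {1..s}" for i
    using PiE_mem[OF assms(1)[unfolded level_vectors_def] that] by auto
  have "2 \<le> r 1" using r(1)[of 1] assms(2) by simp
  also have "r 1 \<le> box_weight s r" unfolding box_weight_def using assms(2) by (intro member_le_sum) auto
  finally show "2 \<le> box_weight s r" .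
  have "box_weight s r \<le> (\<Sum>i\<in>{1..s}. q + 1)" unfolding box_weight_def using r(2) by (intro sum_mono)
  then show "box_weight s r \<le> m + 1" using assms(3) by simp
qed

lemma time_length:
  assumes "2 \<le> box_weight s r" "box_weight s r \<le> m + 1"
  shows "2 ^ (m + 1 - box_weight s r) * 2 * time_half_length s r = 2 ^ m"
proof -
  have "2 ^ (m + 1 - box_weight s r) * 2 * time_half_length s r = (2::nat) ^ ((m + 1 - box_weight s r) + 1 + (box_weight s r - 2))"
    unfolding time_half_length_def by (simp only: power_add power_one_right)
  also have "(m + 1 - box_weight s r) + 1 + (box_weight s r - 2) = m" using assms by simp
  finally show ?thesis .
qed

lemma card_boxes_of_level:
  assumes "box_weight s r \<le> m + 1"
  shows "card (boxes_of_level s m r) = 2 * 2 ^ m" "finite (boxes_of_level s m r)"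
proof -
  have "card (boxes_of_level s m r) = 2 ^ (m + 1 - box_weight s r) * (\<Prod>i\<in>{1..s}. 2 ^ r i)"
    unfolding boxes_of_level_def by (simp add: card_cartesian_product card_PiE)
  also have "(\<Prod>i\<in>{1..s}. 2 ^ r i) = (2::nat) ^ box_weight s r" unfolding box_weight_def by (rule power_sum[symmetric])
  also have "2 ^ (m + 1 - box_weight s r) * 2 ^ box_weight s r = (2::nat) ^ (m + 1)"
    using assms by (simp only: power_add[symmetric] le_add_diff_inverse2)
  finally show "card (boxes_of_level s m r) = 2 * 2 ^ m" by simp
  show "finite (boxes_of_level s m r)" unfolding boxes_of_level_def by (intro finite_cartesian_product finite_PiE) auto
qed

text \<open>For each vector of levels, \<open>2\<^sup>m\<close> points can occupy at most half of the boxes.\<close>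

lemma card_empty_boxes:
  assumes "s \<ge> 1" "s * (q + 1) \<le> m + 1"
  shows "finite (empty_boxes s m q x)" "real (card (empty_boxes s m q x)) \<ge> real q ^ s * 2 ^ m"
proof -
  have fin: "finite (level_vectors s q)" unfolding level_vectors_def by (intro finite_PiE) auto
  have finb: "finite (boxes_of_level s m r - point_box s x r ` {..<2 ^ m})" if "r \<in> level_vectors s q" for r
    using card_boxes_of_level(2)[OF box_weight_bounds(2)[OF that assms]] by simp
  show "finite (empty_boxes s m q x)" unfolding empty_boxes_def using fin finb by (intro finite_SigmaI)
  have "q ^ s * 2 ^ m = (\<Sum>r\<in>level_vectors s q. 2 ^ m)"
    unfolding level_vectors_def by (simp add: card_PiE)
  also have "\<dots> \<le> (\<Sum>r\<in>level_vectors s q. card (boxes_of_level s m r - point_box s x r ` {..<2 ^ m}))"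
  proof (intro sum_mono)
    fix r assume r: "r \<in> level_vectors s q"
    have "card (point_box s x r ` {..<2 ^ m}) \<le> 2 ^ m" using card_image_le[of "{..<2 ^ m}" "point_box s x r"] by simp
    moreover have "card (boxes_of_level s m r) - card (point_box s x r ` {..<2 ^ m})
        \<le> card (boxes_of_level s m r - point_box s x r ` {..<2 ^ m})"
      by (rule diff_card_le_card_Diff) simp
    ultimately show "2 ^ m \<le> card (boxes_of_level s m r - point_box s x r ` {..<2 ^ m})"
      using card_boxes_of_level(1)[OF box_weight_bounds(2)[OF r assms]] by linarith
  qed
  also have "\<dots> = card (empty_boxes s m q x)"
    unfolding empty_boxes_def using fin finb by (subst card_SigmaI) auto
  finally have "real (q ^ s * 2 ^ m) \<le> real (card (empty_boxes s m q x))" by (simp only: of_nat_le_iff)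
  then show "real (card (empty_boxes s m q x)) \<ge> real q ^ s * 2 ^ m" by simp
qed

definition box_inner :: "nat \<Rightarrow> box \<Rightarrow> box \<Rightarrow> real" where
  "box_inner s = (\<lambda>(r, a, k) (r', a', k'). \<Prod>i\<in>{1..s}. unit_integral (\<lambda>x. haar (r i) (k i) x * haar (r' i) (k' i) x))"

lemma has_cube_integral_box_box:
  "has_cube_integral {1..s} (\<lambda>t. box_space s j t * box_space s j' t) (box_inner s j j')"
  unfolding box_space_def box_inner_def split_beta prod.distrib[symmetric]
  by (intro has_cube_integral_prod bounded_on_unit_mult bounded_on_unit_haar) simp

text \<open>Boxes with different levels or positions in space are orthogonal in space, and boxes that differ only
in time have disjoint supports. The square of the norm is the measure \<open>1/2\<close> of the box.\<close>

lemma sum_box_inner: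
  assumes "s \<ge> 1" "s * (q + 1) \<le> m + 1" "j \<in> empty_boxes s m q x" "j' \<in> empty_boxes s m q x"
  shows "(\<Sum>N<2 ^ m. box_time s j N * box_time s j' N * box_inner s j j') = (if j = j' then 1 / 2 else 0)"
proof -
  obtain r a k r' a' k' where j: "j = (r, a, k)" "j' = (r', a', k')" by (metis prod_cases3)
  have r: "r \<in> level_vectors s q" "r' \<in> level_vectors s q"
    and a: "a < 2 ^ (m + 1 - box_weight s r)"
    and k: "k \<in> Pi\<^sub>E {1..s} (\<lambda>i. {..<2 ^ r i})" "k' \<in> Pi\<^sub>E {1..s} (\<lambda>i. {..<2 ^ r' i})"
    using assms(3,4) unfolding j empty_boxes_def boxes_of_level_def by auto
  have ki: "k i < 2 ^ r i" "k' i < 2 ^ r' i" if "i \<in> {1..s}" for i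
    using PiE_mem[OF k(1) that] PiE_mem[OF k(2) that] by auto
  show ?thesis
  proof (cases "r = r' \<and> k = k'")
    case False
    then obtain i where i: "i \<in> {1..s}" "(r i, k i) \<noteq> (r' i, k' i)"
    proof -
      assume *: "\<And>i. i \<in> {1..s} \<Longrightarrow> (r i, k i) \<noteq> (r' i, k' i) \<Longrightarrow> thesis"
      show thesis
      proof (rule ccontr)
        assume "\<not> thesis"
        then have eq: "r i = r' i" "k i = k' i" if "i \<in> {1..s}" for i using * that by blast+
        have "r = r'" using r eq(1) unfolding level_vectors_def by (intro PiE_ext[of r _ _ r']) auto
        moreover have "k = k'" using k eq(2) \<open>r = r'\<close> by (intro PiE_ext[of k _ _ k']) auto
        ultimately show False using False by simp
      qed
    qed
    have "unit_integral (\<lambda>x. haar (r i) (k i) x * haar (r' i) (k' i) x) = 0"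
      using i ki by (intro unit_integral_haar_orthogonal) auto
    then have "box_inner s j j' = 0" unfolding j box_inner_def using i(1) by (auto intro!: prod_zero)
    then show ?thesis using False j by auto
  next
    case True
    note w = box_weight_bounds[OF r(1) assms(1,2)]
    have h: "time_half_length s r > 0" by (simp add: time_half_length_def)
    show ?thesis
    proof (cases "a = a'")
      case False
      then show ?thesis using True j by (simp add: box_time_def time_haar_orthogonal)
    next
      case a': True
      have "box_inner s j j' = (\<Prod>i\<in>{1..s}. 1 / 2 ^ r i)"
        unfolding j box_inner_def using True ki by (auto intro!: prod.cong simp: unit_integral_haar_square)
      also have "\<dots> = 1 / 2 ^ box_weight s r"
        unfolding box_weight_def by (simp add: prod_dividef power_sum)
      finally have inner: "box_inner s j j' = 1 / 2 ^ box_weight s r" .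
      have "(\<Sum>N<2 ^ m. box_time s j N * box_time s j' N) = 2 * real (time_half_length s r)"
        using sum_time_haar_square[OF h a, unfolded time_length[OF w]] True a' j
        by (simp add: box_time_def)
      then have "(\<Sum>N<2 ^ m. box_time s j N * box_time s j' N * box_inner s j j')
          = 2 * real (time_half_length s r) / 2 ^ box_weight s r"
        unfolding sum_distrib_right[symmetric] inner by simp
      also have "\<dots> = 1 / 2"
      proof -
        have "(2::real) ^ box_weight s r = 2 ^ (box_weight s r - 2) * 2 ^ 2"
          using w(1) by (simp only: power_add[symmetric] le_add_diff_inverse2)
        then show ?thesis by (simp add: time_half_length_def)
      qed
      finally show ?thesis using True a' j by simp
    qed
  qed
qed

definition box_coefficient :: "nat \<Rightarrow> (nat \<Rightarrow> nat \<Rightarrow> real) \<Rightarrow> nat \<Rightarrow> box \<Rightarrow> real" where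
  "box_coefficient s x N = (\<lambda>(r, a, k). (\<Sum>n<N. \<Prod>i\<in>{1..s}. unit_integral (\<lambda>t. indicator {x n i<..} t * haar (r i) (k i) t))
     - real N * (\<Prod>i\<in>{1..s}. unit_integral (\<lambda>t. t * haar (r i) (k i) t)))"

lemma has_cube_integral_discrepancy_box:
  "has_cube_integral {1..s} (\<lambda>t. scaled_discrepancy {1..s} x N t * box_space s j t) (box_coefficient s x N j)"
  unfolding scaled_discrepancy_def box_space_def box_coefficient_def split_beta left_diff_distrib
    sum_distrib_right mult.assoc prod.distrib[symmetric]
  by (intro has_cube_integral_diff has_cube_integral_sum has_cube_integral_cmult has_cube_integral_prod
      bounded_on_unit_mult bounded_on_unit_haar bounded_on_unit_id bounded_on_unit_indicator) simp_all

text \<open>In the counting part each point misses the box in time or in some space coordinate, which makes the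
corresponding factor vanish. The linear part \<open>N \<Prod>\<^sub>i t\<^sub>i\<close> gives \<open>h\<^sup>2 \<Prod>\<^sub>i 4\<^bsup>-r\<^sub>i-1\<^esup>\<close> with \<open>h\<close> the half-length in time,
where the levels cancel.\<close>

lemma sum_box_coefficient:
  assumes "s \<ge> 1" "s * (q + 1) \<le> m + 1" "j \<in> empty_boxes s m q x" and x: "\<And>n. x n \<in> unit_cube s"
  shows "(\<Sum>N<2 ^ m. box_time s j N * box_coefficient s x N j) = - (1 / 4 ^ (s + 2))"
proof -
  obtain r a k where j: "j = (r, a, k)" by (metis prod_cases3)
  have r: "r \<in> level_vectors s q" and a: "a < 2 ^ (m + 1 - box_weight s r)"
    and k: "k \<in> Pi\<^sub>E {1..s} (\<lambda>i. {..<2 ^ r i})"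
    and empty: "\<And>n. n < 2 ^ m \<Longrightarrow> (a, k) \<noteq> point_box s x r n"
    using assms(3) unfolding j empty_boxes_def boxes_of_level_def by auto
  have ki: "k i < 2 ^ r i" if "i \<in> {1..s}" for i using PiE_mem[OF k that] by auto
  note w = box_weight_bounds[OF r assms(1,2)]
  define h where "h = time_half_length s r"
  have h: "h > 0" by (simp add: h_def time_half_length_def)
  have M: "2 ^ (m + 1 - box_weight s r) * 2 * h = 2 ^ m" unfolding h_def by (rule time_length[OF w])
  let ?c = "\<lambda>n. \<Prod>i\<in>{1..s}. unit_integral (\<lambda>t. indicator {x n i<..} t * haar (r i) (k i) t)"
  let ?v = "\<Prod>i\<in>{1..s}. unit_integral (\<lambda>t. t * haar (r i) (k i) t)"
  \<comment> \<open>The point \<open>x n\<close> counts for \<open>N\<close> only when \<open>n < N\<close>; this condition is the time factor of its contribution.\<close>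
  have vanish: "(\<Sum>N<2 ^ m. (if n < N then 1 else 0) * time_haar h a N) * ?c n = 0" if n: "n < 2 ^ m" for n
  proof (cases "n div (2 * h) = a")
    case False
    then show ?thesis using sum_time_haar_after[OF h a, of n] M by simp
  next
    case True
    have "\<exists>i\<in>{1..s}. k i \<noteq> nat \<lfloor>x n i * 2 ^ r i\<rfloor>"
    proof (rule ccontr)
      assume "\<not> ?thesis"
      then have "k = (\<lambda>i\<in>{1..s}. nat \<lfloor>x n i * 2 ^ r i\<rfloor>)"
        using k by (intro extensionalityI[of _ "{1..s}"]) (auto simp: PiE_def)
      then show False using empty[OF n] True unfolding point_box_def h_def by simp
    qed
    then obtain i where i: "i \<in> {1..s}" "k i \<noteq> nat \<lfloor>x n i * 2 ^ r i\<rfloor>" by blast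
    have "unit_integral (\<lambda>t. indicator {x n i<..} t * haar (r i) (k i) t) = 0"
      using i ki by (intro unit_integral_indicator_haar) auto
    then have "?c n = 0" using i(1) by (intro prod_zero) auto
    then show ?thesis by simp
  qed
  have "(\<Sum>N<2 ^ m. box_time s j N * box_coefficient s x N j)
      = (\<Sum>N<2 ^ m. \<Sum>n<2 ^ m. (if n < N then 1 else 0) * time_haar h a N * ?c n)
        - (\<Sum>N<2 ^ m. real N * time_haar h a N) * ?v"
  proof -
    have "box_time s j N * box_coefficient s x N j
        = (\<Sum>n<2 ^ m. (if n < N then 1 else 0) * time_haar h a N * ?c n) - real N * time_haar h a N * ?v"
      if "N < 2 ^ m" for N
    proof -
      have "(\<Sum>n<N. ?c n) = (\<Sum>n<2 ^ m. if n < N then ?c n else 0)"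
        using that by (intro sum.mono_neutral_cong_left) auto
      then have "time_haar h a N * (\<Sum>n<N. ?c n) = (\<Sum>n<2 ^ m. time_haar h a N * (if n < N then ?c n else 0))"
        by (simp only: sum_distrib_left)
      also have "\<dots> = (\<Sum>n<2 ^ m. (if n < N then 1 else 0) * time_haar h a N * ?c n)"
        by (intro sum.cong) auto
      finally show ?thesis
        unfolding j box_time_def box_coefficient_def by (simp add: right_diff_distrib h_def[symmetric] mult.commute)
    qed
    then show ?thesis by (simp add: sum_subtractf sum_distrib_right)
  qed
  also have "(\<Sum>N<2 ^ m. \<Sum>n<2 ^ m. (if n < N then 1 else 0) * time_haar h a N * ?c n)
      = (\<Sum>n<2 ^ m. (\<Sum>N<2 ^ m. (if n < N then 1 else 0) * time_haar h a N) * ?c n)"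
    by (subst sum.swap) (simp only: sum_distrib_right)
  also have "\<dots> = 0" using vanish by (intro sum.neutral) auto
  also have "(\<Sum>N<2 ^ m. real N * time_haar h a N) = (real h)\<^sup>2"
    using sum_time_haar_id[OF h a] M by simp
  also have "?v = 1 / (4 ^ box_weight s r * 4 ^ s)"
  proof -
    have "?v = (\<Prod>i\<in>{1..s}. 1 / 4 ^ Suc (r i))" using ki by (intro prod.cong refl unit_integral_id_haar)
    also have "\<dots> = 1 / 4 ^ (\<Sum>i\<in>{1..s}. Suc (r i))" by (simp only: prod_dividef prod.neutral_const power_sum)
    also have "(\<Sum>i\<in>{1..s}. Suc (r i)) = box_weight s r + s" by (simp add: box_weight_def sum_Suc)
    finally show ?thesis by (simp add: power_add)
  qed
  also have "(real h)\<^sup>2 = 4 ^ (box_weight s r - 2)"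
    unfolding h_def time_half_length_def by (simp add: power2_eq_square power_mult_distrib[symmetric])
  also have "0 - 4 ^ (box_weight s r - 2) * (1 / (4 ^ box_weight s r * 4 ^ s)) = - (1 / 4 ^ (s + 2 :: nat) :: real)"
  proof -
    have "(4::real) ^ box_weight s r = 4 ^ (box_weight s r - 2) * 4 ^ 2"
      using w(1) by (simp only: power_add[symmetric] le_add_diff_inverse2)
    then show ?thesis by (simp add: power_add)
  qed
  finally show ?thesis .
qed

text \<open>Bessel's inequality for the orthogonal family of empty boxes, obtained from the nonnegative square of
\<open>N \<Delta>\<^sub>N + 2 c \<Sum>\<^sub>j e\<^sub>j\<close>. With \<open>\<langle>N \<Delta>\<^sub>N, e\<^sub>j\<rangle> = -c\<close> and \<open>\<parallel>e\<^sub>j\<parallel>\<^sup>2 = 1/2\<close> the factor \<open>2 c\<close> is the optimal one.\<close>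

lemma sum_squared_discrepancy_lower_bound:
  assumes "s \<ge> 1" "s * (q + 1) \<le> m + 1" and x: "\<And>n. x n \<in> unit_cube s"
  shows "(\<Sum>N<2 ^ m. squared_discrepancy {1..s} x N) \<ge> 2 / 16 ^ (s + 2) * (real q ^ s * 2 ^ m)"
proof -
  let ?E = "empty_boxes s m q x" and ?D = "scaled_discrepancy {1..s} x"
  define c :: real where "c = 1 / 4 ^ (s + 2)"
  have fin: "finite ?E" by (rule card_empty_boxes(1)[OF assms(1,2)])
  let ?Q = "\<lambda>N. squared_discrepancy {1..s} x N + 2 * (2 * c) * (\<Sum>j\<in>?E. box_time s j N * box_coefficient s x N j)
      + (2 * c)\<^sup>2 * (\<Sum>j\<in>?E. \<Sum>j'\<in>?E. box_time s j N * box_time s j' N * box_inner s j j')"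
  have "0 \<le> ?Q N" for N
  proof -
    \<comment> \<open>Written with all products over coordinates exposed, as the integration rules need them.\<close>
    have expand: "(?D N t + 2 * c * (\<Sum>j\<in>?E. box_time s j N * box_space s j t))\<^sup>2
       = (?D N t)\<^sup>2 + 2 * (2 * c) * (\<Sum>j\<in>?E. box_time s j N * (?D N t * box_space s j t))
        + (2 * c)\<^sup>2 * (\<Sum>j\<in>?E. \<Sum>j'\<in>?E. (box_time s j N * box_time s j' N) * (box_space s j t * box_space s j' t))" for t
    proof -
      have 1: "(\<Sum>j\<in>?E. box_time s j N * (?D N t * box_space s j t)) = ?D N t * (\<Sum>j\<in>?E. box_time s j N * box_space s j t)"
        by (simp add: sum_distrib_left mult_ac)
      have 2: "(\<Sum>j\<in>?E. \<Sum>j'\<in>?E. (box_time s j N * box_time s j' N) * (box_space s j t * box_space s j' t))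
         = (\<Sum>j\<in>?E. box_time s j N * box_space s j t) * (\<Sum>j\<in>?E. box_time s j N * box_space s j t)"
        unfolding sum_product by (intro sum.cong refl) (simp add: mult_ac)
      show ?thesis unfolding 1 2 by (simp add: power2_eq_square algebra_simps)
    qed
    have "has_cube_integral {1..s} (\<lambda>t. (?D N t + 2 * c * (\<Sum>j\<in>?E. box_time s j N * box_space s j t))\<^sup>2) (?Q N)"
      unfolding expand
      using unit_cube_bounds[OF x]
      by (intro has_cube_integral_add has_cube_integral_cmult has_cube_integral_sum
          has_cube_integral_discrepancy_box has_cube_integral_box_box has_cube_integral_squared_discrepancy) auto
    then show ?thesis by (rule has_cube_integral_nonneg) simp
  qed
  then have "0 \<le> (\<Sum>N<2 ^ m. ?Q N)" by (intro sum_nonneg)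
  also have "\<dots> = (\<Sum>N<2 ^ m. squared_discrepancy {1..s} x N)
      + 2 * (2 * c) * (\<Sum>j\<in>?E. \<Sum>N<2 ^ m. box_time s j N * box_coefficient s x N j)
      + (2 * c)\<^sup>2 * (\<Sum>j\<in>?E. \<Sum>j'\<in>?E. \<Sum>N<2 ^ m. box_time s j N * box_time s j' N * box_inner s j j')"
  proof -
    have "(\<Sum>N<2 ^ m. \<Sum>j\<in>?E. box_time s j N * box_coefficient s x N j)
        = (\<Sum>j\<in>?E. \<Sum>N<2 ^ m. box_time s j N * box_coefficient s x N j)" by (rule sum.swap)
    moreover have "(\<Sum>N<2 ^ m. \<Sum>j\<in>?E. \<Sum>j'\<in>?E. box_time s j N * box_time s j' N * box_inner s j j')
        = (\<Sum>j\<in>?E. \<Sum>j'\<in>?E. \<Sum>N<2 ^ m. box_time s j N * box_time s j' N * box_inner s j j')"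
      by (subst sum.swap, intro sum.cong refl, rule sum.swap)
    ultimately show ?thesis by (simp only: sum.distrib sum_distrib_left[symmetric])
  qed
  also have "(\<Sum>j\<in>?E. \<Sum>N<2 ^ m. box_time s j N * box_coefficient s x N j) = (\<Sum>j\<in>?E. - c)"
    unfolding c_def by (intro sum.cong refl sum_box_coefficient[OF assms(1,2) _ x])
  also have "(\<Sum>j\<in>?E. \<Sum>j'\<in>?E. \<Sum>N<2 ^ m. box_time s j N * box_time s j' N * box_inner s j j')
      = (\<Sum>j\<in>?E. \<Sum>j'\<in>?E. if j = j' then 1 / 2 else 0)"
    by (intro sum.cong refl sum_box_inner[OF assms(1,2)])
  also have "\<dots> = (\<Sum>j\<in>?E. 1 / 2)" using fin by (intro sum.cong refl) simp
  finally have "2 * c\<^sup>2 * real (card ?E) \<le> (\<Sum>N<2 ^ m. squared_discrepancy {1..s} x N)"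
    by (simp add: power2_eq_square algebra_simps)
  moreover have "2 * c\<^sup>2 * (real q ^ s * 2 ^ m) \<le> 2 * c\<^sup>2 * real (card ?E)"
    by (intro mult_left_mono card_empty_boxes(2)[OF assms(1,2)]) simp
  moreover have "c\<^sup>2 = 1 / 16 ^ (s + 2)"
  proof -
    have "(4 ^ n)\<^sup>2 = (16 ^ n :: real)" for n by (simp add: power2_eq_square power_mult_distrib[symmetric])
    then show ?thesis unfolding c_def power_divide by (simp only: power_one)
  qed
  ultimately show ?thesis by simp
qed

section \<open>Order of magnitude of the discrepancy\<close>

text \<open>The admissible levels go up to about \<open>m / (2 s)\<close>, so that their sum is at most \<open>m + 1\<close>, the number
of halvings that lead to a box.\<close>

lemma sum_scaled_L2_lower_bound:
  assumes "s \<ge> 1" "m \<ge> 4 * s" "\<And>n. x n \<in> unit_cube s"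
  shows "(\<Sum>N<2 ^ m. (real N * L2_discrepancy s N x)\<^sup>2)
    \<ge> 2 / (16 ^ (s + 2) * (4 * real s) ^ s) * (2 ^ m * real m ^ s)"
proof -
  define q where "q = m div (2 * s)"
  have "m < 2 * s * (q + 1)" unfolding q_def 
    using dividend_less_times_div[of "2 * s" m] assms(1) by (simp add: algebra_simps)
  then have "real m < real (2 * s * (q + 1))" by (simp only: of_nat_less_iff)
  moreover have "real (4 * s) \<le> real m" using assms(2) by (simp only: of_nat_le_iff)
  ultimately have "real m \<le> real q * (4 * real s)" by (simp add: algebra_simps)
  then have q: "real m / (4 * real s) \<le> real q" using assms(1) by (simp add: divide_le_eq)
  have "2 * s * q \<le> m" unfolding q_def by (rule times_div_less_eq_dividend)
  then have qm: "s * (q + 1) \<le> m + 1" using assms(2) by (simp add: algebra_simps)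
  have "2 / (16 ^ (s + 2) * (4 * real s) ^ s) * (2 ^ m * real m ^ s)
      = 2 / 16 ^ (s + 2) * ((real m / (4 * real s)) ^ s * 2 ^ m)"
    by (simp add: power_divide mult_ac)
  also have "\<dots> \<le> 2 / 16 ^ (s + 2) * (real q ^ s * 2 ^ m)"
    by (intro mult_left_mono mult_right_mono power_mono q) auto
  also have "\<dots> \<le> (\<Sum>N<2 ^ m. squared_discrepancy {1..s} x N)"
    by (rule sum_squared_discrepancy_lower_bound[OF assms(1) qm assms(3)])
  also have "\<dots> \<le> (\<Sum>N<2 ^ m. (real N * L2_discrepancy s N x)\<^sup>2)"
  proof (intro sum_mono)
    fix N
    show "squared_discrepancy {1..s} x N \<le> (real N * L2_discrepancy s N x)\<^sup>2"
      unfolding scaled_L2_discrepancy[OF assms(3)]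
    proof (rule member_le_sum)
      show "{1..s} \<in> {u. u \<noteq> {} \<and> u \<subseteq> {1..s}}" using assms(1) by auto
      fix u assume "u \<in> {u. u \<noteq> {} \<and> u \<subseteq> {1..s}} - {{1..s}}"
      then show "0 \<le> squared_discrepancy u x N"
        using unit_cube_bounds[OF assms(3)] finite_subset[of u "{1..s}"]
        by (intro squared_discrepancy_nonneg) auto
    qed simp
  qed
  finally show ?thesis .
qed

text \<open>If \<open>A\<close> were smaller than claimed for all but finitely many \<open>N\<close>, the sum over \<open>N < 2\<^sup>m\<close> would be at most half of
the assumed lower bound plus a constant, since \<open>ln N \<le> m\<close>.\<close>

lemma infinite_of_dyadic_square_sums:
  fixes A :: "nat \<Rightarrow> real"
  assumes nonneg: "\<And>N. 0 \<le> A N" and "c > 0"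
    and sums: "\<And>m. m \<ge> m0 \<Longrightarrow> c * (2 ^ m * real m ^ s) \<le> (\<Sum>N<2 ^ m. (real N * A N)\<^sup>2)"
  shows "infinite {N. N \<ge> 2 \<and> A N \<ge> sqrt (c / 2) * (ln (real N) powr (real s / 2) / real N)}"
proof
  let ?S = "{N. N \<ge> 2 \<and> A N \<ge> sqrt (c / 2) * (ln (real N) powr (real s / 2) / real N)}"
  assume "finite ?S"
  then obtain N1 where "\<forall>N\<in>?S. N < N1" unfolding finite_nat_set_iff_bounded by blast
  then have N1: "\<And>N. N \<ge> 2 \<Longrightarrow> A N \<ge> sqrt (c / 2) * (ln (real N) powr (real s / 2) / real N) \<Longrightarrow> N < N1"
    by blast
  define K where "K = (\<Sum>N<N1 + 2. (real N * A N)\<^sup>2)"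
  have bound: "2 ^ m \<le> 2 * K / c" if m: "m \<ge> m0" "m \<ge> 1" for m
  proof -
    have each: "(real N * A N)\<^sup>2 \<le> (if N < N1 + 2 then (real N * A N)\<^sup>2 else 0) + c / 2 * real m ^ s" if N: "N < 2 ^ m" for N
    proof (cases "N < N1 + 2")
      case True
      then show ?thesis using \<open>c > 0\<close> by simp
    next
      case False
      then have N2: "N \<ge> 2" "\<not> N < N1" by auto
      then have "A N < sqrt (c / 2) * (ln (real N) powr (real s / 2) / real N)" using N1 by force
      then have "real N * A N \<le> sqrt (c / 2) * ln (real N) powr (real s / 2)"
        using N2 by (simp add: field_simps)
      then have "(real N * A N)\<^sup>2 \<le> (sqrt (c / 2) * ln (real N) powr (real s / 2))\<^sup>2"
        using nonneg by (intro power_mono) auto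
      also have "\<dots> = c / 2 * ln (real N) ^ s"
        using \<open>c > 0\<close> N2 by (subst ln_powr_half_power2) auto
      also have "\<dots> \<le> c / 2 * real m ^ s"
      proof (intro mult_left_mono power_mono)
        have "real N \<le> 2 ^ m" using N by (metis less_imp_le of_nat_le_iff of_nat_numeral of_nat_power)
        then have "ln (real N) \<le> ln (2 ^ m)" using N2 by (subst ln_le_cancel_iff) auto
        also have "\<dots> = real m * ln 2" by (simp add: ln_realpow)
        also have "\<dots> \<le> real m * 1" using ln_le_minus_one[of 2] by (intro mult_left_mono) auto
        finally show "ln (real N) \<le> real m" by simp
      qed (use \<open>c > 0\<close> N2 in auto)
      finally show ?thesis using False by simp
    qed
    have "c * (2 ^ m * real m ^ s) \<le> (\<Sum>N<2 ^ m. (real N * A N)\<^sup>2)" by (rule sums[OF m(1)])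
    also have "\<dots> \<le> (\<Sum>N<2 ^ m. (if N < N1 + 2 then (real N * A N)\<^sup>2 else 0) + c / 2 * real m ^ s)"
      using each by (intro sum_mono) auto
    also have "\<dots> = (\<Sum>N<2 ^ m. if N < N1 + 2 then (real N * A N)\<^sup>2 else 0) + c / 2 * (2 ^ m * real m ^ s)"
      by (simp add: sum.distrib)
    also have "(\<Sum>N<2 ^ m. if N < N1 + 2 then (real N * A N)\<^sup>2 else 0)
        = (\<Sum>N\<in>{..<2 ^ m} \<inter> {..<N1 + 2}. (real N * A N)\<^sup>2)"
      by (subst sum.inter_restrict) auto
    also have "\<dots> \<le> K" unfolding K_def by (intro sum_mono2) auto
    finally have "c / 2 * (2 ^ m * real m ^ s) \<le> K" by simp
    moreover have "c / 2 * (2 ^ m * 1) \<le> c / 2 * (2 ^ m * real m ^ s)"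
      using \<open>c > 0\<close> m(2) by (intro mult_left_mono one_le_power) auto
    ultimately have "c / 2 * (2 ^ m * 1) \<le> K" by (rule order_trans[rotated])
    then show ?thesis using \<open>c > 0\<close> by (simp add: le_divide_eq mult_ac)
  qed
  obtain k :: nat where k: "2 * K / c < real k" using reals_Archimedean2 by blast
  have "real k < 2 ^ (k + m0 + 1)"
  proof -
    have "real k < 2 ^ k" by (rule of_nat_less_two_power)
    also have "\<dots> \<le> 2 ^ (k + m0 + 1)" by (intro power_increasing) auto
    finally show ?thesis .
  qed
  then show False using bound[of "k + m0 + 1"] k by simp
qed

theorem corollary2:
  fixes s :: nat and p :: "nat \<Rightarrow> nat"
  assumes "s \<ge> 1"
    and "\<And>i. i \<in> {1..s} \<Longrightarrow> prime (p i)"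
    and "inj_on p {1..s}"
  shows
    "(\<exists>C>0. \<forall>N\<ge>2. RMS_L2_discrepancy s N p \<le> C * (ln (real N) powr (real s / 2) / real N))
   \<and> (\<exists>c>0. \<forall>x :: nat \<Rightarrow> nat \<Rightarrow> real. (\<forall>n. x n \<in> unit_cube s) \<longrightarrow>
        infinite {N. N \<ge> 2 \<and> L2_discrepancy s N x \<ge> c * (ln (real N) powr (real s / 2) / real N)})
   \<and> (\<exists>c>0. infinite {N. N \<ge> 2 \<and>
        RMS_L2_discrepancy s N p \<ge> c * (ln (real N) powr (real s / 2) / real N)})
   \<and> (\<exists>C>0. \<forall>N\<ge>2. \<exists>\<sigma>\<in>unit_cube s.
        L2_discrepancy s N (shifted_halton s p \<sigma>) \<le> C * (ln (real N) powr (real s / 2) / real N))"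
proof -
  define c where "c = 2 / (16 ^ (s + 2) * (4 * real s) ^ s)"
  have c: "c > 0" using assms(1) by (simp add: c_def)
  obtain C where C: "C > 0" "\<And>N. N \<ge> 2 \<Longrightarrow> RMS_L2_discrepancy s N p \<le> C * (ln (real N) powr (real s / 2) / real N)"
    using RMS_L2_discrepancy_upper_bound[of s p] assms(2,3) by blast
  have "infinite {N. N \<ge> 2 \<and> L2_discrepancy s N x \<ge> sqrt (c / 2) * (ln (real N) powr (real s / 2) / real N)}"
    if "\<forall>n. x n \<in> unit_cube s" for x
    using sum_scaled_L2_lower_bound[OF assms(1)] that
    by (intro infinite_of_dyadic_square_sums[OF L2_discrepancy_nonneg c, of "4 * s"]) (simp add: c_def)
  moreover have "infinite {N. N \<ge> 2 \<and> RMS_L2_discrepancy s N p \<ge> sqrt (c / 2) * (ln (real N) powr (real s / 2) / real N)}"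
  proof (rule infinite_of_dyadic_square_sums[OF _ c])
    show "0 \<le> RMS_L2_discrepancy s N p" for N
      unfolding RMS_L2_discrepancy_def by (intro real_sqrt_ge_zero integral_nonneg) simp
    fix m assume m: "4 * s \<le> m"
    interpret P: prob_space "uniform_shift s"
      unfolding uniform_shift_eq by (intro prob_space_PiM prob_space_unit_measure)
    have int: "has_bochner_integral (uniform_shift s)
        (\<lambda>\<sigma>. \<Sum>N<2 ^ m. (real N * L2_discrepancy s N (shifted_halton s p \<sigma>))\<^sup>2)
        (\<Sum>N<2 ^ m. (real N * RMS_L2_discrepancy s N p)\<^sup>2)"
      by (intro has_bochner_integral_sum has_bochner_integral_scaled_L2)
    have "c * (2 ^ m * real m ^ s)
        \<le> (LINT \<sigma>|uniform_shift s. (\<Sum>N<2 ^ m. (real N * L2_discrepancy s N (shifted_halton s p \<sigma>))\<^sup>2))"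
      using int sum_scaled_L2_lower_bound[OF assms(1) m shifted_halton_in_unit_cube]
      by (intro P.integral_ge_const) (auto simp: c_def has_bochner_integral_iff)
    then show "c * (2 ^ m * real m ^ s) \<le> (\<Sum>N<2 ^ m. (real N * RMS_L2_discrepancy s N p)\<^sup>2)"
      unfolding has_bochner_integral_integral_eq[OF int] .
  qed
  \<comment> \<open>The constant \<open>C + 1\<close> makes the bound on the mean strict.\<close>
  moreover have "\<exists>\<sigma>\<in>unit_cube s. L2_discrepancy s N (shifted_halton s p \<sigma>)
      \<le> (C + 1) * (ln (real N) powr (real s / 2) / real N)" if N: "N \<ge> 2" for N
  proof (rule exists_shift_below_RMS)
    have "ln (real N) > 0" using N by simp
    then have "ln (real N) powr (real s / 2) / real N > 0" using N by simp
    then show "RMS_L2_discrepancy s N p < (C + 1) * (ln (real N) powr (real s / 2) / real N)"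
      using C(2)[OF N] unfolding distrib_right by linarith
  qed (use N in simp)
  moreover have "sqrt (c / 2) > 0" "C + 1 > 0" using c C(1) by auto
  ultimately show ?thesis using C by blast
qed

end
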